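(* Let $(A,\Delta)$ be an algebraic quantum group with dual $B=\widehat A$, and let $V\in M(B\otimes A)$ be the unique element with $\langle V,a\otimes b\rangle=\langle a,b\rangle$ for all $a\in A$, $b\in B$. Then $$(\iota\otimes\Delta)V=V_{12}V_{13}\qquad\text{and}\qquad(\Delta\otimes\iota)V=V_{13}V_{23},$$ where the first equation holds in $M(B\otimes A\otimes A)$ and the second in $M(B\otimes B\otimes A)$.
   Context: All algebras are associative algebras over $\mathbb C$, possibly non-unital, with non-degenerate product; $M(A)$ is the multiplier algebra of $A$; $\iota$ denotes identity maps. Regular multiplier Hopf algebra: an algebra $A$ with a homomorphism $\Delta:A\to M(A\otimes A)$ such that $\Delta(a)(1\otimes a')$, $(a\otimes 1)\Delta(a')$, $\Delta(a)(a'\otimes 1)$ and $(1\otimes a)\Delta(a')$ lie in $A\otimes A$ for all $a,a'$; $\Delta$ is coassociative, $(a\otimes1\otimes1)(\Delta\otimes\iota)(\Delta(c)(1\otimes a'))=((\iota\otimes\Delta)((a\otimes1)\Delta(c)))(1\otimes1\otimes a')$; and the maps $a\otimes a'\mapsto\Delta(a)(1\otimes a')$, $a\otimes a'\mapsto(a\otimes1)\Delta(a')$, and the same two maps for the flipped coproduct, are bijections of $A\otimes A$. It has a unique counit $\varepsilon$ and a bijective antipode $S$. A left integral is a non-zero linear functional $\varphi$ on $A$ with $(\iota\otimes\varphi)\Delta(a)=\varphi(a)1$ in $M(A)$ for all $a$. An algebraic quantum group is a regular multiplier Hopf algebra with (left and right) integrals. Fix a left integral $\varphi$. Dual: $B=\widehat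 A=\{\varphi(\,\cdot\,c):c\in A\}$, with $\langle a,b\rangle=b(a)$. Its product is $\langle a,bb'\rangle=\langle\Delta(a),b\otimes b'\rangle$; its coproduct $\Delta:B\to M(B\otimes B)$ is determined by $\langle a\otimes a',(b'\otimes1)\Delta(b)\rangle=\langle\Delta(a)(1\otimes a'),b'\otimes b\rangle$ and $\langle a\otimes a',\Delta(b)(1\otimes b')\rangle=\langle(a\otimes1)\Delta(a'),b\otimes b'\rangle$. $(B,\Delta)$ is again an algebraic quantum group. There are unital left actions given by $\langle a',a\triangleright b\rangle=\langle a'a,b\rangle$ and $\langle b\triangleright a,b'\rangle=\langle a,b'b\rangle$. The pairing of $B\otimes A$ with $A\otimes B$ is $\langle b\otimes a,a'\otimes b'\rangle=\langle a',b\rangle\langle a,b'\rangle$; it extends uniquely to $M(B\otimes A)\times(A\otimes B)$ by $\langle m,(b\triangleright a')\otimes(a\triangleright b')\rangle=\langle m(b\otimes a),a'\otimes b'\rangle$. This is the pairing in the definition of $V$; existence and uniqueness of $V$ are known. The maps $\iota\otimes\Delta:B\otimes A\to M(B\otimes A\otimes A)$ and $\Delta\otimes\iota:B\otimes A\to M(B\otimes B\otimes A)$ are non-degenerate homomorphisms and are extended to unital homomorphisms on $M(B\otimes A)$. Leg numbering: in $M(B\otimes A\otimes A)$, $V_{12}=V\otimes1$ and $V_{13}$ is obtained from $V_{12}$ by flipping the last two tensor factors; in $M(B\otimes B\otimes A)$, $V_{23}=1\otimes V$ and $V_{13}$ is $V$ placed in the first and third tensor factors. *)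

theory Defs
  imports Complex_Main "HOL-Library.Poly_Mapping"
begin

section \<open>Complex vector spaces and (possibly non-unital) complex algebras\<close>

class complex_vector = ab_group_add +
  fixes scaleC :: "complex \<Rightarrow> 'a \<Rightarrow> 'a" (infixr \<open>*\<^sub>C\<close> 75)
  assumes scaleC_add_right: "c *\<^sub>C (x + y) = c *\<^sub>C x + c *\<^sub>C y"
    and scaleC_add_left: "(c + d) *\<^sub>C x = c *\<^sub>C x + d *\<^sub>C x"
    and scaleC_scaleC: "c *\<^sub>C d *\<^sub>C x = (c * d) *\<^sub>C x"
    and scaleC_one: "1 *\<^sub>C x = x"

class complex_algebra = complex_vector + ring +
  assumes mult_scaleC_left: "(c *\<^sub>C x) * y = c *\<^sub>C (x * y)"
    and mult_scaleC_right: "x * (c *\<^sub>C y) = c *\<^sub>C (x * y)"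

class nondegenerate_algebra = complex_algebra +
  assumes nondegenerate_left: "(\<And>y. x * y = 0) \<Longrightarrow> x = 0"
    and nondegenerate_right: "(\<And>y. y * x = 0) \<Longrightarrow> x = 0"

global_interpretation complex_vector:
  vector_space "scaleC :: complex \<Rightarrow> 'a \<Rightarrow> 'a :: complex_vector"
  by unfold_locales
    (simp_all add: scaleC_add_right scaleC_add_left scaleC_scaleC scaleC_one)

abbreviation clinear :: "('a::complex_vector \<Rightarrow> 'b::complex_vector) \<Rightarrow> bool"
  where "clinear \<equiv> Vector_Spaces.linear scaleC scaleC"

lemma clinear_iff:
  "clinear f \<longleftrightarrow> (\<forall>x y. f (x + y) = f x + f y) \<and> (\<forall>c x. f (c *\<^sub>C x) = c *\<^sub>C f x)"
  by (simp add: Vector_Spaces.linear_iff complex_vector.vector_space_axioms)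

definition cbilinear ::
    "('a::complex_vector \<Rightarrow> 'b::complex_vector \<Rightarrow> 'c::complex_vector) \<Rightarrow> bool"
  where "cbilinear f \<longleftrightarrow> (\<forall>a. clinear (f a)) \<and> (\<forall>b. clinear (\<lambda>a. f a b))"

instantiation complex :: complex_algebra
begin

definition scaleC_complex :: "complex \<Rightarrow> complex \<Rightarrow> complex"
  where "scaleC_complex c z = c * z"

instance
  by standard (simp_all add: scaleC_complex_def algebra_simps)

end

instantiation poly_mapping :: (type, complex_vector) complex_vector
begin

definition scaleC_poly_mapping :: "complex \<Rightarrow> ('a \<Rightarrow>\<^sub>0 'b) \<Rightarrow> ('a \<Rightarrow>\<^sub>0 'b)"
  where "scaleC_poly_mapping c p = Poly_Mapping.map (scaleC c) p"

lemma lookup_scaleC: "Poly_Mapping.lookup (c *\<^sub>C p) k = c *\<^sub>C Poly_Mapping.lookup p k"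
  for p :: "'a \<Rightarrow>\<^sub>0 'b"
  by (simp add: scaleC_poly_mapping_def Poly_Mapping.map.rep_eq when_def complex_vector.scale_zero_right)

instance
  by standard
    (auto intro!: poly_mapping_eqI
      simp: lookup_scaleC lookup_add scaleC_add_right scaleC_add_left scaleC_scaleC scaleC_one)

end


section \<open>The algebraic tensor product\<close>

text \<open>
  The free vector space on pairs, modulo the subspace spanned by the bilinearity relations.
\<close>

definition tensor_relations ::
    "('a::complex_vector \<times> 'b::complex_vector \<Rightarrow>\<^sub>0 complex) set"
  where "tensor_relations =
    {Poly_Mapping.single (a + a', b) 1 - Poly_Mapping.single (a, b) 1
        - Poly_Mapping.single (a', b) 1 | a a' b. True}
    \<union> {Poly_Mapping.single (a, b + b') 1 - Poly_Mapping.single (a, b) 1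
        - Poly_Mapping.single (a, b') 1 | a b b'. True}
    \<union> {Poly_Mapping.single (c *\<^sub>C a, b) 1 - c *\<^sub>C Poly_Mapping.single (a, b) 1 | c a b. True}
    \<union> {Poly_Mapping.single (a, c *\<^sub>C b) 1 - c *\<^sub>C Poly_Mapping.single (a, b) 1 | c a b. True}"

definition tensor_eq ::
    "('a::complex_vector \<times> 'b::complex_vector \<Rightarrow>\<^sub>0 complex) \<Rightarrow> ('a \<times> 'b \<Rightarrow>\<^sub>0 complex) \<Rightarrow> bool"
  where "tensor_eq p q \<longleftrightarrow> p - q \<in> complex_vector.span tensor_relations"

lemma equivp_tensor_eq: "equivp tensor_eq"
proof (rule equivpI)
  show "reflp tensor_eq"
    by (simp add: reflp_def tensor_eq_def complex_vector.span_zero)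
  show "symp tensor_eq"
    using complex_vector.span_neg by (fastforce simp: symp_def tensor_eq_def)
  show "transp tensor_eq"
    using complex_vector.span_add by (fastforce simp: transp_def tensor_eq_def)
qed

lemma eq_imp_tensor_eq: "p = q \<Longrightarrow> tensor_eq p q"
  by (simp add: tensor_eq_def complex_vector.span_zero)

quotient_type (overloaded) ('a, 'b) tensor (infixr \<open>\<otimes>\<close> 80) =
    "('a::complex_vector \<times> 'b::complex_vector) \<Rightarrow>\<^sub>0 complex" / tensor_eq
  by (rule equivp_tensor_eq)

lift_definition tensor :: "'a::complex_vector \<Rightarrow> 'b::complex_vector \<Rightarrow> 'a \<otimes> 'b" (infixr \<open>\<otimes>\<close> 80)
  is "\<lambda>a b. Poly_Mapping.single (a, b) 1" .

instantiation tensor :: (complex_vector, complex_vector) complex_vector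
begin

lift_definition zero_tensor :: "'a \<otimes> 'b" is 0 .

lift_definition plus_tensor :: "'a \<otimes> 'b \<Rightarrow> 'a \<otimes> 'b \<Rightarrow> 'a \<otimes> 'b" is "(+)"
  by (simp add: tensor_eq_def add_diff_add complex_vector.span_add)

lift_definition uminus_tensor :: "'a \<otimes> 'b \<Rightarrow> 'a \<otimes> 'b" is uminus
  by (simp only: tensor_eq_def minus_diff_minus complex_vector.span_neg)

lift_definition minus_tensor :: "'a \<otimes> 'b \<Rightarrow> 'a \<otimes> 'b \<Rightarrow> 'a \<otimes> 'b" is "(-)"
  unfolding tensor_eq_def by (drule (1) complex_vector.span_diff) (simp add: algebra_simps)

lift_definition scaleC_tensor :: "complex \<Rightarrow> 'a \<otimes> 'b \<Rightarrow> 'a \<otimes> 'b" is scaleC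
  by (simp add: tensor_eq_def complex_vector.span_scale
      flip: complex_vector.scale_right_diff_distrib)

instance
proof
  fix r s t :: "'a \<otimes> 'b" and c d
  show "r + s + t = r + (s + t)"
    by (transfer, rule eq_imp_tensor_eq, rule add.assoc)
  show "r + s = s + r"
    by (transfer, rule eq_imp_tensor_eq, rule add.commute)
  show "0 + t = t"
    by (transfer, rule eq_imp_tensor_eq, rule add_0)
  show "- t + t = 0"
    by (transfer, rule eq_imp_tensor_eq, rule left_minus)
  show "s - t = s + - t"
    by (transfer, rule eq_imp_tensor_eq, rule diff_conv_add_uminus)
  show "c *\<^sub>C (s + t) = c *\<^sub>C s + c *\<^sub>C t"
    by (transfer, rule eq_imp_tensor_eq, rule scaleC_add_right)
  show "(c + d) *\<^sub>C t = c *\<^sub>C t + d *\<^sub>C t"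
    by (transfer, rule eq_imp_tensor_eq, rule scaleC_add_left)
  show "c *\<^sub>C d *\<^sub>C t = (c * d) *\<^sub>C t"
    by (transfer, rule eq_imp_tensor_eq, rule scaleC_scaleC)
  show "1 *\<^sub>C t = t"
    by (transfer, rule eq_imp_tensor_eq, rule scaleC_one)
qed

end

lemma tensor_add_left: "(a + a') \<otimes> b = a \<otimes> b + a' \<otimes> b"
  and tensor_add_right: "a \<otimes> (b + b') = a \<otimes> b + a \<otimes> b'"
  and tensor_scaleC_left: "(c *\<^sub>C a) \<otimes> b = c *\<^sub>C (a \<otimes> b)"
  and tensor_scaleC_right: "a \<otimes> (c *\<^sub>C b) = c *\<^sub>C (a \<otimes> b)"
  by (transfer, unfold tensor_eq_def diff_diff_eq[symmetric], rule complex_vector.span_base,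
      unfold tensor_relations_def, blast)+

lemma cbilinear_tensor: "cbilinear (\<otimes>)"
  by (simp add: cbilinear_def clinear_iff tensor_add_left tensor_add_right
      tensor_scaleC_left tensor_scaleC_right)

lemma free_decomp:
  fixes p :: "'k \<Rightarrow>\<^sub>0 complex"
  shows "p = (\<Sum>k\<in>Poly_Mapping.keys p. Poly_Mapping.lookup p k *\<^sub>C Poly_Mapping.single k 1)"
  by (rule poly_mapping_eqI)
    (auto simp: lookup_sum lookup_scaleC lookup_single when_def scaleC_complex_def
      in_keys_iff if_distrib cong: if_cong)

lemma tensor_induct [case_names tensor add scaleC]:
  fixes t :: "'a::complex_vector \<otimes> 'b::complex_vector"
  assumes tensor: "\<And>a b. P (a \<otimes> b)" and add: "\<And>s t. P s \<Longrightarrow> P t \<Longrightarrow> P (s + t)"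
    and scaleC: "\<And>c t. P t \<Longrightarrow> P (c *\<^sub>C t)"
  shows "P t"
proof -
  have zero: "P 0"
    using scaleC[OF tensor, of 0] by (simp add: complex_vector.scale_zero_left)
  have "P (abs_tensor (\<Sum>k\<in>K. f k *\<^sub>C Poly_Mapping.single k 1))" if "finite K"
    for K and f :: "'a \<times> 'b \<Rightarrow> complex"
    using that
  proof induction
    case empty
    then show ?case using zero by (simp add: zero_tensor_def)
  next
    case (insert k K)
    have "abs_tensor (f k *\<^sub>C Poly_Mapping.single k 1) = f k *\<^sub>C (fst k \<otimes> snd k)"
      by (simp add: tensor.abs_eq scaleC_tensor.abs_eq)
    then show ?case using insert
      by (simp add: plus_tensor.abs_eq[symmetric] add scaleC tensor)
  qed
  moreover obtain p where "t = abs_tensor p"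
    using tensor.abs_induct[of "\<lambda>t. \<exists>p. t = abs_tensor p" t] by blast
  ultimately show ?thesis
    using free_decomp[of p] finite_keys[of p] by metis
qed

text \<open>
  The linear map on the tensor product induced by a bilinear map (lemma \<open>tensor_lift_tensor\<close>).
  It is only meant for bilinear arguments: for these the value does not depend on the
  representative.
\<close>

definition free_lift ::
    "('a \<Rightarrow> 'b \<Rightarrow> 'c::complex_vector) \<Rightarrow> ('a \<times> 'b \<Rightarrow>\<^sub>0 complex) \<Rightarrow> 'c"
  where "free_lift f p = (\<Sum>k\<in>Poly_Mapping.keys p. Poly_Mapping.lookup p k *\<^sub>C f (fst k) (snd k))"

definition tensor_lift ::
    "('a::complex_vector \<Rightarrow> 'b::complex_vector \<Rightarrow> 'c::complex_vector) \<Rightarrow> 'a \<otimes> 'b \<Rightarrow> 'c"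
  where "tensor_lift f t = free_lift f (rep_tensor t)"

lemma free_lift_superset:
  assumes "finite K" "Poly_Mapping.keys p \<subseteq> K"
  shows "free_lift f p = (\<Sum>k\<in>K. Poly_Mapping.lookup p k *\<^sub>C f (fst k) (snd k))"
  unfolding free_lift_def using assms
  by (intro sum.mono_neutral_left)
    (auto simp: in_keys_iff complex_vector.scale_zero_left)

lemma free_lift_add: "free_lift f (p + q) = free_lift f p + free_lift f q"
proof -
  let ?K = "Poly_Mapping.keys p \<union> Poly_Mapping.keys q"
  have "Poly_Mapping.keys (p + q) \<subseteq> ?K" by (rule Poly_Mapping.keys_add)
  then show ?thesis
    by (simp add: free_lift_superset[of ?K] lookup_add scaleC_add_left sum.distrib)
qed

lemma free_lift_scaleC: "free_lift f (c *\<^sub>C p) = c *\<^sub>C free_lift f p"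
proof -
  have "Poly_Mapping.keys (c *\<^sub>C p) \<subseteq> Poly_Mapping.keys p"
    by (auto simp: in_keys_iff lookup_scaleC scaleC_complex_def)
  then show ?thesis
    by (simp add: free_lift_superset[of "Poly_Mapping.keys p"] lookup_scaleC scaleC_complex_def
        complex_vector.scale_sum_right scaleC_scaleC)
qed

lemma free_lift_clinear: "clinear (free_lift f)"
  by (simp add: clinear_iff free_lift_add free_lift_scaleC)

lemma free_lift_single: "free_lift f (Poly_Mapping.single (a, b) 1) = f a b"
  by (simp add: free_lift_def scaleC_one)

lemma free_lift_eq:
  assumes f: "cbilinear f" and pq: "tensor_eq p q"
  shows "free_lift f p = free_lift f q"
proof -
  interpret l: Vector_Spaces.linear scaleC scaleC "free_lift f"
    by (rule free_lift_clinear)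
  have "free_lift f r = 0" if "r \<in> tensor_relations" for r
    using that f
    by (auto simp: tensor_relations_def l.diff l.scale free_lift_single cbilinear_def clinear_iff)
  then have "free_lift f r = 0" if "r \<in> complex_vector.span tensor_relations" for r
    using l.eq_0_on_span that by blast
  with pq have "free_lift f (p - q) = 0"
    by (simp add: tensor_eq_def)
  then show ?thesis by (simp add: l.diff)
qed

lemma tensor_lift_abs: "cbilinear f \<Longrightarrow> tensor_lift f (abs_tensor p) = free_lift f p"
  unfolding tensor_lift_def
  by (rule free_lift_eq) (simp_all add: Quotient3_rep_abs[OF Quotient3_tensor] equivp_reflp[OF equivp_tensor_eq])

lemma tensor_lift_tensor: "cbilinear f \<Longrightarrow> tensor_lift f (a \<otimes> b) = f a b"
  by (simp add: tensor.abs_eq tensor_lift_abs free_lift_single)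

lemma tensor_lift_add:
  assumes "cbilinear f"
  shows "tensor_lift f (s + t) = tensor_lift f s + tensor_lift f t"
  by (induct s rule: tensor.abs_induct, induct t rule: tensor.abs_induct)
    (simp add: plus_tensor.abs_eq tensor_lift_abs[OF assms] free_lift_add)

lemma tensor_lift_scaleC:
  assumes "cbilinear f"
  shows "tensor_lift f (c *\<^sub>C t) = c *\<^sub>C tensor_lift f t"
  by (induct t rule: tensor.abs_induct)
    (simp add: scaleC_tensor.abs_eq tensor_lift_abs[OF assms] free_lift_scaleC)

lemma tensor_lift_clinear: "cbilinear f \<Longrightarrow> clinear (tensor_lift f)"
  by (simp add: clinear_iff tensor_lift_add tensor_lift_scaleC)

lemma clinear_tensor_eqI:
  assumes "clinear f" "clinear g" "\<And>a b. f (a \<otimes> b) = g (a \<otimes> b)"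
  shows "f t = g t"
  using assms by (induct t rule: tensor_induct) (simp_all add: clinear_iff)

lemma cbilinear_lift_lift:
  assumes "\<And>a b. cbilinear (f a b)" "\<And>a' b'. cbilinear (\<lambda>a b. f a b a' b')"
  shows "cbilinear (\<lambda>a b. tensor_lift (f a b) t)"
  unfolding cbilinear_def clinear_iff
proof (intro conjI allI)
  fix a a' b b' c
  show "tensor_lift (f a (b + b')) t = tensor_lift (f a b) t + tensor_lift (f a b') t"
    using assms by (induct t rule: tensor_induct)
      (simp_all add: tensor_lift_tensor tensor_lift_add tensor_lift_scaleC
        scaleC_add_right cbilinear_def clinear_iff)
  show "tensor_lift (f (a + a') b) t = tensor_lift (f a b) t + tensor_lift (f a' b) t"
    using assms by (induct t rule: tensor_induct)
      (simp_all add: tensor_lift_tensor tensor_lift_add tensor_lift_scaleC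
        scaleC_add_right cbilinear_def clinear_iff)
  show "tensor_lift (f a (c *\<^sub>C b)) t = c *\<^sub>C tensor_lift (f a b) t"
    using assms by (induct t rule: tensor_induct)
      (simp_all add: tensor_lift_tensor tensor_lift_add tensor_lift_scaleC
        scaleC_add_right scaleC_scaleC cbilinear_def clinear_iff mult.commute)
  show "tensor_lift (f (c *\<^sub>C a) b) t = c *\<^sub>C tensor_lift (f a b) t"
    using assms by (induct t rule: tensor_induct)
      (simp_all add: tensor_lift_tensor tensor_lift_add tensor_lift_scaleC
        scaleC_add_right scaleC_scaleC cbilinear_def clinear_iff mult.commute)
qed

lemma cbilinear_mult_tensor1: "cbilinear (\<lambda>a' b'. (a * a') \<otimes> (b * b'))"
  for a :: "'a::complex_algebra" and b :: "'b::complex_algebra"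
  by (simp add: cbilinear_def clinear_iff distrib_left mult_scaleC_right
      tensor_add_left tensor_add_right tensor_scaleC_left tensor_scaleC_right)

lemma cbilinear_mult_tensor2: "cbilinear (\<lambda>a b. (a * a') \<otimes> (b * b'))"
  for a' :: "'a::complex_algebra" and b' :: "'b::complex_algebra"
  by (simp add: cbilinear_def clinear_iff distrib_right mult_scaleC_left
      tensor_add_left tensor_add_right tensor_scaleC_left tensor_scaleC_right)

lemma cbilinear_mult_tensor3:
  "cbilinear (\<lambda>a b. tensor_lift (\<lambda>a' b'. (a * a') \<otimes> (b * b')) t)"
  for t :: "'a::complex_algebra \<otimes> 'b::complex_algebra"
  by (rule cbilinear_lift_lift[OF cbilinear_mult_tensor1 cbilinear_mult_tensor2])

instantiation tensor :: (complex_algebra, complex_algebra) complex_algebra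
begin

definition times_tensor :: "'a \<otimes> 'b \<Rightarrow> 'a \<otimes> 'b \<Rightarrow> 'a \<otimes> 'b"
  where "s * t = tensor_lift (\<lambda>a b. tensor_lift (\<lambda>a' b'. (a * a') \<otimes> (b * b')) t) s"

lemma tensor_mult: "(a \<otimes> b) * (a' \<otimes> b') = (a * a') \<otimes> (b * b')"
  for a a' :: 'a and b b' :: 'b
  by (simp only: times_tensor_def tensor_lift_tensor[OF cbilinear_mult_tensor1]
      tensor_lift_tensor[OF cbilinear_mult_tensor2])

instance
proof
  have addl: "(s + s') * t = s * t + s' * t" for s s' t :: "'a \<otimes> 'b"
    by (simp only: times_tensor_def tensor_lift_add[OF cbilinear_mult_tensor3])
  have scl: "(c *\<^sub>C s) * t = c *\<^sub>C (s * t)" for c and s t :: "'a \<otimes> 'b"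
    by (simp only: times_tensor_def tensor_lift_scaleC[OF cbilinear_mult_tensor3])
  have elem: "(a \<otimes> b) * t = tensor_lift (\<lambda>a' b'. (a * a') \<otimes> (b * b')) t"
    for a :: 'a and b :: 'b and t
    by (simp only: times_tensor_def tensor_lift_tensor[OF cbilinear_mult_tensor3])
  have addr: "s * (t + t') = s * t + s * t'" for s t t' :: "'a \<otimes> 'b"
    by (induct s rule: tensor_induct)
      (simp_all add: elem tensor_lift_add[OF cbilinear_mult_tensor1] addl scl scaleC_add_right)
  have scr: "s * (c *\<^sub>C t) = c *\<^sub>C (s * t)" for c and s t :: "'a \<otimes> 'b"
    by (induct s rule: tensor_induct)
      (simp_all add: elem tensor_lift_scaleC[OF cbilinear_mult_tensor1] addl scl
        scaleC_add_right scaleC_scaleC mult.commute)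
  fix r s t :: "'a \<otimes> 'b" and c
  show "(r + s) * t = r * t + s * t" by (rule addl)
  show "r * (s + t) = r * s + r * t" by (rule addr)
  show "(c *\<^sub>C s) * t = c *\<^sub>C (s * t)" by (rule scl)
  show "s * (c *\<^sub>C t) = c *\<^sub>C (s * t)" by (rule scr)
  show "r * s * t = r * (s * t)"
  proof (induct r rule: tensor_induct)
    case (tensor a b)
    show ?case
    proof (induct s rule: tensor_induct)
      case (tensor a' b')
      show ?case
        by (induct t rule: tensor_induct) (simp_all add: tensor_mult addr scr mult.assoc)
    qed (simp_all add: addl addr scl scr)
  qed (simp_all add: addl addr scl scr)
qed

end

definition tensor_map ::
    "('a::complex_vector \<Rightarrow> 'c::complex_vector) \<Rightarrow> ('b::complex_vector \<Rightarrow> 'd::complex_vector)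
      \<Rightarrow> 'a \<otimes> 'b \<Rightarrow> 'c \<otimes> 'd"
  where "tensor_map f g = tensor_lift (\<lambda>a b. f a \<otimes> g b)"

lemma cbilinear_tensor_map:
  "clinear f \<Longrightarrow> clinear g \<Longrightarrow> cbilinear (\<lambda>a b. f a \<otimes> g b)"
  by (simp add: cbilinear_def clinear_iff
      tensor_add_left tensor_add_right tensor_scaleC_left tensor_scaleC_right)

lemma tensor_map_tensor:
  "clinear f \<Longrightarrow> clinear g \<Longrightarrow> tensor_map f g (a \<otimes> b) = f a \<otimes> g b"
  by (simp add: tensor_map_def tensor_lift_tensor cbilinear_tensor_map)

lemma tensor_map_clinear: "clinear f \<Longrightarrow> clinear g \<Longrightarrow> clinear (tensor_map f g)"
  by (simp add: tensor_map_def tensor_lift_clinear cbilinear_tensor_map)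

definition tensor_flip :: "'a::complex_vector \<otimes> 'b::complex_vector \<Rightarrow> 'b \<otimes> 'a"
  where "tensor_flip = tensor_lift (\<lambda>a b. b \<otimes> a)"

definition tensor_assoc ::
    "('a::complex_vector \<otimes> 'b::complex_vector) \<otimes> 'c::complex_vector \<Rightarrow> 'a \<otimes> 'b \<otimes> 'c"
  where "tensor_assoc = tensor_lift (\<lambda>t c. tensor_lift (\<lambda>a b. a \<otimes> b \<otimes> c) t)"

text \<open>\<open>a \<otimes> (b \<otimes> c) \<mapsto> a \<otimes> (c \<otimes> b)\<close>\<close>

definition tensor_flip23 ::
    "'a::complex_vector \<otimes> 'b::complex_vector \<otimes> 'c::complex_vector \<Rightarrow> 'a \<otimes> 'c \<otimes> 'b"
  where "tensor_flip23 = tensor_map id tensor_flip"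


section \<open>Multiplier algebras\<close>

text \<open>
  A multiplier \<open>m\<close> is encoded by the pair of maps \<open>L x = m x\<close> and \<open>R x = x m\<close>.
\<close>

definition is_multiplier :: "('a::complex_algebra \<Rightarrow> 'a) \<Rightarrow> ('a \<Rightarrow> 'a) \<Rightarrow> bool"
  where "is_multiplier L R \<longleftrightarrow> clinear L \<and> clinear R \<and>
    (\<forall>x y. L (x * y) = L x * y) \<and> (\<forall>x y. R (x * y) = x * R y) \<and>
    (\<forall>x y. x * L y = R x * y)"

typedef (overloaded) 'a multiplier =
  "{(L, R). is_multiplier L R} :: (('a::complex_algebra \<Rightarrow> 'a) \<times> ('a \<Rightarrow> 'a)) set"
  by (rule exI[of _ "(id, id)"]) (simp add: is_multiplier_def clinear_iff)

setup_lifting type_definition_multiplier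

lift_definition lmult :: "'a::complex_algebra multiplier \<Rightarrow> 'a \<Rightarrow> 'a" (infixr \<open>\<rhd>\<close> 72) is fst .

lift_definition rmult :: "'a::complex_algebra \<Rightarrow> 'a multiplier \<Rightarrow> 'a" (infixl \<open>\<lhd>\<close> 72)
  is "\<lambda>x m. snd m x" .

lift_definition mult_of :: "'a::complex_algebra \<Rightarrow> 'a multiplier"
  is "\<lambda>a. (\<lambda>x. a * x, \<lambda>x. x * a)"
  by (simp add: is_multiplier_def clinear_iff distrib_left distrib_right mult_scaleC_left mult_scaleC_right mult.assoc)

instantiation multiplier :: (complex_algebra) "{complex_algebra, monoid_mult}"
begin

lift_definition zero_multiplier :: "'a multiplier" is "(\<lambda>_. 0, \<lambda>_. 0)"
  by (simp add: is_multiplier_def clinear_iff complex_vector.scale_zero_right)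

lift_definition one_multiplier :: "'a multiplier" is "(id, id)"
  by (simp add: is_multiplier_def clinear_iff)

lift_definition plus_multiplier :: "'a multiplier \<Rightarrow> 'a multiplier \<Rightarrow> 'a multiplier"
  is "\<lambda>(L, R) (L', R'). (\<lambda>x. L x + L' x, \<lambda>x. R x + R' x)"
  by (auto simp: is_multiplier_def clinear_iff algebra_simps scaleC_add_right)

lift_definition uminus_multiplier :: "'a multiplier \<Rightarrow> 'a multiplier"
  is "\<lambda>(L, R). (\<lambda>x. - L x, \<lambda>x. - R x)"
  by (auto simp: is_multiplier_def clinear_iff complex_vector.scale_minus_right)

lift_definition minus_multiplier :: "'a multiplier \<Rightarrow> 'a multiplier \<Rightarrow> 'a multiplier"
  is "\<lambda>(L, R) (L', R'). (\<lambda>x. L x - L' x, \<lambda>x. R x - R' x)"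
  by (auto simp: is_multiplier_def clinear_iff algebra_simps complex_vector.scale_right_diff_distrib)

lift_definition scaleC_multiplier :: "complex \<Rightarrow> 'a multiplier \<Rightarrow> 'a multiplier"
  is "\<lambda>c (L, R). (\<lambda>x. c *\<^sub>C L x, \<lambda>x. c *\<^sub>C R x)"
  by (auto simp: is_multiplier_def clinear_iff scaleC_add_right scaleC_scaleC mult.commute
      mult_scaleC_left mult_scaleC_right)

lift_definition times_multiplier :: "'a multiplier \<Rightarrow> 'a multiplier \<Rightarrow> 'a multiplier"
  is "\<lambda>(L, R) (L', R'). (L \<circ> L', R' \<circ> R)"
  by (auto simp: is_multiplier_def clinear_iff)

instance
proof
  fix l m n :: "'a multiplier" and c d
  show "l + m + n = l + (m + n)"
    by transfer (auto simp: add.assoc)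
  show "m + n = n + m"
    by transfer (auto simp: add.commute)
  show "0 + m = m"
    by transfer auto
  show "- m + m = 0"
    by transfer auto
  show "m - n = m + - n"
    by transfer auto
  show "c *\<^sub>C (m + n) = c *\<^sub>C m + c *\<^sub>C n"
    by transfer (auto simp: scaleC_add_right)
  show "(c + d) *\<^sub>C m = c *\<^sub>C m + d *\<^sub>C m"
    by transfer (auto simp: scaleC_add_left)
  show "c *\<^sub>C d *\<^sub>C m = (c * d) *\<^sub>C m"
    by transfer (auto simp: scaleC_scaleC)
  show "1 *\<^sub>C m = m"
    by transfer (auto simp: scaleC_one)
  show "l * m * n = l * (m * n)"
    by transfer (auto simp: comp_assoc)
  show "(l + m) * n = l * n + m * n" "l * (m + n) = l * m + l * n"
    by (transfer, auto simp: fun_eq_iff is_multiplier_def clinear_iff)+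
  show "(c *\<^sub>C m) * n = c *\<^sub>C (m * n)" "m * (c *\<^sub>C n) = c *\<^sub>C (m * n)"
    by (transfer, auto simp: fun_eq_iff is_multiplier_def clinear_iff)+
  show "1 * m = m" "m * 1 = m"
    by (transfer, auto)+
qed

end

text \<open>The inverse of the embedding, for multipliers that lie in the algebra.\<close>

definition of_mult :: "'a::complex_algebra multiplier \<Rightarrow> 'a"
  where "of_mult m = (THE x. mult_of x = m)"

lemma is_multiplier_tensor_map:
  assumes "is_multiplier L R" "is_multiplier L' R'"
  shows "is_multiplier (tensor_map L L') (tensor_map R R')"
proof -
  have lin: "clinear L" "clinear R" "clinear L'" "clinear R'"
    and L: "\<And>x y. L (x * y) = L x * y" and L': "\<And>x y. L' (x * y) = L' x * y"
    and R: "\<And>x y. R (x * y) = x * R y" and R': "\<And>x y. R' (x * y) = x * R' y"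
    and LR: "\<And>x y. x * L y = R x * y" and LR': "\<And>x y. x * L' y = R' x * y"
    using assms unfolding is_multiplier_def by blast+
  note clin = tensor_map_clinear[OF lin(1,3)] tensor_map_clinear[OF lin(2,4)]
  note rules = tensor_map_tensor[OF lin(1,3)] tensor_map_tensor[OF lin(2,4)]
    clin[unfolded clinear_iff]
    tensor_mult distrib_left distrib_right mult_scaleC_left mult_scaleC_right
  have "tensor_map L L' (s * t) = tensor_map L L' s * t" for s t
  proof (induct s rule: tensor_induct)
    case (tensor a b)
    show ?case by (induct t rule: tensor_induct) (simp_all add: rules L L')
  qed (simp_all add: rules)
  moreover have "tensor_map R R' (s * t) = s * tensor_map R R' t" for s t
  proof (induct s rule: tensor_induct)
    case (tensor a b)
    show ?case by (induct t rule: tensor_induct) (simp_all add: rules R R')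
  qed (simp_all add: rules)
  moreover have "s * tensor_map L L' t = tensor_map R R' s * t" for s t
  proof (induct s rule: tensor_induct)
    case (tensor a b)
    show ?case by (induct t rule: tensor_induct) (simp_all add: rules LR LR')
  qed (simp_all add: rules)
  ultimately show ?thesis
    unfolding is_multiplier_def using clin by blast
qed

lift_definition mult_tensor ::
    "'a::complex_algebra multiplier \<Rightarrow> 'b::complex_algebra multiplier \<Rightarrow> ('a \<otimes> 'b) multiplier"
  (infixr \<open>\<otimes>\<^sub>M\<close> 80)
  is "\<lambda>(L, R) (L', R'). (tensor_map L L', tensor_map R R')"
  by (auto intro: is_multiplier_tensor_map)


text \<open>The isomorphism \<open>M(A) \<rightarrow> M(B)\<close> induced by an algebra isomorphism \<open>f : A \<rightarrow> B\<close>.\<close>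

definition multiplier_iso ::
    "('a::complex_algebra \<Rightarrow> 'b::complex_algebra) \<Rightarrow> 'a multiplier \<Rightarrow> 'b multiplier"
  where "multiplier_iso f m =
    Abs_multiplier (\<lambda>y. f (m \<rhd> inv f y), \<lambda>y. f (inv f y \<lhd> m))"

text \<open>
  The extension to \<open>M(A)\<close> of a non-degenerate homomorphism \<open>F : A \<rightarrow> M(B)\<close>: the value at \<open>m\<close> is the
  multiplier \<open>n\<close> with \<open>n F(x) = F(m x)\<close> and \<open>F(x) n = F(x m)\<close>, which is unique because
  \<open>F(A) B\<close> spans \<open>B\<close>.
\<close>

definition multiplier_extension ::
    "('a::complex_algebra \<Rightarrow> 'b::complex_algebra multiplier) \<Rightarrow> 'a multiplier \<Rightarrow> 'b multiplier"
  where "multiplier_extension F m =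
    (THE n. \<forall>x. n * F x = F (m \<rhd> x) \<and> F x * n = F (x \<lhd> m))"


section \<open>Regular multiplier Hopf algebras and integrals\<close>

text \<open>
  For \<open>\<Delta> : A \<rightarrow> M(A \<otimes> A)\<close>, the maps \<open>\<iota> \<otimes> \<Delta> : B \<otimes> A \<rightarrow> M(B \<otimes> A \<otimes> A)\<close> and
  \<open>\<Delta> \<otimes> \<iota> : A \<otimes> B \<rightarrow> M(A \<otimes> A \<otimes> B)\<close>.
\<close>

definition id_comult ::
    "('a \<Rightarrow> ('a \<otimes> 'a) multiplier) \<Rightarrow> 'b::complex_algebra \<otimes> 'a::complex_algebra
      \<Rightarrow> ('b \<otimes> 'a \<otimes> 'a) multiplier"
  where "id_comult \<Delta> = tensor_lift (\<lambda>b a. mult_of b \<otimes>\<^sub>M \<Delta> a)"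

definition comult_id ::
    "('a \<Rightarrow> ('a \<otimes> 'a) multiplier) \<Rightarrow> 'a::complex_algebra \<otimes> 'b::complex_algebra
      \<Rightarrow> ('a \<otimes> 'a \<otimes> 'b) multiplier"
  where "comult_id \<Delta> = tensor_lift (\<lambda>a b. multiplier_iso tensor_assoc (\<Delta> a \<otimes>\<^sub>M mult_of b))"

definition comult_flip ::
    "('a::complex_algebra \<Rightarrow> ('a \<otimes> 'a) multiplier) \<Rightarrow> 'a \<Rightarrow> ('a \<otimes> 'a) multiplier"
  where "comult_flip \<Delta> a = multiplier_iso tensor_flip (\<Delta> a)"

text \<open>
  The linear maps \<open>a \<otimes> a' \<mapsto> \<Delta>(a) (1 \<otimes> a')\<close> and \<open>a \<otimes> a' \<mapsto> (a \<otimes> 1) \<Delta>(a')\<close> on \<open>A \<otimes> A\<close>.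
\<close>

definition galois1 ::
    "('a::complex_algebra \<Rightarrow> ('a \<otimes> 'a) multiplier) \<Rightarrow> 'a \<otimes> 'a \<Rightarrow> 'a \<otimes> 'a"
  where "galois1 \<Delta> = tensor_lift (\<lambda>a a'. of_mult (\<Delta> a * (1 \<otimes>\<^sub>M mult_of a')))"

definition galois2 ::
    "('a::complex_algebra \<Rightarrow> ('a \<otimes> 'a) multiplier) \<Rightarrow> 'a \<otimes> 'a \<Rightarrow> 'a \<otimes> 'a"
  where "galois2 \<Delta> = tensor_lift (\<lambda>a a'. of_mult ((mult_of a \<otimes>\<^sub>M 1) * \<Delta> a'))"

definition regular_multiplier_hopf ::
    "('a::nondegenerate_algebra \<Rightarrow> ('a \<otimes> 'a) multiplier) \<Rightarrow> bool"
  where "regular_multiplier_hopf \<Delta> \<longleftrightarrow>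
    clinear \<Delta> \<and> (\<forall>a a'. \<Delta> (a * a') = \<Delta> a * \<Delta> a') \<and>
    (\<forall>a a'. \<Delta> a * (1 \<otimes>\<^sub>M mult_of a') \<in> range mult_of \<and>
            (mult_of a \<otimes>\<^sub>M 1) * \<Delta> a' \<in> range mult_of \<and>
            \<Delta> a * (mult_of a' \<otimes>\<^sub>M 1) \<in> range mult_of \<and>
            (1 \<otimes>\<^sub>M mult_of a) * \<Delta> a' \<in> range mult_of) \<and>
    (\<forall>a c a'.
      (mult_of a \<otimes>\<^sub>M 1 \<otimes>\<^sub>M 1) * comult_id \<Delta> (of_mult (\<Delta> c * (1 \<otimes>\<^sub>M mult_of a'))) =
      id_comult \<Delta> (of_mult ((mult_of a \<otimes>\<^sub>M 1) * \<Delta> c)) * (1 \<otimes>\<^sub>M 1 \<otimes>\<^sub>M mult_of a')) \<and>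
    bij (galois1 \<Delta>) \<and> bij (galois2 \<Delta>) \<and>
    bij (galois1 (comult_flip \<Delta>)) \<and> bij (galois2 (comult_flip \<Delta>))"

text \<open>
  \<open>(\<iota> \<otimes> \<phi>)(m)\<close> and \<open>(\<phi> \<otimes> \<iota>)(m)\<close> in \<open>M(A)\<close>, for \<open>m \<in> M(A \<otimes> A)\<close> such that the products with
  \<open>a \<otimes> 1\<close>, respectively \<open>1 \<otimes> a\<close>, lie in \<open>A \<otimes> A\<close>.
\<close>

definition slice_right ::
    "('a \<Rightarrow> complex) \<Rightarrow> ('a::complex_algebra \<otimes> 'a) multiplier \<Rightarrow> 'a multiplier"
  where "slice_right \<phi> m =
    (let \<iota>\<phi> = tensor_lift (\<lambda>x y. \<phi> y *\<^sub>C x)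
     in Abs_multiplier (\<lambda>a. \<iota>\<phi> (of_mult (m * (mult_of a \<otimes>\<^sub>M 1))),
                        \<lambda>a. \<iota>\<phi> (of_mult ((mult_of a \<otimes>\<^sub>M 1) * m))))"

definition slice_left ::
    "('a \<Rightarrow> complex) \<Rightarrow> ('a::complex_algebra \<otimes> 'a) multiplier \<Rightarrow> 'a multiplier"
  where "slice_left \<phi> m =
    (let \<phi>\<iota> = tensor_lift (\<lambda>x y. \<phi> x *\<^sub>C y)
     in Abs_multiplier (\<lambda>a. \<phi>\<iota> (of_mult (m * (1 \<otimes>\<^sub>M mult_of a))),
                        \<lambda>a. \<phi>\<iota> (of_mult ((1 \<otimes>\<^sub>M mult_of a) * m))))"

definition left_integral ::
    "('a::nondegenerate_algebra \<Rightarrow> ('a \<otimes> 'a) multiplier) \<Rightarrow> ('a \<Rightarrow> complex) \<Rightarrow> bool"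
  where "left_integral \<Delta> \<phi> \<longleftrightarrow>
    clinear \<phi> \<and> (\<exists>a. \<phi> a \<noteq> 0) \<and> (\<forall>a. slice_right \<phi> (\<Delta> a) = \<phi> a *\<^sub>C 1)"

definition right_integral ::
    "('a::nondegenerate_algebra \<Rightarrow> ('a \<otimes> 'a) multiplier) \<Rightarrow> ('a \<Rightarrow> complex) \<Rightarrow> bool"
  where "right_integral \<Delta> \<psi> \<longleftrightarrow>
    clinear \<psi> \<and> (\<exists>a. \<psi> a \<noteq> 0) \<and> (\<forall>a. slice_left \<psi> (\<Delta> a) = \<psi> a *\<^sub>C 1)"

definition algebraic_quantum_group ::
    "('a::nondegenerate_algebra \<Rightarrow> ('a \<otimes> 'a) multiplier) \<Rightarrow> bool"
  where "algebraic_quantum_group \<Delta> \<longleftrightarrow>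
    regular_multiplier_hopf \<Delta> \<and> (\<exists>\<phi>. left_integral \<Delta> \<phi>) \<and> (\<exists>\<psi>. right_integral \<Delta> \<psi>)"


section \<open>The dual\<close>

text \<open>
  The pairing of \<open>A \<otimes> B\<close> with \<open>C \<otimes> D\<close> built from pairings of \<open>A\<close> with \<open>C\<close> and of \<open>B\<close> with \<open>D\<close>.
\<close>

definition pairing_tensor ::
    "('a::complex_vector \<Rightarrow> 'c::complex_vector \<Rightarrow> complex)
      \<Rightarrow> ('b::complex_vector \<Rightarrow> 'd::complex_vector \<Rightarrow> complex)
      \<Rightarrow> 'a \<otimes> 'b \<Rightarrow> 'c \<otimes> 'd \<Rightarrow> complex"
  where "pairing_tensor p q s t =
    tensor_lift (\<lambda>a b. tensor_lift (\<lambda>c d. p a c * q b d) t) s"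

text \<open>
  \<open>(B, \<Delta>\<^sub>B)\<close> is the dual of \<open>(A, \<Delta>)\<close>. Since \<open>{\<phi>( \<cdot> c) | c}\<close> is a set depending on \<open>\<phi>\<close>, it enters
  through a type \<open>'b\<close> that the evaluation \<open>b \<mapsto> (a \<mapsto> \<langle>a, b\<rangle>)\<close> identifies with it, as a
  vector space. In the product formula, \<open>\<langle>m, \<phi>( \<cdot> c) \<otimes> \<phi>( \<cdot> c')\<rangle> = (\<phi> \<otimes> \<phi>)(m (c \<otimes> c'))\<close> for
  \<open>m \<in> M(A \<otimes> A)\<close>. All the structure of \<open>B\<close> is determined by these conditions.
\<close>

definition dual_of ::
    "('a::nondegenerate_algebra \<Rightarrow> ('a \<otimes> 'a) multiplier) \<Rightarrow> ('a \<Rightarrow> complex)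
      \<Rightarrow> ('b::nondegenerate_algebra \<Rightarrow> ('b \<otimes> 'b) multiplier) \<Rightarrow> ('a \<Rightarrow> 'b \<Rightarrow> complex) \<Rightarrow> bool"
  where "dual_of \<Delta> \<phi> \<Delta>\<^sub>B p \<longleftrightarrow>
    cbilinear p \<and>
    bij_betw (\<lambda>b a. p a b) UNIV {\<lambda>a. \<phi> (a * c) | c. True} \<and>
    (\<forall>b b' c c'. (\<forall>x. p x b = \<phi> (x * c)) \<and> (\<forall>x. p x b' = \<phi> (x * c')) \<longrightarrow>
      (\<forall>a. p a (b * b') = tensor_lift (\<lambda>x y. \<phi> x * \<phi> y) (\<Delta> a \<rhd> (c \<otimes> c')))) \<and>
    (\<forall>b b'. (mult_of b' \<otimes>\<^sub>M 1) * \<Delta>\<^sub>B b \<in> range mult_of \<and>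
      (\<forall>a a'. pairing_tensor p p (a \<otimes> a') (of_mult ((mult_of b' \<otimes>\<^sub>M 1) * \<Delta>\<^sub>B b)) =
              pairing_tensor p p (of_mult (\<Delta> a * (1 \<otimes>\<^sub>M mult_of a'))) (b' \<otimes> b))) \<and>
    (\<forall>b b'. \<Delta>\<^sub>B b * (1 \<otimes>\<^sub>M mult_of b') \<in> range mult_of \<and>
      (\<forall>a a'. pairing_tensor p p (a \<otimes> a') (of_mult (\<Delta>\<^sub>B b * (1 \<otimes>\<^sub>M mult_of b'))) =
              pairing_tensor p p (of_mult ((mult_of a \<otimes>\<^sub>M 1) * \<Delta> a')) (b \<otimes> b')))"

text \<open>The actions \<open>a \<triangleright> b\<close> and \<open>b \<triangleright> a\<close>.\<close>

definition act_dual ::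
    "('a::complex_algebra \<Rightarrow> 'b::complex_algebra \<Rightarrow> complex) \<Rightarrow> 'a \<Rightarrow> 'b \<Rightarrow> 'b"
  where "act_dual p a b = (THE y. \<forall>a'. p a' y = p (a' * a) b)"

definition dual_act ::
    "('a::complex_algebra \<Rightarrow> 'b::complex_algebra \<Rightarrow> complex) \<Rightarrow> 'b \<Rightarrow> 'a \<Rightarrow> 'a"
  where "dual_act p b a = (THE x. \<forall>b'. p x b' = p a (b' * b))"

text \<open>
  \<open>P\<close> is the extension to \<open>M(B \<otimes> A) \<times> (A \<otimes> B)\<close> of the pairing of \<open>B \<otimes> A\<close> with \<open>A \<otimes> B\<close>.
\<close>

definition extended_pairing ::
    "('a::nondegenerate_algebra \<Rightarrow> 'b::nondegenerate_algebra \<Rightarrow> complex)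
      \<Rightarrow> (('b \<otimes> 'a) multiplier \<Rightarrow> 'a \<otimes> 'b \<Rightarrow> complex) \<Rightarrow> bool"
  where "extended_pairing p P \<longleftrightarrow>
    (let q = pairing_tensor (\<lambda>b a. p a b) p in
      cbilinear P \<and>
      (\<forall>x t. P (mult_of x) t = q x t) \<and>
      (\<forall>m a a' b b'. P m (dual_act p b a' \<otimes> act_dual p a b') = q (m \<rhd> (b \<otimes> a)) (a' \<otimes> b')))"


section \<open>Leg numbering\<close>

definition leg12 :: "('a::complex_algebra \<otimes> 'b::complex_algebra) multiplier
    \<Rightarrow> ('a \<otimes> 'b \<otimes> 'c::complex_algebra) multiplier"
  where "leg12 m = multiplier_iso tensor_assoc (m \<otimes>\<^sub>M 1)"

definition leg13 :: "('a::complex_algebra \<otimes> 'c::complex_algebra) multiplier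
    \<Rightarrow> ('a \<otimes> 'b::complex_algebra \<otimes> 'c) multiplier"
  where "leg13 m = multiplier_iso tensor_flip23 (leg12 m)"

definition leg23 :: "('b::complex_algebra \<otimes> 'c::complex_algebra) multiplier
    \<Rightarrow> ('a::complex_algebra \<otimes> 'b \<otimes> 'c) multiplier"
  where "leg23 m = 1 \<otimes>\<^sub>M m"

end

theory Submission
  imports Defs
begin

text \<open>
  Write \<open>\<Delta>(h) = h\<^sub>1 \<otimes> h\<^sub>2\<close> and let \<open>W(h \<otimes> x) = h\<^sub>2 \<otimes> h\<^sub>1 x\<close>, a bijection of \<open>A \<otimes> A\<close> because \<open>A\<close> is a
  regular multiplier Hopf algebra. The map \<open>c \<mapsto> \<phi>( \<cdot> c)\<close> of \<open>A\<close> onto \<open>B\<close> is the Fourier transform, and in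
  these coordinates everything in sight is built from \<open>W\<^sup>-\<^sup>1\<close>: left multiplication by \<open>V\<close> on \<open>B \<otimes> A\<close> is
  \<open>W\<^sup>-\<^sup>1\<close> (lemma \<open>multiplicative_unitary_hat\<close>), the map \<open>b \<otimes> d \<mapsto> \<Delta>(b)(1 \<otimes> d)\<close> of \<open>B\<close> is
  \<open>G = \<sigma> W\<^sup>-\<^sup>1 \<sigma>\<close> with the flip \<open>\<sigma>\<close> (lemma \<open>dual_comult_hat\<close>), and the product of \<open>B\<close> is
  \<open>(\<phi> \<otimes> \<iota>) G\<close> (lemma \<open>hat_mult_hat\<close>). All three follow from left invariance of \<open>\<phi>\<close> in the form
  \<open>(\<iota> \<otimes> \<phi>)(\<Delta>(a)\<Delta>(h)(g \<otimes> 1)) = \<phi>(ah) g\<close> (lemma \<open>fourier\<close>).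

  Since \<open>\<Delta>\<close> is a coassociative homomorphism, \<open>W\<close> satisfies the pentagon equation
  \<open>W\<^sub>1\<^sub>2 W\<^sub>1\<^sub>3 W\<^sub>2\<^sub>3 = W\<^sub>2\<^sub>3 W\<^sub>1\<^sub>2\<close> (lemma \<open>pentagon\<close>). Both formulas for \<open>V\<close> are rearrangements of it: the equations
  \<open>V\<^sub>1\<^sub>2V\<^sub>1\<^sub>3 (\<iota> \<otimes> \<Delta>)(x) = (\<iota> \<otimes> \<Delta>)(V x)\<close> and \<open>V\<^sub>1\<^sub>3V\<^sub>2\<^sub>3 (\<Delta> \<otimes> \<iota>)(x) = (\<Delta> \<otimes> \<iota>)(V x)\<close>, covered by an
  element in the middle leg, become \<open>W\<^sub>1\<^sub>2\<^sup>-\<^sup>1 W\<^sub>1\<^sub>3\<^sup>-\<^sup>1 \<sigma>\<^sub>2\<^sub>3 W\<^sub>2\<^sub>3 = \<sigma>\<^sub>2\<^sub>3 W\<^sub>2\<^sub>3 W\<^sub>1\<^sub>2\<^sup>-\<^sup>1\<close> and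
  \<open>W\<^sub>1\<^sub>3\<^sup>-\<^sup>1 W\<^sub>2\<^sub>3\<^sup>-\<^sup>1 G\<^sub>1\<^sub>2 = G\<^sub>1\<^sub>2 W\<^sub>1\<^sub>3\<^sup>-\<^sup>1\<close>. They determine the extensions to \<open>M(B \<otimes> A)\<close> because
  \<open>\<iota> \<otimes> \<Delta>\<close> and \<open>\<Delta> \<otimes> \<iota>\<close> are homomorphisms with dense range (lemma \<open>multiplier_extension_eqI\<close>). For \<open>B\<close>
  the homomorphism property is the pentagon equation for \<open>G\<close> with \<open>\<phi>\<close> applied to the first leg
  (lemma \<open>dual_comult_mult\<close>).

  Reading off \<open>V\<close> from its pairings requires that \<open>\<langle> \<cdot> , \<cdot> \<rangle>\<close> separates the points of \<open>A\<close>, that is,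
  that \<open>\<phi>\<close> is faithful (lemma \<open>faithful\<close>). Multiplication composed with \<open>W\<^sup>-\<^sup>1\<close> is \<open>x \<otimes> q \<mapsto> \<epsilon>(x) q\<close> with the
  counit \<open>\<epsilon>\<close>. If \<open>\<phi>(x \<cdot> ) = 0\<close>, then left invariance gives \<open>x\<^sub>1 \<phi>(x\<^sub>2 c) = 0\<close> for all \<open>c\<close>; this property
  passes through \<open>W\<^sup>-\<^sup>1\<close> and forces \<open>\<epsilon>(x) = 0\<close>. It is shared by the second legs \<open>x\<^sub>2\<close> of \<open>\<Delta>(x)\<close>, so that
  \<open>x r = \<epsilon>(x\<^sub>2) x\<^sub>1 r = 0\<close> for all \<open>r\<close>.
\<close>

section \<open>Slices and bases of tensor products\<close>

lemma clinear_add: "clinear f \<Longrightarrow> f (x + y) = f x + f y"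
  and clinear_scaleC: "clinear f \<Longrightarrow> f (c *\<^sub>C x) = c *\<^sub>C f x"
  by (simp_all add: clinear_iff)

lemma clinear_zero: "clinear f \<Longrightarrow> f 0 = 0"
  using clinear_scaleC[of f 0 0] by simp

lemma clinear_diff: "clinear f \<Longrightarrow> f (x - y) = f x - f y"
  by (metis clinear_add diff_add_cancel add_diff_cancel)

lemma clinear_sum: "clinear f \<Longrightarrow> f (sum g S) = (\<Sum>x\<in>S. f (g x))"
  by (induct S rule: infinite_finite_induct) (simp_all add: clinear_zero clinear_add)

lemma clinear_compose: "clinear f \<Longrightarrow> clinear g \<Longrightarrow> clinear (\<lambda>x. f (g x))"
  by (simp add: clinear_iff)

lemma clinear_comp: "clinear f \<Longrightarrow> clinear g \<Longrightarrow> clinear (f \<circ> g)"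
  by (simp add: clinear_iff)

lemma clinear_id: "clinear id" "clinear (\<lambda>x. x)"
  by (simp_all add: clinear_iff)

lemma clinear_inv: "clinear f \<Longrightarrow> bij f \<Longrightarrow> clinear (inv f)"
  unfolding clinear_iff by (metis bij_inv_eq_iff)

lemmas tensor_linear_simps =
  tensor_add_left tensor_add_right tensor_scaleC_left tensor_scaleC_right
  scaleC_add_left scaleC_add_right scaleC_scaleC
  distrib_left distrib_right mult_scaleC_left mult_scaleC_right

lemma tensor_zero_left: "0 \<otimes> y = 0"
  using tensor_scaleC_left[of 0 0 y] by simp

lemmas tensor_map_linear = clinear_add[OF tensor_map_clinear] clinear_scaleC[OF tensor_map_clinear]

lemma tensor_map_map:
  assumes "clinear f" "clinear g" "clinear f'" "clinear g'"
  shows "tensor_map f g (tensor_map f' g' t) = tensor_map (f \<circ> f') (g \<circ> g') t"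
  using assms
  by (induct t rule: tensor_induct)
    (simp_all add: tensor_map_tensor[OF clinear_comp clinear_comp] tensor_map_tensor
      tensor_map_linear tensor_map_linear[OF clinear_comp clinear_comp])

lemma tensor_map_id: "tensor_map id id = id"
proof
  show "tensor_map id id t = id t" for t :: "'a::complex_vector \<otimes> 'b::complex_vector"
    by (rule clinear_tensor_eqI[of _ id]) (simp_all add: tensor_map_clinear clinear_id tensor_map_tensor)
qed

lemma tensor_map_ident: "tensor_map (\<lambda>x. x) (\<lambda>x. x) t = t"
  by (simp add: tensor_map_id[unfolded id_def])

definition left_slice :: "('a \<Rightarrow> complex) \<Rightarrow> 'a::complex_vector \<otimes> 'b::complex_vector \<Rightarrow> 'b"
  where "left_slice f = tensor_lift (\<lambda>x y. f x *\<^sub>C y)"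

definition right_slice :: "('b \<Rightarrow> complex) \<Rightarrow> 'a::complex_vector \<otimes> 'b::complex_vector \<Rightarrow> 'a"
  where "right_slice g = tensor_lift (\<lambda>x y. g y *\<^sub>C x)"

lemma cbilinear_left_slice: "clinear f \<Longrightarrow> cbilinear (\<lambda>x y. f x *\<^sub>C y)"
  and cbilinear_right_slice: "clinear g \<Longrightarrow> cbilinear (\<lambda>x y. g y *\<^sub>C x)"
  by (simp_all add: cbilinear_def clinear_iff scaleC_add_left scaleC_add_right
      scaleC_scaleC scaleC_complex_def mult.commute)

lemma left_slice_tensor: "clinear f \<Longrightarrow> left_slice f (x \<otimes> y) = f x *\<^sub>C y"
  and left_slice_clinear: "clinear f \<Longrightarrow> clinear (left_slice f)"
  by (simp_all add: left_slice_def tensor_lift_tensor tensor_lift_clinear cbilinear_left_slice)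

lemmas left_slice_linear = clinear_add[OF left_slice_clinear] clinear_scaleC[OF left_slice_clinear]

lemma right_slice_tensor: "clinear g \<Longrightarrow> right_slice g (x \<otimes> y) = g y *\<^sub>C x"
  and right_slice_clinear: "clinear g \<Longrightarrow> clinear (right_slice g)"
  by (simp_all add: right_slice_def tensor_lift_tensor tensor_lift_clinear cbilinear_right_slice)

lemmas right_slice_linear = clinear_add[OF right_slice_clinear] clinear_scaleC[OF right_slice_clinear]

lemma left_slice_zero: "left_slice (\<lambda>_. 0) t = 0"
proof -
  have 0: "clinear (\<lambda>_. 0 :: complex)" by (simp add: clinear_iff scaleC_complex_def)
  show ?thesis
    by (induct t rule: tensor_induct)
      (simp_all add: left_slice_tensor[OF 0] left_slice_linear[OF 0])
qed

lemma slice_slice: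
  assumes "clinear f" "clinear g"
  shows "f (right_slice g t) = g (left_slice f t)"
  by (rule clinear_tensor_eqI[of "f \<circ> right_slice g" "g \<circ> left_slice f", unfolded o_def, OF
        clinear_compose[OF assms(1) right_slice_clinear[OF assms(2)]]
        clinear_compose[OF assms(2) left_slice_clinear[OF assms(1)]]])
    (simp add: assms left_slice_tensor right_slice_tensor clinear_scaleC[OF assms(1)]
      clinear_scaleC[OF assms(2)] scaleC_complex_def)

text \<open>
  The expansions hold over all large finite index sets, so that expansions of different vectors
  can be compared on a common one.
\<close>

lemma coordinate_functionals:
  obtains G :: "'a::complex_vector \<Rightarrow> 'a \<Rightarrow> complex"
  where "\<And>b. clinear (G b)"
    and "\<And>v. \<exists>S. finite S \<and> (\<forall>S'. finite S' \<longrightarrow> S \<subseteq> S' \<longrightarrow> (\<Sum>b\<in>S'. G b v *\<^sub>C b) = v)"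
proof
  define B where "B = complex_vector.extend_basis ({} :: 'a set)"
  have ind: "complex_vector.independent B" and span: "complex_vector.span B = UNIV"
    using complex_vector.independent_extend_basis[OF complex_vector.independent_empty]
      complex_vector.span_extend_basis[OF complex_vector.independent_empty]
    by (simp_all add: B_def)
  let ?R = "complex_vector.representation B"
  show "clinear (\<lambda>v. ?R v b)" for b
    using ind span
    by (simp add: clinear_iff scaleC_complex_def complex_vector.representation_add
        complex_vector.representation_scale)
  show "\<exists>S. finite S \<and> (\<forall>S'. finite S' \<longrightarrow> S \<subseteq> S' \<longrightarrow> (\<Sum>b\<in>S'. ?R v b *\<^sub>C b) = v)" for v
  proof (intro exI[of _ "{b. ?R v b \<noteq> 0}"] conjI allI impI)
    show "finite {b. ?R v b \<noteq> 0}" by (rule complex_vector.finite_representation)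
    fix S' assume S': "finite S'" "{b. ?R v b \<noteq> 0} \<subseteq> S'"
    have "(\<Sum>b\<in>S'. ?R v b *\<^sub>C b) = (\<Sum>b | ?R v b \<noteq> 0. ?R v b *\<^sub>C b)"
      using S' by (intro sum.mono_neutral_right) auto
    also have "\<dots> = v"
      using ind span by (intro complex_vector.sum_nonzero_representation_eq) auto
    finally show "(\<Sum>b\<in>S'. ?R v b *\<^sub>C b) = v" .
  qed
qed

lemma functionals_separate:
  fixes v :: "'a::complex_vector"
  assumes "\<And>g. clinear g \<Longrightarrow> g v = (0::complex)"
  shows "v = 0"
proof -
  obtain G :: "'a \<Rightarrow> 'a \<Rightarrow> complex" where "\<And>b. clinear (G b)"
    and "\<And>v. \<exists>S. finite S \<and> (\<forall>S'. finite S' \<longrightarrow> S \<subseteq> S' \<longrightarrow> (\<Sum>b\<in>S'. G b v *\<^sub>C b) = v)"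
    using coordinate_functionals by blast
  then obtain S where "(\<Sum>b\<in>S. G b v *\<^sub>C b) = v" and "\<And>b. clinear (G b)"
    by (metis order_refl)
  then show ?thesis using assms by (metis (no_types, lifting) complex_vector.scale_zero_left sum.neutral)
qed

text \<open>
  The coefficients of a tensor with respect to a basis of the second factor are slices of it.
\<close>

lemma tensor_slice_expansion:
  fixes t :: "'a::complex_vector \<otimes> 'b::complex_vector"
  shows "\<exists>S G. (\<forall>b\<in>S. clinear (G b)) \<and> t = (\<Sum>b\<in>S. right_slice (G b) t \<otimes> b)"
proof -
  obtain G :: "'b \<Rightarrow> 'b \<Rightarrow> complex" where G: "\<And>b. clinear (G b)"
    and S: "\<And>v. \<exists>S. finite S \<and> (\<forall>S'. finite S' \<longrightarrow> S \<subseteq> S' \<longrightarrow> (\<Sum>b\<in>S'. G b v *\<^sub>C b) = v)"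
    using coordinate_functionals by blast
  have "\<exists>S. finite S \<and> (\<forall>S'. finite S' \<longrightarrow> S \<subseteq> S' \<longrightarrow> (\<Sum>b\<in>S'. right_slice (G b) t \<otimes> b) = t)"
  proof (induct t rule: tensor_induct)
    case (tensor x y)
    obtain S where "finite S" "\<And>S'. finite S' \<Longrightarrow> S \<subseteq> S' \<Longrightarrow> (\<Sum>b\<in>S'. G b y *\<^sub>C b) = y"
      using S by blast
    moreover have "(\<Sum>b\<in>S'. right_slice (G b) (x \<otimes> y) \<otimes> b) = x \<otimes> (\<Sum>b\<in>S'. G b y *\<^sub>C b)" for S'
    proof -
      have "clinear (\<lambda>v. x \<otimes> v)" by (simp add: clinear_iff tensor_linear_simps)
      from clinear_sum[OF this, of "\<lambda>b. G b y *\<^sub>C b" S'] show ?thesis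
        by (simp only: right_slice_tensor[OF G] tensor_scaleC_left tensor_scaleC_right)
    qed
    ultimately show ?case by metis
  next
    case (add s t)
    then obtain S T where "finite S" "finite T"
      "\<And>S'. finite S' \<Longrightarrow> S \<subseteq> S' \<Longrightarrow> (\<Sum>b\<in>S'. right_slice (G b) s \<otimes> b) = s"
      "\<And>S'. finite S' \<Longrightarrow> T \<subseteq> S' \<Longrightarrow> (\<Sum>b\<in>S'. right_slice (G b) t \<otimes> b) = t" by blast
    then show ?case
      by (intro exI[of _ "S \<union> T"])
        (simp add: clinear_add[OF right_slice_clinear[OF G]] tensor_add_left sum.distrib)
  next
    case (scaleC c t)
    then show ?case
      by (auto simp: clinear_scaleC[OF right_slice_clinear[OF G]] tensor_scaleC_left
          simp flip: complex_vector.scale_sum_right)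
  qed
  then show ?thesis using G by (metis order_refl)
qed

text \<open>
  In the expansion of \<open>t\<close> along a basis of the second factor the coefficients are right slices of \<open>t\<close>.
  Left and right slices commute, so the functionals in \<open>F\<close> vanish on these coefficients: \<open>t\<close> lies in
  the tensor product of the common kernel of \<open>F\<close> with the second factor.
\<close>

lemma vanish_by_slices:
  fixes t :: "'a::complex_vector \<otimes> 'b::complex_vector"
  assumes H: "clinear H" and left: "\<And>f. f \<in> F \<Longrightarrow> clinear f \<and> left_slice f t = 0"
    and vanish: "\<And>x y. (\<And>f. f \<in> F \<Longrightarrow> f x = 0) \<Longrightarrow> H (x \<otimes> y) = 0"
  shows "H t = 0"
proof -
  obtain S G where G: "\<forall>b\<in>S. clinear (G b)" and t: "t = (\<Sum>b\<in>S. right_slice (G b) t \<otimes> b)"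
    using tensor_slice_expansion by blast
  have "H (right_slice (G b) t \<otimes> b) = 0" if "b \<in> S" for b
    using that G left by (intro vanish) (simp add: slice_slice clinear_zero)
  then show ?thesis
    by (subst t) (simp add: clinear_sum[OF H])
qed

lemma zero_by_left_slices:
  assumes "\<And>f. f \<in> F \<Longrightarrow> clinear f \<and> left_slice f t = 0"
    and "\<And>x. (\<And>f. f \<in> F \<Longrightarrow> f x = 0) \<Longrightarrow> x = 0"
  shows "t = 0"
  using vanish_by_slices[OF clinear_id(1) assms(1)] assms(2) by (metis id_apply tensor_zero_left)

lemma tensor_flip_tensor: "tensor_flip (a \<otimes> b) = b \<otimes> a"
  and tensor_flip_clinear: "clinear tensor_flip"
proof -
  have *: "cbilinear (\<lambda>a b. b \<otimes> a)"
    by (simp add: cbilinear_def clinear_iff tensor_linear_simps)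
  show "tensor_flip (a \<otimes> b) = b \<otimes> a" "clinear tensor_flip"
    unfolding tensor_flip_def by (simp_all add: tensor_lift_tensor tensor_lift_clinear *)
qed

lemmas tensor_flip_linear = clinear_add[OF tensor_flip_clinear] clinear_scaleC[OF tensor_flip_clinear]

lemma tensor_flip_flip: "tensor_flip (tensor_flip t) = t"
  by (induct t rule: tensor_induct) (simp_all add: tensor_flip_tensor tensor_flip_linear)

lemma slice_flip:
  assumes "clinear f"
  shows "left_slice f (tensor_flip t) = right_slice f t"
    and "right_slice f (tensor_flip t') = left_slice f t'"
proof -
  show *: "left_slice f (tensor_flip t) = right_slice f t" for t :: "'b \<otimes> 'a"
    using assms by (induct t rule: tensor_induct)
      (simp_all add: tensor_flip_linear tensor_flip_tensor left_slice_tensor right_slice_tensor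
        clinear_add[OF left_slice_clinear] clinear_add[OF right_slice_clinear]
        clinear_scaleC[OF left_slice_clinear] clinear_scaleC[OF right_slice_clinear])
  show "right_slice f (tensor_flip t') = left_slice f t'" for t' :: "'a \<otimes> 'c"
    using assms by (induct t' rule: tensor_induct)
      (simp_all add: tensor_flip_linear tensor_flip_tensor left_slice_tensor right_slice_tensor
        clinear_add[OF left_slice_clinear] clinear_add[OF right_slice_clinear]
        clinear_scaleC[OF left_slice_clinear] clinear_scaleC[OF right_slice_clinear])
qed

lemma zero_by_right_slices:
  assumes "\<And>f. f \<in> F \<Longrightarrow> clinear f \<and> right_slice f t = 0"
    and "\<And>x. (\<And>f. f \<in> F \<Longrightarrow> f x = 0) \<Longrightarrow> x = 0"
  shows "t = 0"
proof -
  have "tensor_flip t = 0"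
    using assms by (intro zero_by_left_slices[of F]) (auto simp: slice_flip)
  then show ?thesis by (metis clinear_zero tensor_flip_clinear tensor_flip_flip)
qed

lemma tensor_assoc_inner:
  fixes c :: "'c::complex_vector"
  shows "cbilinear (\<lambda>(a::'a::complex_vector) (b::'b::complex_vector). a \<otimes> b \<otimes> c)"
    and "cbilinear (\<lambda>(t::'a \<otimes> 'b) (c::'c). tensor_lift (\<lambda>a b. a \<otimes> b \<otimes> c) t)"
proof -
  show *: "cbilinear (\<lambda>(a::'a) (b::'b). a \<otimes> b \<otimes> c)" for c :: 'c
    by (simp add: cbilinear_def clinear_iff tensor_linear_simps)
  have "clinear (\<lambda>c::'c. tensor_lift (\<lambda>a b. a \<otimes> b \<otimes> c) t)" for t :: "'a \<otimes> 'b"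
    by (induct t rule: tensor_induct)
      (simp_all add: clinear_iff tensor_lift_tensor[OF *] tensor_lift_add[OF *] tensor_lift_scaleC[OF *]
        tensor_linear_simps mult.commute)
  then show "cbilinear (\<lambda>(t::'a \<otimes> 'b) (c::'c). tensor_lift (\<lambda>a b. a \<otimes> b \<otimes> c) t)"
    by (simp add: cbilinear_def tensor_lift_clinear[OF *])
qed

lemma tensor_assoc_tensor: "tensor_assoc ((a \<otimes> b) \<otimes> c) = a \<otimes> b \<otimes> c"
  and tensor_assoc_clinear: "clinear tensor_assoc"
  unfolding tensor_assoc_def by (simp_all add: tensor_lift_tensor tensor_lift_clinear tensor_assoc_inner)

lemmas tensor_assoc_linear = clinear_add[OF tensor_assoc_clinear] clinear_scaleC[OF tensor_assoc_clinear]

lemma clinear_tensor_eqI3: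
  assumes f: "clinear f" and g: "clinear g" and "\<And>a b c. f (a \<otimes> b \<otimes> c) = g (a \<otimes> b \<otimes> c)"
  shows "f t = g t"
proof (rule clinear_tensor_eqI[OF f g])
  show "f (a \<otimes> s) = g (a \<otimes> s)" for a s
    by (rule clinear_tensor_eqI[of "\<lambda>s. f (a \<otimes> s)" "\<lambda>s. g (a \<otimes> s)"])
      (use f g in \<open>simp_all add: assms clinear_iff tensor_linear_simps\<close>)
qed

lemma clinear_tensor_eqI3':
  assumes f: "clinear f" and g: "clinear g" and "\<And>a b c. f ((a \<otimes> b) \<otimes> c) = g ((a \<otimes> b) \<otimes> c)"
  shows "f t = g t"
proof (rule clinear_tensor_eqI[OF f g])
  show "f (s \<otimes> a) = g (s \<otimes> a)" for a s
    by (rule clinear_tensor_eqI[of "\<lambda>s. f (s \<otimes> a)" "\<lambda>s. g (s \<otimes> a)"])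
      (use f g in \<open>simp_all add: assms clinear_iff tensor_linear_simps\<close>)
qed

lemma
  fixes a :: "'a::complex_vector" and b :: "'b::complex_vector" and c :: "'c::complex_vector"
  shows bij_tensor_assoc: "bij (tensor_assoc :: ('a \<otimes> 'b) \<otimes> 'c \<Rightarrow> 'a \<otimes> 'b \<otimes> 'c)"
    and inv_tensor_assoc: "inv tensor_assoc (a \<otimes> b \<otimes> c) = (a \<otimes> b) \<otimes> c"
proof -
  \<comment> \<open>Conjugating \<open>(x \<otimes> y) \<otimes> z \<mapsto> x \<otimes> y \<otimes> z\<close> with the reversal of the factors gives its inverse.\<close>
  define u :: "'a \<otimes> 'b \<otimes> 'c \<Rightarrow> ('a \<otimes> 'b) \<otimes> 'c" where
    "u = (\<lambda>t. tensor_flip (tensor_map id tensor_flip (tensor_assoc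
      (tensor_flip (tensor_map id tensor_flip t)))))"
  have u: "clinear u"
    by (simp add: u_def clinear_iff tensor_flip_linear tensor_flip_clinear clinear_id
        tensor_assoc_linear
        tensor_map_linear)
  have u_tensor: "u (a \<otimes> b \<otimes> c) = (a \<otimes> b) \<otimes> c" for a b c
    by (simp add: u_def tensor_map_tensor tensor_flip_tensor tensor_assoc_tensor
        clinear_id tensor_flip_clinear)
  have 1: "u (tensor_assoc t) = t" for t
    using clinear_tensor_eqI3'[OF clinear_comp[OF u tensor_assoc_clinear] clinear_id(1), of t]
    by (simp add: u_tensor tensor_assoc_tensor)
  have 2: "tensor_assoc (u t) = t" for t
    using clinear_tensor_eqI3[OF clinear_comp[OF tensor_assoc_clinear u] clinear_id(1), of t]
    by (simp add: u_tensor tensor_assoc_tensor)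
  show bij: "bij (tensor_assoc :: ('a \<otimes> 'b) \<otimes> 'c \<Rightarrow> 'a \<otimes> 'b \<otimes> 'c)"
    using 1 2 by (intro o_bij[of u]) (auto simp: fun_eq_iff)
  show "inv tensor_assoc (a \<otimes> b \<otimes> c) = (a \<otimes> b) \<otimes> c"
    using bij_is_inj[OF bij] by (intro inv_f_eq) (simp_all add: tensor_assoc_tensor)
qed

lemma inv_tensor_assoc_clinear: "clinear (inv tensor_assoc)"
  by (rule clinear_inv[OF tensor_assoc_clinear bij_tensor_assoc])

lemma tensor_flip23_tensor: "tensor_flip23 (a \<otimes> b \<otimes> c) = a \<otimes> c \<otimes> b"
  and tensor_flip23_clinear: "clinear tensor_flip23"
  by (simp_all add: tensor_flip23_def tensor_map_tensor tensor_map_clinear clinear_id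
      tensor_flip_clinear tensor_flip_tensor)

lemmas tensor_flip23_linear = clinear_add[OF tensor_flip23_clinear] clinear_scaleC[OF tensor_flip23_clinear]

lemma tensor_flip23_flip23: "tensor_flip23 (tensor_flip23 t) = t"
  using clinear_tensor_eqI3[OF clinear_comp[OF tensor_flip23_clinear tensor_flip23_clinear]
      clinear_id(1), of t]
  by (simp add: tensor_flip23_tensor)

lemma bij_tensor_flip: "bij tensor_flip"
  and inv_tensor_flip: "inv tensor_flip = tensor_flip"
  and bij_tensor_flip23: "bij tensor_flip23"
  and inv_tensor_flip23: "inv tensor_flip23 = tensor_flip23"
proof -
  show "bij tensor_flip" by (rule o_bij[of tensor_flip]) (simp_all add: fun_eq_iff tensor_flip_flip)
  show "inv tensor_flip = tensor_flip" by (rule inv_equality) (rule tensor_flip_flip)+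
  show "bij tensor_flip23"
    by (rule o_bij[of tensor_flip23]) (simp_all add: fun_eq_iff tensor_flip23_flip23)
  show "inv tensor_flip23 = tensor_flip23" by (rule inv_equality) (rule tensor_flip23_flip23)+
qed

section \<open>Legs of operators on triple tensor products\<close>

text \<open>
  Leg numbering for operators. The definitions parallel those of \<open>leg12\<close>, \<open>leg13\<close> and \<open>leg23\<close>, so that
  left multiplication by a leg of a multiplier is the corresponding leg of left multiplication.
\<close>

definition leg12_map :: "('a::complex_vector \<otimes> 'b::complex_vector \<Rightarrow> 'c::complex_vector \<otimes> 'd::complex_vector)
    \<Rightarrow> 'a \<otimes> 'b \<otimes> 'e::complex_vector \<Rightarrow> 'c \<otimes> 'd \<otimes> 'e"
  where "leg12_map f = tensor_assoc \<circ> tensor_map f id \<circ> inv tensor_assoc"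

definition leg23_map :: "('a::complex_vector \<otimes> 'b::complex_vector \<Rightarrow> 'c::complex_vector \<otimes> 'd::complex_vector)
    \<Rightarrow> 'e::complex_vector \<otimes> 'a \<otimes> 'b \<Rightarrow> 'e \<otimes> 'c \<otimes> 'd"
  where "leg23_map f = tensor_map id f"

definition leg13_map :: "('a::complex_vector \<otimes> 'b::complex_vector \<Rightarrow> 'c::complex_vector \<otimes> 'd::complex_vector)
    \<Rightarrow> 'a \<otimes> 'e::complex_vector \<otimes> 'b \<Rightarrow> 'c \<otimes> 'e \<otimes> 'd"
  where "leg13_map f = tensor_flip23 \<circ> leg12_map f \<circ> tensor_flip23"

lemma leg12_map_clinear: "clinear f \<Longrightarrow> clinear (leg12_map f)"
  and leg23_map_clinear: "clinear f \<Longrightarrow> clinear (leg23_map f)"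
  and leg13_map_clinear: "clinear f \<Longrightarrow> clinear (leg13_map f)"
  by (simp_all add: leg12_map_def leg23_map_def leg13_map_def clinear_comp tensor_assoc_clinear
      tensor_map_clinear inv_tensor_assoc_clinear clinear_id tensor_flip23_clinear)

lemmas leg12_map_linear = clinear_add[OF leg12_map_clinear] clinear_scaleC[OF leg12_map_clinear]
lemmas leg23_map_linear = clinear_add[OF leg23_map_clinear] clinear_scaleC[OF leg23_map_clinear]
lemmas leg13_map_linear = clinear_add[OF leg13_map_clinear] clinear_scaleC[OF leg13_map_clinear]

lemma leg12_map_tensor: "clinear f \<Longrightarrow> leg12_map f (a \<otimes> b \<otimes> c) = tensor_assoc (f (a \<otimes> b) \<otimes> c)"
  and leg23_map_tensor: "clinear f \<Longrightarrow> leg23_map f (c \<otimes> t) = c \<otimes> f t"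
  and leg13_map_tensor:
    "clinear f \<Longrightarrow> leg13_map f (a \<otimes> c \<otimes> b) = tensor_flip23 (tensor_assoc (f (a \<otimes> b) \<otimes> c))"
  by (simp_all add: leg12_map_def leg23_map_def leg13_map_def tensor_map_tensor clinear_id
      inv_tensor_assoc tensor_flip23_tensor)

lemma leg12_map_comp: "clinear f \<Longrightarrow> clinear g \<Longrightarrow> leg12_map f (leg12_map g t) = leg12_map (f \<circ> g) t"
  and leg23_map_comp: "clinear f \<Longrightarrow> clinear g \<Longrightarrow> leg23_map f (leg23_map g t') = leg23_map (f \<circ> g) t'"
  and leg13_map_comp: "clinear f \<Longrightarrow> clinear g \<Longrightarrow> leg13_map f (leg13_map g t'') = leg13_map (f \<circ> g) t''"
proof -
  assume f: "clinear f" and g: "clinear g"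
  show 12: "leg12_map f (leg12_map g t) = leg12_map (f \<circ> g) t" for t
    by (simp add: leg12_map_def bij_is_inj[OF bij_tensor_assoc] tensor_map_map f g clinear_id)
  show "leg23_map f (leg23_map g t') = leg23_map (f \<circ> g) t'"
    by (simp add: leg23_map_def tensor_map_map f g clinear_id)
  show "leg13_map f (leg13_map g t'') = leg13_map (f \<circ> g) t''"
    by (simp add: leg13_map_def tensor_flip23_flip23 12)
qed

lemma leg12_map_id: "leg12_map id = id"
  and leg23_map_id: "leg23_map id = id"
  and leg13_map_id: "leg13_map id = id"
proof -
  show 12: "leg12_map id = id"
    by (simp add: leg12_map_def tensor_map_id fun_eq_iff bij_is_surj[OF bij_tensor_assoc] surj_f_inv_f)
  show "leg23_map id = id" by (simp add: leg23_map_def tensor_map_id)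
  show "leg13_map id = id" by (simp add: leg13_map_def 12 fun_eq_iff tensor_flip23_flip23)
qed

lemma tensor_assoc_map:
  assumes "clinear f" "clinear g" "clinear h"
  shows "tensor_assoc (tensor_map f g t \<otimes> h c) = tensor_map f (tensor_map g h) (tensor_assoc (t \<otimes> c))"
  using assms
  by (induct t rule: tensor_induct)
    (simp_all add: tensor_map_tensor tensor_map_clinear tensor_assoc_tensor tensor_linear_simps
      tensor_assoc_linear tensor_map_linear)

lemma leg12_map_natural:
  fixes f :: "'a::complex_vector \<otimes> 'b::complex_vector \<Rightarrow> 'a \<otimes> 'b"
    and f' :: "'c::complex_vector \<otimes> 'd::complex_vector \<Rightarrow> 'c \<otimes> 'd"
  assumes lin: "clinear f" "clinear f'" "clinear g" "clinear h" "clinear k"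
    and nat: "\<And>x y. f (g x \<otimes> h y) = tensor_map g h (f' (x \<otimes> y))"
  shows "leg12_map f (tensor_map g (tensor_map h k) t) = tensor_map g (tensor_map h k) (leg12_map f' t)"
proof -
  let ?T = "tensor_map g (tensor_map h k)"
  have T: "clinear ?T" using lin by (simp add: tensor_map_clinear)
  show ?thesis
    using clinear_tensor_eqI3[OF clinear_comp[OF leg12_map_clinear[OF lin(1)] T]
        clinear_comp[OF T leg12_map_clinear[OF lin(2)]], of t]
    by (simp add: tensor_map_tensor tensor_map_clinear lin leg12_map_tensor nat tensor_assoc_map)
qed

lemma tensor_flip23_map:
  assumes "clinear f" "clinear g" "clinear h"
  shows "tensor_flip23 (tensor_map f (tensor_map g h) t) = tensor_map f (tensor_map h g) (tensor_flip23 t)"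
proof -
  have T: "clinear (tensor_map f (tensor_map g h))" "clinear (tensor_map f (tensor_map h g))"
    using assms by (simp_all add: tensor_map_clinear)
  show ?thesis
    using clinear_tensor_eqI3[OF clinear_comp[OF tensor_flip23_clinear T(1)]
        clinear_comp[OF T(2) tensor_flip23_clinear], of t]
    by (simp add: tensor_map_tensor tensor_map_clinear assms tensor_flip23_tensor)
qed

lemma leg13_map_natural:
  fixes f :: "'a::complex_vector \<otimes> 'b::complex_vector \<Rightarrow> 'a \<otimes> 'b"
    and f' :: "'c::complex_vector \<otimes> 'd::complex_vector \<Rightarrow> 'c \<otimes> 'd"
  assumes lin: "clinear f" "clinear f'" "clinear g" "clinear h" "clinear k"
    and nat: "\<And>x y. f (g x \<otimes> h y) = tensor_map g h (f' (x \<otimes> y))"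
  shows "leg13_map f (tensor_map g (tensor_map k h) t) = tensor_map g (tensor_map k h) (leg13_map f' t)"
  using assms by (simp add: leg13_map_def tensor_flip23_map leg12_map_natural[OF lin nat])

lemma leg23_map_natural:
  fixes f :: "'a::complex_vector \<otimes> 'b::complex_vector \<Rightarrow> 'a \<otimes> 'b"
    and f' :: "'c::complex_vector \<otimes> 'd::complex_vector \<Rightarrow> 'c \<otimes> 'd"
  assumes lin: "clinear f" "clinear f'" "clinear g" "clinear h" "clinear k"
    and nat: "\<And>x y. f (g x \<otimes> h y) = tensor_map g h (f' (x \<otimes> y))"
  shows "leg23_map f (tensor_map k (tensor_map g h) t) = tensor_map k (tensor_map g h) (leg23_map f' t)"
proof -
  let ?T = "tensor_map k (tensor_map g h)"
  have T: "clinear ?T" using lin by (simp add: tensor_map_clinear)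
  show ?thesis
    using clinear_tensor_eqI3[OF clinear_comp[OF leg23_map_clinear[OF lin(1)] T]
        clinear_comp[OF T leg23_map_clinear[OF lin(2)]], of t]
    by (simp add: tensor_map_tensor tensor_map_clinear lin leg23_map_tensor nat)
qed

lemma leg13_map_flip12:
  assumes f: "clinear f"
  shows "leg13_map f (leg12_map tensor_flip t) = leg12_map tensor_flip (leg23_map f t)"
proof -
  note flip12 = leg12_map_clinear[OF tensor_flip_clinear]
  have *: "leg12_map tensor_flip (a \<otimes> z) = tensor_flip23 (tensor_assoc (z \<otimes> a))" for a z
    by (induct z rule: tensor_induct)
      (simp_all add: leg12_map_tensor[OF tensor_flip_clinear] tensor_flip_tensor tensor_assoc_tensor
        tensor_flip23_tensor tensor_linear_simps clinear_add[OF flip12] clinear_scaleC[OF flip12]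
        tensor_assoc_linear tensor_flip23_linear)
  show ?thesis
    using clinear_tensor_eqI3[OF clinear_comp[OF leg13_map_clinear[OF f] flip12]
        clinear_comp[OF flip12 leg23_map_clinear[OF f]], of t]
    by (simp add: leg23_map_tensor[OF f] *)
      (simp add: leg12_map_tensor tensor_flip_clinear tensor_flip_tensor tensor_assoc_tensor
        leg13_map_tensor[OF f] tensor_flip23_tensor)
qed

lemma tensor_flip_comp_flip: "tensor_flip \<circ> tensor_flip = id"
  by (simp add: fun_eq_iff tensor_flip_flip)

lemma leg12_flip_flip: "leg12_map tensor_flip (leg12_map tensor_flip t) = t"
  by (simp add: leg12_map_comp[OF tensor_flip_clinear tensor_flip_clinear] tensor_flip_comp_flip
      leg12_map_id)

lemma leg23_map_flip12:
  assumes f: "clinear f"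
  shows "leg23_map f (leg12_map tensor_flip t) = leg12_map tensor_flip (leg13_map f t)"
  using leg13_map_flip12[OF f, of "leg12_map tensor_flip t"] by (metis leg12_flip_flip)

lemma left_slice_assoc:
  assumes "clinear f"
  shows "left_slice f (tensor_assoc (t \<otimes> c)) = left_slice f t \<otimes> c"
  using assms
  by (induct t rule: tensor_induct)
    (simp_all add: left_slice_tensor left_slice_linear tensor_assoc_tensor tensor_assoc_linear
      tensor_linear_simps)

lemma left_slice_leg23_map:
  assumes "clinear f" "clinear g"
  shows "left_slice f (leg23_map g t) = g (left_slice f t)"
  using assms
  by (induct t rule: tensor_induct)
    (simp_all add: left_slice_tensor left_slice_linear leg23_map_tensor leg23_map_linear
      clinear_add[OF assms(2)] clinear_scaleC[OF assms(2)])

text \<open>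
  Reversing the three factors exchanges \<open>\<Delta>(h)(x \<otimes> 1)\<close>, the form in which the coproduct occurs in
  \<open>\<Delta> \<otimes> \<iota>\<close> and \<open>\<iota> \<otimes> \<Delta>\<close>, with its flip \<open>W(h \<otimes> x)\<close>. It also carries the pentagon equation of an operator
  over to its conjugate by the flip.
\<close>

definition rev3 :: "'a::complex_vector \<otimes> 'b::complex_vector \<otimes> 'c::complex_vector \<Rightarrow> 'c \<otimes> 'b \<otimes> 'a"
  where "rev3 = tensor_assoc \<circ> tensor_flip \<circ> tensor_map id tensor_flip"

lemma rev3_tensor: "rev3 (a \<otimes> t) = tensor_assoc (tensor_flip t \<otimes> a)"
  and rev3_clinear: "clinear rev3"
  by (simp_all add: rev3_def tensor_map_tensor clinear_id tensor_flip_clinear tensor_flip_tensor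
      clinear_comp tensor_assoc_clinear tensor_map_clinear)

lemma rev3_rev3: "rev3 (rev3 t) = t"
  using clinear_tensor_eqI3[OF clinear_comp[OF rev3_clinear rev3_clinear] clinear_id(1), of t]
  by (simp add: rev3_tensor tensor_flip_tensor tensor_assoc_tensor)

lemmas rev3_linear = clinear_add[OF rev3_clinear] clinear_scaleC[OF rev3_clinear]

lemma rev3_assoc: "rev3 (tensor_assoc (t \<otimes> c)) = c \<otimes> tensor_flip t"
  by (induct t rule: tensor_induct)
    (simp_all add: tensor_linear_simps tensor_assoc_linear rev3_linear tensor_flip_linear
      rev3_tensor tensor_flip_tensor tensor_assoc_tensor)

lemma rev3_leg12_map:
  assumes f: "clinear f"
  shows "rev3 (leg12_map f t) = leg23_map (tensor_flip \<circ> f \<circ> tensor_flip) (rev3 t)"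
proof -
  have g: "clinear (tensor_flip \<circ> f \<circ> tensor_flip)"
    by (intro clinear_comp tensor_flip_clinear f)
  show ?thesis
    using clinear_tensor_eqI3[OF clinear_comp[OF rev3_clinear leg12_map_clinear[OF f]]
        clinear_comp[OF leg23_map_clinear[OF g] rev3_clinear], of t]
    by (simp add: leg12_map_tensor[OF f] rev3_assoc leg23_map_tensor[OF g, unfolded o_def] o_def
        rev3_tensor tensor_flip_tensor tensor_assoc_tensor)
qed

lemma rev3_leg23_map:
  assumes f: "clinear f"
  shows "rev3 (leg23_map f t) = leg12_map (tensor_flip \<circ> f \<circ> tensor_flip) (rev3 t)"
proof -
  have g: "clinear (tensor_flip \<circ> f \<circ> tensor_flip)"
    by (intro clinear_comp tensor_flip_clinear f)
  show ?thesis
    using rev3_leg12_map[OF g, of "rev3 t"]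
    by (simp add: rev3_rev3 o_def tensor_flip_flip) (metis rev3_rev3)
qed

lemma rev3_leg13_map:
  assumes f: "clinear f"
  shows "rev3 (leg13_map f t) = leg13_map (tensor_flip \<circ> f \<circ> tensor_flip) (rev3 t)"
proof -
  have g: "clinear (tensor_flip \<circ> f \<circ> tensor_flip)"
    by (intro clinear_comp tensor_flip_clinear f)
  have *: "rev3 (tensor_flip23 (tensor_assoc (z \<otimes> c))) =
      tensor_flip23 (tensor_assoc (tensor_flip z \<otimes> c))" for z c
    by (induct z rule: tensor_induct)
      (simp_all add: rev3_linear tensor_linear_simps tensor_assoc_linear tensor_flip_linear
        tensor_flip23_linear
        tensor_assoc_tensor tensor_flip_tensor tensor_flip23_tensor rev3_tensor)
  show ?thesis
    using clinear_tensor_eqI3[OF clinear_comp[OF rev3_clinear leg13_map_clinear[OF f]]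
        clinear_comp[OF leg13_map_clinear[OF g] rev3_clinear], of t]
    by (simp add: leg13_map_tensor[OF f] * leg13_map_tensor[OF g, unfolded o_def] o_def
        rev3_tensor tensor_flip_tensor tensor_assoc_tensor)
qed

section \<open>Multipliers\<close>

text \<open>
  Slicing with \<open>y \<mapsto> g(y b)\<close> turns right multiplication by \<open>a \<otimes> b\<close> into right multiplication by \<open>a\<close>. Hence
  a tensor that is annihilated by multiplication has vanishing slices by non-degeneracy of the first
  factor, and these slices separate points by non-degeneracy of the second.
\<close>

instance tensor :: (nondegenerate_algebra, nondegenerate_algebra) nondegenerate_algebra
proof
  fix t :: "'a \<otimes> 'b"
  have slice: "right_slice (\<lambda>y. g (y * b)) t * a = right_slice g (t * (a \<otimes> b))"
    "a * right_slice (\<lambda>y. g (b * y)) t = right_slice g ((a \<otimes> b) * t)"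
    if "clinear g" for g :: "'b \<Rightarrow> complex" and a b
  proof -
    have g: "clinear (\<lambda>y. g (y * b))" "clinear (\<lambda>y. g (b * y))"
      using that by (simp_all add: clinear_iff tensor_linear_simps)
    note rules = right_slice_tensor[OF g(1)] right_slice_tensor[OF g(2)] right_slice_tensor[OF that]
      right_slice_linear[OF g(1)]
      right_slice_linear[OF g(2)]
      right_slice_linear[OF that]
    show "right_slice (\<lambda>y. g (y * b)) t * a = right_slice g (t * (a \<otimes> b))"
      by (induct t rule: tensor_induct) (simp_all add: rules tensor_mult tensor_linear_simps)
    show "a * right_slice (\<lambda>y. g (b * y)) t = right_slice g ((a \<otimes> b) * t)"
      by (induct t rule: tensor_induct) (simp_all add: rules tensor_mult tensor_linear_simps)
  qed
  have lin: "clinear (\<lambda>y. g (y * b))" "clinear (\<lambda>y. g (b * y))"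
    if "clinear g" for g :: "'b \<Rightarrow> complex" and b
    using that by (simp_all add: clinear_iff tensor_linear_simps)
  show "t = 0" if 0: "\<And>s. t * s = 0"
  proof (rule zero_by_right_slices[of "{\<lambda>y. g (y * b) | g b. clinear g}"])
    show "clinear f \<and> right_slice f t = 0" if "f \<in> {\<lambda>y. g (y * b) | g b. clinear g}" for f
    proof -
      obtain g b where f: "f = (\<lambda>y. g (y * b))" and g: "clinear g"
        using \<open>f \<in> _\<close> by blast
      have "right_slice f t = 0"
        by (rule nondegenerate_left)
          (simp add: f slice(1)[OF g] 0 clinear_zero[OF right_slice_clinear[OF g]])
      then show ?thesis using lin(1)[OF g] by (simp add: f)
    qed
    show "x = 0" if x: "\<And>f. f \<in> {\<lambda>y. g (y * b) | g b. clinear g} \<Longrightarrow> f x = (0::complex)"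
      for x :: 'b
      by (rule nondegenerate_left, rule functionals_separate) (use x in blast)
  qed
  show "t = 0" if 0: "\<And>s. s * t = 0"
  proof (rule zero_by_right_slices[of "{\<lambda>y. g (b * y) | g b. clinear g}"])
    show "clinear f \<and> right_slice f t = 0" if "f \<in> {\<lambda>y. g (b * y) | g b. clinear g}" for f
    proof -
      obtain g b where f: "f = (\<lambda>y. g (b * y))" and g: "clinear g"
        using \<open>f \<in> _\<close> by blast
      have "right_slice f t = 0"
        by (rule nondegenerate_right)
          (simp add: f slice(2)[OF g] 0 clinear_zero[OF right_slice_clinear[OF g]])
      then show ?thesis using lin(2)[OF g] by (simp add: f)
    qed
    show "x = 0" if x: "\<And>f. f \<in> {\<lambda>y. g (b * y) | g b. clinear g} \<Longrightarrow> f x = (0::complex)"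
      for x :: 'b
      by (rule nondegenerate_right, rule functionals_separate) (use x in blast)
  qed
qed

lemma lmult_clinear: "clinear ((\<rhd>) m)"
  by transfer (auto simp: is_multiplier_def)

lemma rmult_clinear: "clinear (\<lambda>x. x \<lhd> m)"
  by transfer (auto simp: is_multiplier_def)

lemmas lmult_linear = clinear_add[OF lmult_clinear] clinear_scaleC[OF lmult_clinear]
  clinear_diff[OF lmult_clinear] clinear_zero[OF lmult_clinear]

lemmas rmult_linear = clinear_add[OF rmult_clinear] clinear_scaleC[OF rmult_clinear]

lemma lmult_mult: "m \<rhd> (x * y) = (m \<rhd> x) * y"
  and rmult_mult: "(x * y) \<lhd> m = x * (y \<lhd> m)"
  and mult_lmult: "x * (m \<rhd> y) = (x \<lhd> m) * y"
  by (transfer, auto simp: is_multiplier_def)+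

lemma lmult_simps:
  "(m * n) \<rhd> x = m \<rhd> n \<rhd> x" "1 \<rhd> x = x" "mult_of a \<rhd> x = a * x" "(m + n) \<rhd> x = m \<rhd> x + n \<rhd> x"
  "(m - n) \<rhd> x = m \<rhd> x - n \<rhd> x" "(c *\<^sub>C m) \<rhd> x = c *\<^sub>C (m \<rhd> x)" "0 \<rhd> x = 0"
  by (transfer, auto)+

lemma rmult_simps: "x \<lhd> (m * n) = x \<lhd> m \<lhd> n" "x \<lhd> 1 = x" "x \<lhd> mult_of a = x * a"
  by (transfer, auto)+

text \<open>
  The right action of a multiplier is determined by its left action, since \<open>(x m) y = x (m y)\<close>.
\<close>

lemma multiplier_eqI:
  fixes m n :: "'a::nondegenerate_algebra multiplier"
  assumes "\<And>x. m \<rhd> x = n \<rhd> x"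
  shows "m = n"
proof -
  have "x \<lhd> m = x \<lhd> n" for x
  proof -
    have "(x \<lhd> m - x \<lhd> n) * y = 0" for y
      by (simp add: left_diff_distrib assms flip: mult_lmult)
    then have "x \<lhd> m - x \<lhd> n = 0" by (rule nondegenerate_left)
    then show ?thesis by simp
  qed
  with assms show ?thesis
    by transfer (auto simp: fun_eq_iff)
qed

lemma mult_of_linear:
  "mult_of (x + y) = mult_of x + mult_of y" "mult_of (c *\<^sub>C x) = c *\<^sub>C mult_of x"
  by (simp_all add: mult_of.rep_eq plus_multiplier.rep_eq scaleC_multiplier.rep_eq fun_eq_iff
      tensor_linear_simps flip: Rep_multiplier_inject)

lemma mult_of_mult: "mult_of (x * y) = mult_of x * mult_of y"
  by transfer (auto simp: mult.assoc)

lemma mult_of_inject: "mult_of x = mult_of y \<longleftrightarrow> x = y" for x y :: "'a::nondegenerate_algebra"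
proof
  assume "mult_of x = mult_of y"
  then have "(x - y) * z = 0" for z
    by (metis left_diff_distrib lmult_simps(3) right_minus_eq)
  then have "x - y = 0" by (rule nondegenerate_left)
  then show "x = y" by simp
qed simp

lemma of_mult_mult_of: "of_mult (mult_of x) = x" for x :: "'a::nondegenerate_algebra"
  by (simp add: of_mult_def mult_of_inject)

lemma mult_of_of_mult:
  fixes m :: "'a::nondegenerate_algebra multiplier"
  shows "m \<in> range mult_of \<Longrightarrow> mult_of (of_mult m) = m"
  by (auto simp: of_mult_mult_of)

lemma of_mult_eqI: "mult_of x = m \<Longrightarrow> of_mult m = x" for x :: "'a::nondegenerate_algebra"
  by (auto simp: of_mult_mult_of)

lemma mult_mult_of: "m * mult_of x = mult_of (m \<rhd> x)" for x :: "'a::nondegenerate_algebra"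
  by (rule multiplier_eqI) (simp add: lmult_simps lmult_mult)

lemma mult_of_mult_right: "mult_of x * m = mult_of (x \<lhd> m)" for x :: "'a::nondegenerate_algebra"
  by (rule multiplier_eqI) (simp add: lmult_simps mult_lmult)

lemma lmult_mult_tensor: "(\<rhd>) (m \<otimes>\<^sub>M n) = tensor_map ((\<rhd>) m) ((\<rhd>) n)"
  by transfer (auto simp: fun_eq_iff)

lemma rmult_mult_tensor: "(\<lambda>x. x \<lhd> (m \<otimes>\<^sub>M n)) = tensor_map (\<lambda>x. x \<lhd> m) (\<lambda>x. x \<lhd> n)"
  by transfer (auto simp: fun_eq_iff)

lemma lmult_mult_tensor_tensor: "(m \<otimes>\<^sub>M n) \<rhd> (x \<otimes> y) = (m \<rhd> x) \<otimes> (n \<rhd> y)"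
  by (simp add: lmult_mult_tensor tensor_map_tensor lmult_clinear)

lemma rmult_mult_tensor_tensor: "(x \<otimes> y) \<lhd> (m \<otimes>\<^sub>M n) = (x \<lhd> m) \<otimes> (y \<lhd> n)"
  using rmult_mult_tensor[of m n, THEN fun_cong, of "x \<otimes> y"]
  by (simp add: tensor_map_tensor rmult_clinear)

lemma multiplier_tensor_eqI:
  fixes m n :: "('a::nondegenerate_algebra \<otimes> 'b::nondegenerate_algebra) multiplier"
  assumes "\<And>x y. m \<rhd> (x \<otimes> y) = n \<rhd> (x \<otimes> y)"
  shows "m = n"
  by (rule multiplier_eqI, rule clinear_tensor_eqI[OF lmult_clinear lmult_clinear], rule assms)

lemma mult_tensor_linear:
  fixes m m' :: "'a::nondegenerate_algebra multiplier" and n n' :: "'b::nondegenerate_algebra multiplier"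
  shows "(m + m') \<otimes>\<^sub>M n = m \<otimes>\<^sub>M n + m' \<otimes>\<^sub>M n" "m \<otimes>\<^sub>M (n + n') = m \<otimes>\<^sub>M n + m \<otimes>\<^sub>M n'"
    "(c *\<^sub>C m) \<otimes>\<^sub>M n = c *\<^sub>C (m \<otimes>\<^sub>M n)" "m \<otimes>\<^sub>M (c *\<^sub>C n) = c *\<^sub>C (m \<otimes>\<^sub>M n)"
  by (rule multiplier_tensor_eqI; simp add: lmult_mult_tensor_tensor lmult_simps tensor_linear_simps)+

lemma mult_tensor_mult:
  fixes m m' :: "'a::nondegenerate_algebra multiplier" and n n' :: "'b::nondegenerate_algebra multiplier"
  shows "(m \<otimes>\<^sub>M n) * (m' \<otimes>\<^sub>M n') = (m * m') \<otimes>\<^sub>M (n * n')"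
  by (rule multiplier_tensor_eqI) (simp add: lmult_mult_tensor_tensor lmult_simps)

lemma mult_tensor_mult_of:
  fixes x :: "'a::nondegenerate_algebra" and y :: "'b::nondegenerate_algebra"
  shows "mult_of x \<otimes>\<^sub>M mult_of y = mult_of (x \<otimes> y)"
  by (rule multiplier_tensor_eqI) (simp add: lmult_mult_tensor_tensor lmult_simps tensor_mult)

lemma mult_tensor_one:
  "(1 :: 'a::nondegenerate_algebra multiplier) \<otimes>\<^sub>M (1 :: 'b::nondegenerate_algebra multiplier) = 1"
  by (rule multiplier_tensor_eqI) (simp add: lmult_mult_tensor_tensor lmult_simps)

lemmas multiplier_linear_simps =
  mult_of_linear mult_tensor_linear scaleC_add_left scaleC_add_right scaleC_scaleC
  distrib_left distrib_right mult_scaleC_left mult_scaleC_right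

lemma is_multiplier_iso:
  assumes f: "clinear f" "bij f" and mult: "\<And>x y. f (x * y) = f x * f y"
  shows "is_multiplier (\<lambda>y. f (m \<rhd> inv f y)) (\<lambda>y. f (inv f y \<lhd> m))"
proof -
  have inv_f: "inv f (f x) = x" "f (inv f y) = y" for x y
    using f(2) by (simp_all add: bij_is_inj bij_is_surj surj_f_inv_f)
  have inv_mult: "inv f (x * y) = inv f x * inv f y" for x y
    by (metis inv_f mult)
  note inv_lin = clinear_inv[OF f]
  show ?thesis
    unfolding is_multiplier_def
  proof (intro conjI allI)
    show "clinear (\<lambda>y. f (m \<rhd> inv f y))" "clinear (\<lambda>y. f (inv f y \<lhd> m))"
      by (simp_all add: clinear_iff clinear_add[OF f(1)] clinear_scaleC[OF f(1)]
          clinear_add[OF inv_lin] clinear_scaleC[OF inv_lin] lmult_linear rmult_linear)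
    show "f (m \<rhd> inv f (x * y)) = f (m \<rhd> inv f x) * y" for x y
      by (metis inv_mult lmult_mult mult inv_f(2))
    show "f (inv f (x * y) \<lhd> m) = x * f (inv f y \<lhd> m)" for x y
      by (metis inv_mult rmult_mult mult inv_f(2))
    show "x * f (m \<rhd> inv f y) = f (inv f x \<lhd> m) * y" for x y
      by (metis mult_lmult mult inv_f(2))
  qed
qed

lemma lmult_multiplier_iso:
  assumes "clinear f" "bij f" "\<And>x y. f (x * y) = f x * f y"
  shows "(\<rhd>) (multiplier_iso f m) = f \<circ> (\<rhd>) m \<circ> inv f"
  using is_multiplier_iso[OF assms, of m]
  by (simp add: multiplier_iso_def lmult.rep_eq Abs_multiplier_inverse fun_eq_iff)

lemma tensor_flip_mult: "tensor_flip (s * t) = tensor_flip s * tensor_flip t"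
  for s t :: "'a::complex_algebra \<otimes> 'b::complex_algebra"
proof (induct s rule: tensor_induct)
  case (tensor a b)
  show ?case
    by (induct t rule: tensor_induct)
      (simp_all add: tensor_mult tensor_flip_tensor tensor_flip_linear tensor_linear_simps)
qed (simp_all add: tensor_flip_linear tensor_linear_simps)

lemma tensor_assoc_mult: "tensor_assoc (s * t) = tensor_assoc s * tensor_assoc t"
  for s t :: "('a::complex_algebra \<otimes> 'b::complex_algebra) \<otimes> 'c::complex_algebra"
proof -
  note lin = tensor_assoc_linear
  have "clinear (\<lambda>s. tensor_assoc (s * t))" "clinear (\<lambda>s. tensor_assoc s * tensor_assoc t)"
    "clinear (\<lambda>t. tensor_assoc (s * t))" "clinear (\<lambda>t. tensor_assoc s * tensor_assoc t)"
    for s t :: "('a \<otimes> 'b) \<otimes> 'c"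
    by (simp_all add: clinear_iff lin tensor_linear_simps)
  note * = clinear_tensor_eqI3'[OF this(1,2)] clinear_tensor_eqI3'[OF this(3,4)]
  show ?thesis
    by (rule *(1), rule *(2)) (simp add: tensor_mult tensor_assoc_tensor)
qed

lemma tensor_flip23_mult: "tensor_flip23 (s * t) = tensor_flip23 s * tensor_flip23 t"
  for s t :: "'a::complex_algebra \<otimes> 'b::complex_algebra \<otimes> 'c::complex_algebra"
proof -
  note lin = tensor_flip23_linear
  have "clinear (\<lambda>s. tensor_flip23 (s * t))" "clinear (\<lambda>s. tensor_flip23 s * tensor_flip23 t)"
    "clinear (\<lambda>t. tensor_flip23 (s * t))" "clinear (\<lambda>t. tensor_flip23 s * tensor_flip23 t)"
    for s t :: "'a \<otimes> 'b \<otimes> 'c"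
    by (simp_all add: clinear_iff lin tensor_linear_simps)
  note * = clinear_tensor_eqI3[OF this(1,2)] clinear_tensor_eqI3[OF this(3,4)]
  show ?thesis
    by (rule *(1), rule *(2)) (simp add: tensor_mult tensor_flip23_tensor)
qed

lemmas lmult_assoc_iso = lmult_multiplier_iso[OF tensor_assoc_clinear bij_tensor_assoc tensor_assoc_mult]
lemmas lmult_flip_iso = lmult_multiplier_iso[OF tensor_flip_clinear bij_tensor_flip tensor_flip_mult]
lemmas lmult_flip23_iso =
  lmult_multiplier_iso[OF tensor_flip23_clinear bij_tensor_flip23 tensor_flip23_mult]

lemma lmult_one: "(\<rhd>) 1 = id"
  by (simp add: fun_eq_iff lmult_simps)

lemma lmult_leg12: "(\<rhd>) (leg12 m) = leg12_map ((\<rhd>) m)"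
  by (simp add: leg12_def leg12_map_def lmult_assoc_iso lmult_mult_tensor lmult_one)

lemma lmult_leg13: "(\<rhd>) (leg13 m) = leg13_map ((\<rhd>) m)"
  by (simp add: leg13_def leg13_map_def lmult_flip23_iso lmult_leg12 inv_tensor_flip23)

lemma lmult_leg23: "(\<rhd>) (leg23 m) = leg23_map ((\<rhd>) m)"
  by (simp add: leg23_def leg23_map_def lmult_mult_tensor lmult_one)

lemma multiplier_iso_hom:
  fixes f :: "'a::complex_algebra \<Rightarrow> 'b::nondegenerate_algebra"
  assumes "clinear f" "bij f" "\<And>x y. f (x * y) = f x * f y"
  shows "multiplier_iso f (m * n) = multiplier_iso f m * multiplier_iso f n"
    and "multiplier_iso f (mult_of x) = mult_of (f x)"
    and "multiplier_iso f (m + n) = multiplier_iso f m + multiplier_iso f n"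
    and "multiplier_iso f (c *\<^sub>C m) = c *\<^sub>C multiplier_iso f m"
proof -
  have inv_f: "inv f (f x) = x" "f (inv f y) = y" for x y
    using assms(2) by (simp_all add: bij_is_inj bij_is_surj surj_f_inv_f)
  show "multiplier_iso f (m * n) = multiplier_iso f m * multiplier_iso f n"
    "multiplier_iso f (mult_of x) = mult_of (f x)"
    "multiplier_iso f (m + n) = multiplier_iso f m + multiplier_iso f n"
    "multiplier_iso f (c *\<^sub>C m) = c *\<^sub>C multiplier_iso f m"
    by (rule multiplier_eqI; simp add: lmult_multiplier_iso[OF assms] lmult_simps inv_f assms(3)
        clinear_add[OF assms(1)] clinear_scaleC[OF assms(1)])+
qed

lemmas flip_iso_hom = multiplier_iso_hom[OF tensor_flip_clinear bij_tensor_flip tensor_flip_mult]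
lemmas assoc_iso_hom = multiplier_iso_hom[OF tensor_assoc_clinear bij_tensor_assoc tensor_assoc_mult]

lemma flip_iso_mult_tensor:
  fixes m :: "'a::nondegenerate_algebra multiplier" and n :: "'b::nondegenerate_algebra multiplier"
  shows "multiplier_iso tensor_flip (m \<otimes>\<^sub>M n) = n \<otimes>\<^sub>M m"
  by (rule multiplier_tensor_eqI)
    (simp add: lmult_flip_iso inv_tensor_flip tensor_flip_tensor lmult_mult_tensor_tensor)

lemma assoc_iso_mult_tensor:
  fixes m :: "'a::nondegenerate_algebra multiplier" and n :: "'b::nondegenerate_algebra multiplier"
    and k :: "'c::nondegenerate_algebra multiplier"
  shows "multiplier_iso tensor_assoc ((m \<otimes>\<^sub>M n) \<otimes>\<^sub>M k) = m \<otimes>\<^sub>M n \<otimes>\<^sub>M k"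
proof (rule multiplier_eqI, rule clinear_tensor_eqI3[OF lmult_clinear lmult_clinear])
qed (simp add: lmult_assoc_iso inv_tensor_assoc tensor_assoc_tensor lmult_mult_tensor_tensor)

section \<open>Cancellation and extension of multipliers\<close>

lemma mult_tensor_one_assoc:
  "m \<otimes>\<^sub>M 1 = multiplier_iso tensor_assoc
    ((m \<otimes>\<^sub>M (1 :: 'b::nondegenerate_algebra multiplier)) \<otimes>\<^sub>M (1 :: 'c::nondegenerate_algebra multiplier))"
  for m :: "'a::nondegenerate_algebra multiplier"
  by (simp add: assoc_iso_mult_tensor mult_tensor_one)

lemma lmult_cancel_leg1:
  fixes s :: "'a::nondegenerate_algebra \<otimes> 'b::nondegenerate_algebra"
  assumes "\<And>a. (mult_of a \<otimes>\<^sub>M 1) \<rhd> s = 0"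
  shows "s = 0"
proof (rule nondegenerate_right)
  fix y
  have *: "(a \<otimes> b) * s = 0" for a b
  proof -
    have "(a \<otimes> b) * s = (mult_of a \<otimes>\<^sub>M mult_of b) \<rhd> s"
      by (simp add: mult_tensor_mult_of lmult_simps)
    also have "\<dots> = ((1 \<otimes>\<^sub>M mult_of b) * (mult_of a \<otimes>\<^sub>M 1)) \<rhd> s"
      by (simp add: mult_tensor_mult)
    finally show ?thesis
      by (simp add: assms lmult_simps(1) clinear_zero[OF lmult_clinear])
  qed
  show "y * s = 0"
    by (induct y rule: tensor_induct) (simp_all add: * tensor_linear_simps)
qed

lemma multiplier_cancel_left_leg1:
  fixes m n :: "('a::nondegenerate_algebra \<otimes> 'b::nondegenerate_algebra) multiplier"
  assumes "\<And>a. (mult_of a \<otimes>\<^sub>M 1) * m = (mult_of a \<otimes>\<^sub>M 1) * n"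
  shows "m = n"
proof (rule multiplier_eqI)
  fix x
  have "(mult_of a \<otimes>\<^sub>M 1) \<rhd> (m \<rhd> x - n \<rhd> x) = 0" for a
    using arg_cong[OF assms[of a], of "\<lambda>k. k \<rhd> x"] by (simp add: lmult_simps lmult_linear)
  then show "m \<rhd> x = n \<rhd> x"
    using lmult_cancel_leg1[of "m \<rhd> x - n \<rhd> x"] by simp
qed

text \<open>
  The hypothesis gives equal actions on products only, and products need not span. But
  \<open>m (x y) = (m x) y\<close>, so non-degeneracy removes the second factor.
\<close>

lemma multiplier_cancel_right_leg2:
  fixes m n :: "('a::nondegenerate_algebra \<otimes> 'b::nondegenerate_algebra) multiplier"
  assumes "\<And>b. m * (1 \<otimes>\<^sub>M mult_of b) = n * (1 \<otimes>\<^sub>M mult_of b)"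
  shows "m = n"
proof (rule multiplier_eqI)
  fix x
  have "m \<rhd> ((a \<otimes> b) * (a' \<otimes> b')) = n \<rhd> ((a \<otimes> b) * (a' \<otimes> b'))" for a b a' b'
    using arg_cong[OF assms[of b], of "\<lambda>k. k \<rhd> ((a * a') \<otimes> b')"]
    by (simp add: lmult_mult_tensor_tensor lmult_simps tensor_mult)
  then have "m \<rhd> ((a \<otimes> b) * t) = n \<rhd> ((a \<otimes> b) * t)" for a b t
    by (induct t rule: tensor_induct) (simp_all add: tensor_linear_simps lmult_linear)
  then have "m \<rhd> (x * t) = n \<rhd> (x * t)" for t
    by (induct x rule: tensor_induct) (simp_all add: tensor_linear_simps lmult_linear)
  then have "(m \<rhd> x - n \<rhd> x) * y = 0" for y
    by (simp add: lmult_mult left_diff_distrib)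
  then have "m \<rhd> x - n \<rhd> x = 0" by (rule nondegenerate_left)
  then show "m \<rhd> x = n \<rhd> x" by simp
qed

lemma multiplier_cancel_right_leg2_of_3:
  fixes m n :: "('a::nondegenerate_algebra \<otimes> 'b::nondegenerate_algebra \<otimes> 'c::nondegenerate_algebra) multiplier"
  assumes "\<And>b. m * (1 \<otimes>\<^sub>M mult_of b \<otimes>\<^sub>M 1) = n * (1 \<otimes>\<^sub>M mult_of b \<otimes>\<^sub>M 1)"
  shows "m = n"
proof (rule multiplier_cancel_right_leg2)
  fix t :: "'b \<otimes> 'c"
  have "m * (1 \<otimes>\<^sub>M mult_of (b \<otimes> c)) = n * (1 \<otimes>\<^sub>M mult_of (b \<otimes> c))" for b c
  proof -
    have "(1 :: 'a multiplier) \<otimes>\<^sub>M mult_of (b \<otimes> c) = (1 \<otimes>\<^sub>M mult_of b \<otimes>\<^sub>M 1) * (1 \<otimes>\<^sub>M 1 \<otimes>\<^sub>M mult_of c)"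
      by (simp add: mult_tensor_mult mult_tensor_mult_of)
    then show ?thesis by (simp only: assms flip: mult.assoc)
  qed
  then show "m * (1 \<otimes>\<^sub>M mult_of t) = n * (1 \<otimes>\<^sub>M mult_of t)"
    by (induct t rule: tensor_induct) (simp_all add: multiplier_linear_simps)
qed

lemma multiplier_cancel_right_leg3:
  fixes m n :: "('a::nondegenerate_algebra \<otimes> 'b::nondegenerate_algebra \<otimes> 'c::nondegenerate_algebra) multiplier"
  assumes "\<And>c. m * (1 \<otimes>\<^sub>M 1 \<otimes>\<^sub>M mult_of c) = n * (1 \<otimes>\<^sub>M 1 \<otimes>\<^sub>M mult_of c)"
  shows "m = n"
proof (rule multiplier_cancel_right_leg2)
  fix t :: "'b \<otimes> 'c"
  have "m * (1 \<otimes>\<^sub>M mult_of (b \<otimes> c)) = n * (1 \<otimes>\<^sub>M mult_of (b \<otimes> c))" for b c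
  proof -
    have "(1 :: 'a multiplier) \<otimes>\<^sub>M mult_of (b \<otimes> c) = (1 \<otimes>\<^sub>M 1 \<otimes>\<^sub>M mult_of c) * (1 \<otimes>\<^sub>M mult_of b \<otimes>\<^sub>M 1)"
      by (simp add: mult_tensor_mult mult_tensor_mult_of)
    then show ?thesis by (simp only: assms flip: mult.assoc)
  qed
  then show "m * (1 \<otimes>\<^sub>M mult_of t) = n * (1 \<otimes>\<^sub>M mult_of t)"
    by (induct t rule: tensor_induct) (simp_all add: multiplier_linear_simps)
qed

text \<open>
  The condition on right multiplication is automatic: \<open>F(x) n F(y) = F(x (V y)) = F((x V) y)
  = F(x V) F(y)\<close>, and the range of \<open>F\<close> is dense.
\<close>

lemma multiplier_extension_eqI:
  fixes F :: "'a::complex_algebra \<Rightarrow> 'b::nondegenerate_algebra multiplier"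
  assumes hom: "\<And>x y. F (x * y) = F x * F y"
    and dense: "\<And>m n. (\<And>x. m * F x = n * F x) \<Longrightarrow> m = n"
    and left: "\<And>x. n * F x = F (V \<rhd> x)"
  shows "multiplier_extension F V = n"
  unfolding multiplier_extension_def
proof (rule the_equality)
  have "F x * n = F (x \<lhd> V)" for x
  proof (rule dense)
    show "F x * n * F y = F (x \<lhd> V) * F y" for y
      by (simp add: mult.assoc left mult_lmult flip: hom)
  qed
  with left show "\<forall>x. n * F x = F (V \<rhd> x) \<and> F x * n = F (x \<lhd> V)" by blast
  show "k = n" if "\<forall>x. k * F x = F (V \<rhd> x) \<and> F x * k = F (x \<lhd> V)" for k
    by (rule dense) (use that in \<open>simp add: left\<close>)
qed

lemma right_slice_lmult:
  assumes "clinear g"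
  shows "right_slice g ((n \<otimes>\<^sub>M 1) \<rhd> t) = n \<rhd> right_slice g t"
  by (induct t rule: tensor_induct)
    (simp_all add: lmult_linear lmult_simps lmult_mult_tensor_tensor right_slice_tensor[OF assms]
      right_slice_linear[OF assms])

lemma right_slice_rmult:
  assumes "clinear g"
  shows "right_slice g (t \<lhd> (n \<otimes>\<^sub>M 1)) = right_slice g t \<lhd> n"
  by (induct t rule: tensor_induct)
    (simp_all add: rmult_linear rmult_simps rmult_mult_tensor_tensor right_slice_tensor[OF assms]
      right_slice_linear[OF assms])

section \<open>The pentagon equation of a regular multiplier Hopf algebra\<close>

lemma galois1_tensor:
  fixes D :: "'a::nondegenerate_algebra \<Rightarrow> ('a \<otimes> 'a) multiplier"
  assumes D: "clinear D" and range: "\<And>a a'. D a * (1 \<otimes>\<^sub>M mult_of a') \<in> range mult_of"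
  shows galois1_clinear: "clinear (galois1 D)"
    and mult_of_galois1: "mult_of (galois1 D (a \<otimes> a')) = D a * (1 \<otimes>\<^sub>M mult_of a')"
proof -
  have "mult_of (of_mult (D a * (1 \<otimes>\<^sub>M mult_of a'))) = D a * (1 \<otimes>\<^sub>M mult_of a')" for a a'
    by (rule mult_of_of_mult[OF range])
  note 1 = this
  have 2: "cbilinear (\<lambda>a a'. of_mult (D a * (1 \<otimes>\<^sub>M mult_of a')))"
    unfolding cbilinear_def clinear_iff
    by (intro conjI allI; rule of_mult_eqI)
      (simp_all add: multiplier_linear_simps 1 clinear_add[OF D] clinear_scaleC[OF D])
  show "clinear (galois1 D)"
    "mult_of (galois1 D (a \<otimes> a')) = D a * (1 \<otimes>\<^sub>M mult_of a')"
    by (simp_all add: galois1_def tensor_lift_clinear[OF 2] tensor_lift_tensor[OF 2] 1)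
qed

lemma id_comult_tensor:
  fixes D :: "'a::nondegenerate_algebra \<Rightarrow> ('a \<otimes> 'a) multiplier"
    and b :: "'b::nondegenerate_algebra"
  assumes D: "clinear D"
  shows id_comult_clinear: "clinear (id_comult D :: 'b \<otimes> 'a \<Rightarrow> _)"
    and id_comult_apply: "id_comult D (b \<otimes> a) = mult_of b \<otimes>\<^sub>M D a"
proof -
  have "cbilinear (\<lambda>(b :: 'b) a. mult_of b \<otimes>\<^sub>M D a)"
    by (simp add: cbilinear_def clinear_iff multiplier_linear_simps clinear_add[OF D] clinear_scaleC[OF D])
  then show "clinear (id_comult D :: 'b \<otimes> 'a \<Rightarrow> _)" "id_comult D (b \<otimes> a) = mult_of b \<otimes>\<^sub>M D a"
    by (simp_all add: id_comult_def tensor_lift_clinear tensor_lift_tensor)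
qed

lemma comult_id_tensor:
  fixes D :: "'a::nondegenerate_algebra \<Rightarrow> ('a \<otimes> 'a) multiplier"
    and b :: "'b::nondegenerate_algebra"
  assumes D: "clinear D"
  shows comult_id_clinear: "clinear (comult_id D :: 'a \<otimes> 'b \<Rightarrow> _)"
    and comult_id_apply:
      "comult_id D (a \<otimes> b) = multiplier_iso tensor_assoc (D a \<otimes>\<^sub>M mult_of b)"
proof -
  have "cbilinear (\<lambda>a (b :: 'b). multiplier_iso tensor_assoc (D a \<otimes>\<^sub>M mult_of b))"
    by (simp add: cbilinear_def clinear_iff multiplier_linear_simps assoc_iso_hom
        clinear_add[OF D] clinear_scaleC[OF D])
  then show "clinear (comult_id D :: 'a \<otimes> 'b \<Rightarrow> _)"
    "comult_id D (a \<otimes> b) = multiplier_iso tensor_assoc (D a \<otimes>\<^sub>M mult_of b)"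
    by (simp_all add: comult_id_def tensor_lift_clinear tensor_lift_tensor)
qed

lemmas id_comult_linear = clinear_add[OF id_comult_clinear] clinear_scaleC[OF id_comult_clinear]
lemmas comult_id_linear = clinear_add[OF comult_id_clinear] clinear_scaleC[OF comult_id_clinear]

lemma id_comult_mult:
  fixes D :: "'a::nondegenerate_algebra \<Rightarrow> ('a \<otimes> 'a) multiplier"
    and s t :: "'b::nondegenerate_algebra \<otimes> 'a"
  assumes D: "clinear D" and mult: "\<And>a a'. D (a * a') = D a * D a'"
  shows "id_comult D (s * t) = id_comult D s * id_comult D t"
proof (induct s rule: tensor_induct)
  case (tensor b a)
  show ?case
    by (induct t rule: tensor_induct)
      (simp_all add: id_comult_apply[OF D] tensor_mult mult mult_of_mult mult_tensor_mult
        tensor_linear_simps id_comult_linear[OF D])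
qed (simp_all add: tensor_linear_simps id_comult_linear[OF D])

lemma comult_id_mult:
  fixes D :: "'a::nondegenerate_algebra \<Rightarrow> ('a \<otimes> 'a) multiplier"
    and s t :: "'a \<otimes> 'b::nondegenerate_algebra"
  assumes D: "clinear D" and mult: "\<And>a a'. D (a * a') = D a * D a'"
  shows "comult_id D (s * t) = comult_id D s * comult_id D t"
proof (induct s rule: tensor_induct)
  case (tensor a b)
  show ?case
    by (induct t rule: tensor_induct)
      (simp_all add: comult_id_apply[OF D] tensor_mult mult mult_of_mult assoc_iso_hom
        tensor_linear_simps comult_id_linear[OF D] flip: mult_tensor_mult)
qed (simp_all add: tensor_linear_simps comult_id_linear[OF D])

lemma id_comult_rmult:
  fixes D :: "'a::nondegenerate_algebra \<Rightarrow> ('a \<otimes> 'a) multiplier"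
    and t :: "'b::nondegenerate_algebra \<otimes> 'a"
  assumes D: "clinear D"
  shows "id_comult D (t \<lhd> (n \<otimes>\<^sub>M 1)) = id_comult D t * (n \<otimes>\<^sub>M 1)"
  by (induct t rule: tensor_induct)
    (simp_all add: id_comult_apply[OF D] rmult_mult_tensor_tensor rmult_simps rmult_linear
      mult_tensor_mult tensor_linear_simps id_comult_linear[OF D] flip: mult_of_mult_right)

lemma comult_id_rmult_right:
  fixes D :: "'a::nondegenerate_algebra \<Rightarrow> ('a \<otimes> 'a) multiplier"
    and t :: "'a \<otimes> 'b::nondegenerate_algebra"
  assumes D: "clinear D"
  shows "comult_id D (t \<lhd> (1 \<otimes>\<^sub>M n)) = comult_id D t * (1 \<otimes>\<^sub>M 1 \<otimes>\<^sub>M n)"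
proof (induct t rule: tensor_induct)
  case (tensor a b)
  show ?case
    by (simp add: comult_id_apply[OF D] rmult_mult_tensor_tensor rmult_simps mult_tensor_mult
      flip: mult_of_mult_right assoc_iso_mult_tensor assoc_iso_hom) (simp add: mult_tensor_one)
qed (simp_all add: rmult_linear tensor_linear_simps comult_id_linear[OF D])

locale multiplier_hopf =
  fixes \<Delta> :: "'a::nondegenerate_algebra \<Rightarrow> ('a \<otimes> 'a) multiplier"
  assumes rmh: "regular_multiplier_hopf \<Delta>"
begin

lemma comult_clinear: "clinear \<Delta>"
  and comult_mult: "\<Delta> (a * a') = \<Delta> a * \<Delta> a'"
  and comult_range:
    "\<Delta> a * (1 \<otimes>\<^sub>M mult_of a') \<in> range mult_of" "(mult_of a \<otimes>\<^sub>M 1) * \<Delta> a' \<in> range mult_of"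
    "\<Delta> a * (mult_of a' \<otimes>\<^sub>M 1) \<in> range mult_of"
  and coassoc: "(mult_of a \<otimes>\<^sub>M 1) * comult_id \<Delta> (of_mult (\<Delta> c * (1 \<otimes>\<^sub>M mult_of a'))) =
      id_comult \<Delta> (of_mult ((mult_of a \<otimes>\<^sub>M 1) * \<Delta> c)) * (1 \<otimes>\<^sub>M 1 \<otimes>\<^sub>M mult_of a')"
  using rmh unfolding regular_multiplier_hopf_def mult_tensor_one by auto

lemmas comult_linear = clinear_add[OF comult_clinear] clinear_scaleC[OF comult_clinear]

definition T1 :: "'a \<otimes> 'a \<Rightarrow> 'a \<otimes> 'a" where "T1 = galois1 \<Delta>"

text \<open>
  In Sweedler notation \<open>T1 (h \<otimes> x)\<close> is \<open>h\<^sub>1 \<otimes> h\<^sub>2 x\<close> and \<open>W (h \<otimes> x)\<close> is \<open>h\<^sub>2 \<otimes> h\<^sub>1 x\<close>.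
\<close>

definition W :: "'a \<otimes> 'a \<Rightarrow> 'a \<otimes> 'a" where "W = galois1 (comult_flip \<Delta>)"

lemma bij_T1: "bij T1" and bij_W: "bij W"
  using rmh unfolding regular_multiplier_hopf_def T1_def W_def by auto

lemma T1_clinear: "clinear T1"
  and mult_of_T1: "mult_of (T1 (h \<otimes> x)) = \<Delta> h * (1 \<otimes>\<^sub>M mult_of x)"
  unfolding T1_def by (rule galois1_tensor[OF comult_clinear comult_range(1)])+

lemma W_clinear: "clinear W"
  and mult_of_flip_W: "mult_of (tensor_flip (W (h \<otimes> x))) = \<Delta> h * (mult_of x \<otimes>\<^sub>M 1)"
proof -
  have lin: "clinear (comult_flip \<Delta>)"
    by (simp add: clinear_iff comult_flip_def comult_linear flip_iso_hom)
  have eq: "comult_flip \<Delta> a * (1 \<otimes>\<^sub>M mult_of x) =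
      multiplier_iso tensor_flip (\<Delta> a * (mult_of x \<otimes>\<^sub>M 1))" for a x
    by (simp add: comult_flip_def flip_iso_hom flip_iso_mult_tensor)
  have range: "comult_flip \<Delta> a * (1 \<otimes>\<^sub>M mult_of x) \<in> range mult_of" for a x
  proof -
    obtain z where "\<Delta> a * (mult_of x \<otimes>\<^sub>M 1) = mult_of z"
      using comult_range(3) by blast
    then show ?thesis by (simp only: eq flip_iso_hom(2) rangeI)
  qed
  show "clinear W"
    unfolding W_def by (rule galois1_clinear[OF lin range])
  have "mult_of (W (h \<otimes> x)) = multiplier_iso tensor_flip (\<Delta> h * (mult_of x \<otimes>\<^sub>M 1))"
    unfolding W_def eq[symmetric] by (rule mult_of_galois1[OF lin range])
  also obtain z where z: "\<Delta> h * (mult_of x \<otimes>\<^sub>M 1) = mult_of z"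
    using comult_range(3) by blast
  finally show "mult_of (tensor_flip (W (h \<otimes> x))) = \<Delta> h * (mult_of x \<otimes>\<^sub>M 1)"
    by (simp add: z flip_iso_hom mult_of_inject tensor_flip_flip)
qed

lemmas T1_linear = clinear_add[OF T1_clinear] clinear_scaleC[OF T1_clinear]
lemmas W_linear = clinear_add[OF W_clinear] clinear_scaleC[OF W_clinear]

lemma W_inv: "W (inv W t) = t" "inv W (W t) = t"
  using bij_W by (simp_all add: bij_is_inj bij_is_surj surj_f_inv_f)

lemma inv_W_clinear: "clinear (inv W)"
  by (rule clinear_inv[OF W_clinear bij_W])

lemma T1_surj: "\<exists>u. t = T1 u"
  using bij_T1 by (metis bij_pointE)

lemma flip_W_rmult: "tensor_flip (W (h \<otimes> x)) \<lhd> (1 \<otimes>\<^sub>M mult_of c) = T1 (h \<otimes> c) \<lhd> (mult_of x \<otimes>\<^sub>M 1)"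
  unfolding mult_of_inject[symmetric] mult_of_mult_right[symmetric] mult_of_T1 mult_of_flip_W
  by (simp add: mult.assoc mult_tensor_mult)

lemma comult_lmult_tensor: "\<Delta> h \<rhd> (x \<otimes> c) = T1 (h \<otimes> c) \<lhd> (mult_of x \<otimes>\<^sub>M 1)"
  unfolding mult_of_inject[symmetric] mult_of_mult_right[symmetric] mult_of_T1 mult_mult_of[symmetric]
  by (simp add: mult.assoc mult_tensor_mult flip: mult_tensor_mult_of)

lemma comult_lmult_flip_W: "\<Delta> a \<rhd> tensor_flip (W (h \<otimes> x)) = tensor_flip (W ((a * h) \<otimes> x))"
  unfolding mult_of_inject[symmetric] mult_mult_of[symmetric] mult_of_flip_W
  by (simp add: mult.assoc comult_mult)

text \<open>
  The coassociativity axiom with the covering element of the first leg moved from the left to the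
  right: multiply the axiom by \<open>v\<close> on the right and cancel \<open>a\<close>.
\<close>

lemma coassoc_right:
  "comult_id \<Delta> (T1 (w \<otimes> c)) * (mult_of v \<otimes>\<^sub>M 1) =
    id_comult \<Delta> (tensor_flip (W (w \<otimes> v))) * (1 \<otimes>\<^sub>M 1 \<otimes>\<^sub>M mult_of c)"
proof (rule multiplier_cancel_left_leg1)
  fix a
  define s where "s = of_mult ((mult_of a \<otimes>\<^sub>M 1) * \<Delta> w)"
  have s: "mult_of s = (mult_of a \<otimes>\<^sub>M 1) * \<Delta> w"
    unfolding s_def by (rule mult_of_of_mult[OF comult_range(2)])
  have T1: "T1 (w \<otimes> c) = of_mult (\<Delta> w * (1 \<otimes>\<^sub>M mult_of c))"
    by (rule of_mult_eqI[symmetric, OF mult_of_T1])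
  have sv: "s \<lhd> (mult_of v \<otimes>\<^sub>M 1) = (mult_of a \<otimes>\<^sub>M 1) \<rhd> tensor_flip (W (w \<otimes> v))"
    unfolding mult_of_inject[symmetric] mult_of_mult_right[symmetric] mult_mult_of[symmetric]
      mult_of_flip_W s
    by (simp add: mult.assoc)
  have left: "id_comult \<Delta> ((mult_of a \<otimes>\<^sub>M 1) \<rhd> t) = (mult_of a \<otimes>\<^sub>M 1) * id_comult \<Delta> t" for t
    by (induct t rule: tensor_induct)
      (simp_all add: id_comult_apply[OF comult_clinear] lmult_mult_tensor_tensor lmult_simps
        lmult_linear mult_of_mult mult_tensor_mult tensor_linear_simps
        id_comult_linear[OF comult_clinear])
  have "(mult_of a \<otimes>\<^sub>M 1) * (comult_id \<Delta> (T1 (w \<otimes> c)) * (mult_of v \<otimes>\<^sub>M 1)) =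
      id_comult \<Delta> s * ((1 \<otimes>\<^sub>M 1 \<otimes>\<^sub>M mult_of c) * (mult_of v \<otimes>\<^sub>M 1))"
    unfolding T1 s_def by (simp only: coassoc flip: mult.assoc)
  also have "\<dots> = id_comult \<Delta> s * (mult_of v \<otimes>\<^sub>M 1) * (1 \<otimes>\<^sub>M 1 \<otimes>\<^sub>M mult_of c)"
    by (simp add: mult_tensor_mult mult.assoc)
  also have "id_comult \<Delta> s * (mult_of v \<otimes>\<^sub>M 1) =
      (mult_of a \<otimes>\<^sub>M 1) * id_comult \<Delta> (tensor_flip (W (w \<otimes> v)))"
    by (simp only: sv left flip: id_comult_rmult[OF comult_clinear])
  finally show "(mult_of a \<otimes>\<^sub>M 1) * (comult_id \<Delta> (T1 (w \<otimes> c)) * (mult_of v \<otimes>\<^sub>M 1)) =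
      (mult_of a \<otimes>\<^sub>M 1) *
        (id_comult \<Delta> (tensor_flip (W (w \<otimes> v))) * (1 \<otimes>\<^sub>M 1 \<otimes>\<^sub>M mult_of c))"
    by (simp only: mult.assoc)
qed

text \<open>
  The next three lemmas express \<open>\<Delta> \<otimes> \<iota>\<close> and \<open>\<iota> \<otimes> \<Delta>\<close>, covered in one leg, by operators on \<open>A \<otimes> A \<otimes> A\<close>.
\<close>

lemma comult_id_mult_leg1:
  fixes t :: "'a \<otimes> 'a"
  shows "comult_id \<Delta> t * (mult_of y \<otimes>\<^sub>M 1) =
    mult_of (rev3 (leg23_map W (tensor_assoc (tensor_flip t \<otimes> y))))"
proof (induct t rule: tensor_induct)
  case (tensor p r)
  have "comult_id \<Delta> (p \<otimes> r) * (mult_of y \<otimes>\<^sub>M 1) =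
      multiplier_iso tensor_assoc ((\<Delta> p * (mult_of y \<otimes>\<^sub>M 1)) \<otimes>\<^sub>M mult_of r)"
    unfolding mult_tensor_one_assoc[of "mult_of y"]
    by (simp add: comult_id_apply[OF comult_clinear] mult_tensor_mult flip: assoc_iso_hom(1))
  then show ?case
    by (simp add: mult_tensor_mult_of assoc_iso_hom tensor_flip_tensor tensor_assoc_tensor
        leg23_map_tensor[OF W_clinear] rev3_tensor flip: mult_of_flip_W)
qed (simp_all add: comult_id_linear[OF comult_clinear] multiplier_linear_simps
    tensor_linear_simps tensor_flip_linear tensor_assoc_linear rev3_linear
    leg23_map_linear[OF W_clinear])

lemma id_comult_mult_leg2:
  fixes t :: "'a \<otimes> 'a"
  shows "id_comult \<Delta> (tensor_flip t) * (1 \<otimes>\<^sub>M mult_of y \<otimes>\<^sub>M 1) =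
    mult_of (rev3 (leg12_map W (tensor_flip23 (tensor_assoc (t \<otimes> y)))))"
proof (induct t rule: tensor_induct)
  case (tensor v u)
  show ?case
    by (simp add: id_comult_apply[OF comult_clinear] mult_tensor_mult tensor_flip_tensor
        mult_tensor_mult_of tensor_assoc_tensor tensor_flip23_tensor leg12_map_tensor[OF W_clinear]
        rev3_assoc flip: mult_of_flip_W)
qed (simp_all add: id_comult_linear[OF comult_clinear] multiplier_linear_simps
    tensor_linear_simps tensor_flip_linear tensor_assoc_linear rev3_linear
    tensor_flip23_linear
    leg12_map_linear[OF W_clinear])

lemma id_comult_mult_leg3:
  fixes t :: "'a \<otimes> 'a"
  shows "id_comult \<Delta> (tensor_flip t) * (1 \<otimes>\<^sub>M 1 \<otimes>\<^sub>M mult_of c) =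
    mult_of (tensor_map (\<lambda>u. u) (\<lambda>x. T1 (x \<otimes> c)) (tensor_flip t))"
proof -
  have lin: "clinear (\<lambda>x. T1 (x \<otimes> c))" by (simp add: clinear_iff T1_linear tensor_linear_simps)
  show ?thesis
  proof (induct t rule: tensor_induct)
    case (tensor v u)
    show ?case
      by (simp add: id_comult_apply[OF comult_clinear] mult_tensor_mult tensor_flip_tensor
          mult_tensor_mult_of tensor_map_tensor[OF clinear_id(2) lin] flip: mult_of_T1)
  qed (simp_all add: id_comult_linear[OF comult_clinear] multiplier_linear_simps
      tensor_linear_simps tensor_flip_linear tensor_map_linear[OF clinear_id(2) lin])
qed

lemma comult_id_rmult_left:
  fixes t :: "'a \<otimes> 'a"
  shows "comult_id \<Delta> (t \<lhd> (mult_of g \<otimes>\<^sub>M 1)) =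
    comult_id \<Delta> t * multiplier_iso tensor_assoc (\<Delta> g \<otimes>\<^sub>M (1 :: 'a multiplier))"
  by (induct t rule: tensor_induct)
    (simp_all add: comult_id_apply[OF comult_clinear] rmult_mult_tensor_tensor rmult_simps
      rmult_linear comult_mult mult_tensor_mult tensor_linear_simps
      comult_id_linear[OF comult_clinear] flip: assoc_iso_hom(1))

lemma comult_id_T1_mult:
  "comult_id \<Delta> (T1 (h \<otimes> c)) * multiplier_iso tensor_assoc (mult_of (tensor_flip z) \<otimes>\<^sub>M 1) =
    mult_of (rev3 (leg12_map W (leg13_map W (h \<otimes> z)))) * (1 \<otimes>\<^sub>M 1 \<otimes>\<^sub>M mult_of c)"
proof (induct z rule: tensor_induct)
  case (tensor y x)
  have "multiplier_iso tensor_assoc (mult_of (x \<otimes> y) \<otimes>\<^sub>M 1) =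
      (mult_of x \<otimes>\<^sub>M 1) * (1 \<otimes>\<^sub>M mult_of y \<otimes>\<^sub>M (1 :: 'a multiplier))"
    by (simp add: assoc_iso_mult_tensor mult_tensor_mult flip: mult_tensor_mult_of)
  then have "comult_id \<Delta> (T1 (h \<otimes> c)) * multiplier_iso tensor_assoc (mult_of (x \<otimes> y) \<otimes>\<^sub>M 1) =
      id_comult \<Delta> (tensor_flip (W (h \<otimes> x))) *
        ((1 \<otimes>\<^sub>M 1 \<otimes>\<^sub>M mult_of c) * (1 \<otimes>\<^sub>M mult_of y \<otimes>\<^sub>M 1))"
    by (simp only: coassoc_right flip: mult.assoc)
  also have "\<dots> = id_comult \<Delta> (tensor_flip (W (h \<otimes> x))) * (1 \<otimes>\<^sub>M mult_of y \<otimes>\<^sub>M 1) *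
      (1 \<otimes>\<^sub>M 1 \<otimes>\<^sub>M mult_of c)"
    by (simp add: mult_tensor_mult mult.assoc)
  finally show ?case
    by (simp add: tensor_flip_tensor id_comult_mult_leg2 leg13_map_tensor[OF W_clinear])
qed (simp_all add: multiplier_linear_simps tensor_linear_simps tensor_flip_linear rev3_linear
    assoc_iso_hom leg12_map_linear[OF W_clinear] leg13_map_linear[OF W_clinear])

text \<open>
  Applied to \<open>h \<otimes> g \<otimes> y\<close>, both sides are \<open>h\<^sub>3 \<otimes> h\<^sub>2 g\<^sub>2 \<otimes> h\<^sub>1 g\<^sub>1 y\<close>. To make sense of the three-fold coproduct
  the third leg is covered by an auxiliary \<open>c\<close>, which is cancelled in the end.
\<close>

lemma pentagon: "leg12_map W (leg13_map W (leg23_map W t)) = leg23_map W (leg12_map W t)"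
proof -
  have "rev3 (leg12_map W (leg13_map W (h \<otimes> W (g \<otimes> y)))) =
      rev3 (leg23_map W (leg12_map W (h \<otimes> g \<otimes> y)))" for h g y
  proof -
    have "mult_of (rev3 (leg12_map W (leg13_map W (h \<otimes> W (g \<otimes> y))))) * (1 \<otimes>\<^sub>M 1 \<otimes>\<^sub>M mult_of c) =
        mult_of (rev3 (leg23_map W (leg12_map W (h \<otimes> g \<otimes> y)))) * (1 \<otimes>\<^sub>M 1 \<otimes>\<^sub>M mult_of c)" for c
    proof -
      have "mult_of (rev3 (leg23_map W (leg12_map W (h \<otimes> g \<otimes> y)))) * (1 \<otimes>\<^sub>M 1 \<otimes>\<^sub>M mult_of c) =
          comult_id \<Delta> (tensor_flip (W (h \<otimes> g))) * ((mult_of y \<otimes>\<^sub>M 1) * (1 \<otimes>\<^sub>M 1 \<otimes>\<^sub>M mult_of c))"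
        by (simp add: comult_id_mult_leg1 tensor_flip_flip leg12_map_tensor[OF W_clinear]
            flip: mult.assoc)
      also have "\<dots> = comult_id \<Delta> (tensor_flip (W (h \<otimes> g)) \<lhd> (1 \<otimes>\<^sub>M mult_of c)) * (mult_of y \<otimes>\<^sub>M 1)"
        by (simp add: comult_id_rmult_right[OF comult_clinear] mult_tensor_mult mult.assoc)
      \<comment> \<open>Here \<open>\<Delta>(h)(g \<otimes> c)\<close> is regrouped as \<open>(\<Delta>(h)(1 \<otimes> c))(g \<otimes> 1)\<close>, so that \<open>\<Delta> \<otimes> \<iota>\<close> splits off \<open>\<Delta>(g)\<close>.\<close>
      also have "\<dots> = comult_id \<Delta> (T1 (h \<otimes> c)) * multiplier_iso tensor_assoc (\<Delta> g \<otimes>\<^sub>M 1) *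
          (mult_of y \<otimes>\<^sub>M 1)"
        by (simp add: flip_W_rmult comult_id_rmult_left)
      also have "\<dots> = comult_id \<Delta> (T1 (h \<otimes> c)) *
          multiplier_iso tensor_assoc (mult_of (tensor_flip (W (g \<otimes> y))) \<otimes>\<^sub>M 1)"
        unfolding mult_tensor_one_assoc[of "mult_of y"]
        by (simp add: mult_of_flip_W mult.assoc mult_tensor_mult flip: assoc_iso_hom(1))
      finally show ?thesis using comult_id_T1_mult[of h c "W (g \<otimes> y)"] by simp
    qed
    then show ?thesis
      using multiplier_cancel_right_leg3 mult_of_inject by blast
  qed
  then have "leg12_map W (leg13_map W (h \<otimes> W (g \<otimes> y))) = leg23_map W (leg12_map W (h \<otimes> g \<otimes> y))"
    for h g y by (metis rev3_rev3)
  then show ?thesis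
    using clinear_tensor_eqI3[OF clinear_comp[OF leg12_map_clinear[OF W_clinear]
          clinear_comp[OF leg13_map_clinear[OF W_clinear] leg23_map_clinear[OF W_clinear]]]
        clinear_comp[OF leg23_map_clinear[OF W_clinear] leg12_map_clinear[OF W_clinear]], of t]
    by (simp add: leg23_map_tensor[OF W_clinear])
qed

lemma leg_inv_W:
  "leg12_map (inv W) (leg12_map W t) = t" "leg23_map (inv W) (leg23_map W t) = t"
  "leg13_map (inv W) (leg13_map W t) = t"
  "leg12_map W (leg12_map (inv W) t) = t" "leg23_map W (leg23_map (inv W) t) = t"
  "leg13_map W (leg13_map (inv W) t) = t"
proof -
  have "W \<circ> inv W = id" "inv W \<circ> W = id" by (simp_all add: fun_eq_iff W_inv)
  then show "leg12_map (inv W) (leg12_map W t) = t" "leg23_map (inv W) (leg23_map W t) = t"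
    "leg13_map (inv W) (leg13_map W t) = t"
    "leg12_map W (leg12_map (inv W) t) = t" "leg23_map W (leg23_map (inv W) t) = t"
    "leg13_map W (leg13_map (inv W) t) = t"
    by (simp_all add: leg12_map_comp leg23_map_comp leg13_map_comp W_clinear inv_W_clinear
        leg12_map_id leg23_map_id leg13_map_id)
qed

lemma pentagon_inv:
  "leg23_map (inv W) (leg13_map (inv W) (leg12_map (inv W) t)) =
    leg12_map (inv W) (leg23_map (inv W) t)"
  using pentagon[of "leg12_map (inv W) (leg23_map (inv W) t)"] by (metis leg_inv_W)

lemma pentagon_mixed:
  "leg13_map (inv W) (leg12_map (inv W) (leg23_map W t)) = leg23_map W (leg12_map (inv W) t)"
  using pentagon[of "leg12_map (inv W) t"] by (metis leg_inv_W)

text \<open>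
  The map \<open>w \<mapsto> w\<^sub>1 g(w\<^sub>2 c)\<close> uses the right leg of the coproduct, whereas \<open>W\<close> multiplies into the left leg;
  by coassociativity they commute. This is \<open>coassoc_right\<close> with \<open>g\<close> applied to the third leg.
\<close>

lemma slice_equivariant:
  assumes g: "clinear g"
  shows "W (tensor_map (\<lambda>w. right_slice g (T1 (w \<otimes> c))) (\<lambda>x. x) u) =
    tensor_map (\<lambda>w. right_slice g (T1 (w \<otimes> c))) (\<lambda>x. x) (W u)"
proof -
  let ?h = "\<lambda>w. right_slice g (T1 (w \<otimes> c))" and ?S = "tensor_map (\<lambda>x. x) (right_slice g)"
  note g_lin = right_slice_linear[OF g]
  have h: "clinear ?h" by (simp add: clinear_iff tensor_linear_simps T1_linear g_lin)
  have T1c: "clinear (\<lambda>x. T1 (x \<otimes> c))" by (simp add: clinear_iff tensor_linear_simps T1_linear)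
  note S_lin = tensor_map_linear[OF clinear_id(2) right_slice_clinear[OF g]]
  have S_assoc: "?S (tensor_assoc (z \<otimes> r)) = g r *\<^sub>C z" for z :: "'a \<otimes> 'a" and r
    by (induct z rule: tensor_induct)
      (simp_all add: tensor_linear_simps tensor_assoc_linear S_lin tensor_assoc_tensor mult.commute
        tensor_map_tensor[OF clinear_id(2) right_slice_clinear[OF g]] right_slice_tensor[OF g])
  have left: "?S (rev3 (leg23_map W (tensor_assoc (tensor_flip t \<otimes> v)))) =
      tensor_flip (W (right_slice g t \<otimes> v))" for t v
    by (induct t rule: tensor_induct)
      (simp_all add: tensor_linear_simps tensor_assoc_linear S_lin tensor_flip_linear rev3_linear
        leg23_map_linear[OF W_clinear]
        g_lin W_linear tensor_flip_tensor tensor_assoc_tensor leg23_map_tensor[OF W_clinear]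
        rev3_tensor S_assoc right_slice_tensor[OF g])
  have right: "?S (tensor_map (\<lambda>u. u) (\<lambda>x. T1 (x \<otimes> c)) (tensor_flip z)) =
      tensor_flip (tensor_map ?h (\<lambda>x. x) z)" for z
    by (induct z rule: tensor_induct)
      (simp_all add: tensor_flip_linear S_lin tensor_map_linear[OF clinear_id(2) T1c]
        tensor_map_linear[OF h clinear_id(2)]
        tensor_flip_tensor tensor_map_tensor[OF clinear_id(2) T1c] tensor_map_tensor[OF h clinear_id(2)]
        tensor_map_tensor[OF clinear_id(2) right_slice_clinear[OF g]])
  have "W (?h w \<otimes> v) = tensor_map ?h (\<lambda>x. x) (W (w \<otimes> v))" for w v
  proof -
    have "rev3 (leg23_map W (tensor_assoc (tensor_flip (T1 (w \<otimes> c)) \<otimes> v))) =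
        tensor_map (\<lambda>u. u) (\<lambda>x. T1 (x \<otimes> c)) (tensor_flip (W (w \<otimes> v)))"
      using coassoc_right[of w c v]
      by (simp only: comult_id_mult_leg1 id_comult_mult_leg3 mult_of_inject)
    from arg_cong[OF this, of ?S] show ?thesis
      unfolding left right by (metis tensor_flip_flip)
  qed
  then show ?thesis
    by (induct u rule: tensor_induct)
      (simp_all add: W_linear tensor_map_tensor[OF h clinear_id(2)]
        tensor_map_linear[OF h clinear_id(2)])
qed

lemma flip_W_surj: "\<exists>z. t = tensor_flip (W z)"
  by (metis tensor_flip_flip W_inv(1))

text \<open>
  The products \<open>(b \<otimes> \<Delta>(a))(1 \<otimes> y \<otimes> 1)\<close> span \<open>B \<otimes> A \<otimes> A\<close> because \<open>W\<close> is surjective.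
\<close>

lemma id_comult_dense:
  fixes m n :: "('b::nondegenerate_algebra \<otimes> 'a \<otimes> 'a) multiplier"
  assumes eq: "\<And>x. m * id_comult \<Delta> x = n * id_comult \<Delta> x"
  shows "m = n"
proof (rule multiplier_tensor_eqI)
  fix b :: 'b and t
  have *: "m * mult_of (b \<otimes> tensor_flip (W z)) = n * mult_of (b \<otimes> tensor_flip (W z))" for z
  proof (induct z rule: tensor_induct)
    case (tensor a y)
    have "mult_of (b \<otimes> tensor_flip (W (a \<otimes> y))) = id_comult \<Delta> (b \<otimes> a) * (1 \<otimes>\<^sub>M mult_of y \<otimes>\<^sub>M 1)"
      by (simp add: id_comult_apply[OF comult_clinear] mult_tensor_mult mult_of_flip_W
          flip: mult_tensor_mult_of)
    then show ?case by (simp only: eq flip: mult.assoc)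
  qed (simp_all add: W_linear tensor_flip_linear tensor_linear_simps multiplier_linear_simps)
  obtain z where "t = tensor_flip (W z)" using flip_W_surj by blast
  with * show "m \<rhd> (b \<otimes> t) = n \<rhd> (b \<otimes> t)"
    by (simp add: mult_mult_of mult_of_inject)
qed

end

section \<open>Left integrals are faithful\<close>

locale multiplier_hopf_integral = multiplier_hopf +
  fixes \<phi> :: "'a \<Rightarrow> complex"
  assumes integral: "left_integral \<Delta> \<phi>"
begin

lemma phi_clinear: "clinear \<phi>"
  and phi_normalized: "\<exists>y. \<phi> y = 1"
proof -
  show phi: "clinear \<phi>" using integral by (simp add: left_integral_def)
  obtain a where "\<phi> a \<noteq> 0" using integral by (auto simp: left_integral_def)
  then have "\<phi> (inverse (\<phi> a) *\<^sub>C a) = 1"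
    by (simp add: clinear_scaleC[OF phi] scaleC_complex_def)
  then show "\<exists>y. \<phi> y = 1" by blast
qed

lemmas phi_linear = clinear_add[OF phi_clinear] clinear_scaleC[OF phi_clinear]

lemma phi_mult_clinear: "clinear (\<lambda>x. \<phi> (x * c))" "clinear (\<lambda>x. \<phi> (c * x))"
  by (simp_all add: clinear_iff tensor_linear_simps phi_linear)

lemma left_invariance: "right_slice \<phi> (tensor_flip (W (a \<otimes> r))) = \<phi> a *\<^sub>C r"
proof -
  define U where "U r = of_mult ((mult_of r \<otimes>\<^sub>M 1) * \<Delta> a)" for r
  have U: "mult_of (U r) = (mult_of r \<otimes>\<^sub>M 1) * \<Delta> a" for r
    unfolding U_def by (rule mult_of_of_mult[OF comult_range(2)])
  have U_lin: "U (x + y) = U x + U y" "U (c *\<^sub>C x) = c *\<^sub>C U x" for x y c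
    unfolding mult_of_inject[symmetric] by (simp_all add: U multiplier_linear_simps)
  let ?L = "\<lambda>r. right_slice \<phi> (tensor_flip (W (a \<otimes> r)))" and ?R = "\<lambda>r. right_slice \<phi> (U r)"
  \<comment> \<open>The left-hand side is the action of \<open>(\<iota> \<otimes> \<phi>)\<Delta>(a)\<close>, once the defining pair of maps is seen to be a multiplier.\<close>
  have "is_multiplier ?L ?R"
    unfolding is_multiplier_def
  proof (intro conjI allI)
    show "clinear ?L" "clinear ?R"
      by (simp_all add: clinear_iff tensor_linear_simps W_linear tensor_flip_linear right_slice_linear[OF phi_clinear] U_lin)
    show "?L (x * y) = ?L x * y" for x y
    proof -
      have "tensor_flip (W (a \<otimes> (x * y))) = tensor_flip (W (a \<otimes> x)) \<lhd> (mult_of y \<otimes>\<^sub>M 1)"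
        unfolding mult_of_inject[symmetric] mult_of_mult_right[symmetric] mult_of_flip_W
        by (simp add: mult.assoc mult_tensor_mult mult_of_mult)
      then show ?thesis by (simp add: right_slice_rmult[OF phi_clinear] rmult_simps)
    qed
    show "?R (x * y) = x * ?R y" for x y
    proof -
      have "U (x * y) = (mult_of x \<otimes>\<^sub>M 1) \<rhd> U y"
        unfolding mult_of_inject[symmetric] mult_mult_of[symmetric] U
        by (simp add: mult_tensor_mult mult_of_mult flip: mult.assoc)
      then show ?thesis by (simp add: right_slice_lmult[OF phi_clinear] lmult_simps)
    qed
    show "x * ?L y = ?R x * y" for x y
    proof -
      have "(mult_of x \<otimes>\<^sub>M 1) \<rhd> tensor_flip (W (a \<otimes> y)) = U x \<lhd> (mult_of y \<otimes>\<^sub>M 1)"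
        unfolding mult_of_inject[symmetric] mult_mult_of[symmetric] mult_of_mult_right[symmetric]
          mult_of_flip_W U
        by (simp add: mult.assoc)
      then have "right_slice \<phi> ((mult_of x \<otimes>\<^sub>M 1) \<rhd> tensor_flip (W (a \<otimes> y))) =
          right_slice \<phi> (U x \<lhd> (mult_of y \<otimes>\<^sub>M 1))" by simp
      then show ?thesis
        by (simp only: right_slice_lmult[OF phi_clinear] right_slice_rmult[OF phi_clinear]
            lmult_simps rmult_simps)
    qed
  qed
  then have "Abs_multiplier (?L, ?R) \<rhd> r = ?L r"
    by (simp add: lmult.rep_eq Abs_multiplier_inverse)
  moreover have "slice_right \<phi> (\<Delta> a) = Abs_multiplier (?L, ?R)"
    by (simp add: slice_right_def Let_def U_def of_mult_mult_of flip: right_slice_def mult_of_flip_W)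
  moreover have "slice_right \<phi> (\<Delta> a) \<rhd> r = \<phi> a *\<^sub>C r"
    using integral by (simp add: left_integral_def lmult_simps)
  ultimately show ?thesis by simp
qed

text \<open>
  For \<open>w = h \<otimes> g\<close> the left-hand side is \<open>(\<iota> \<otimes> \<phi>)(\<Delta>(ah)(g \<otimes> 1))\<close>, so this is left invariance. It
  expresses every pairing with products and coproducts of the dual through \<open>W\<^sup>-\<^sup>1\<close>.
\<close>

lemma fourier: "right_slice \<phi> (\<Delta> a \<rhd> tensor_flip (W w)) = left_slice (\<lambda>x. \<phi> (a * x)) w"
  by (induct w rule: tensor_induct)
    (simp_all add: comult_lmult_flip_W left_invariance left_slice_tensor[OF phi_mult_clinear(2)]
      W_linear tensor_flip_linear lmult_linear right_slice_linear[OF phi_clinear]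
      left_slice_linear[OF phi_mult_clinear(2)])

text \<open>
  For \<open>b = \<phi>( \<cdot> c)\<close> this is the action \<open>b \<triangleright> w = w\<^sub>1 \<langle>w\<^sub>2, b\<rangle>\<close>.
\<close>

definition hat_act :: "'a \<Rightarrow> 'a \<Rightarrow> 'a"
  where "hat_act c w = right_slice \<phi> (T1 (w \<otimes> c))"

lemma hat_act_clinear: "clinear (hat_act c)"
  by (simp add: hat_act_def clinear_iff tensor_linear_simps T1_linear right_slice_linear[OF phi_clinear])

lemma W_hat_act: "W (tensor_map (hat_act c) (\<lambda>x. x) u) = tensor_map (hat_act c) (\<lambda>x. x) (W u)"
  using slice_equivariant[OF phi_clinear, of c u] by (simp add: hat_act_def[abs_def])

lemma right_slice_comult: "right_slice \<phi> (\<Delta> w \<rhd> (v \<otimes> c)) = hat_act c w * v"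
  by (simp add: comult_lmult_tensor right_slice_rmult[OF phi_clinear] rmult_simps hat_act_def)

text \<open>
  This is \<open>x \<otimes> q \<mapsto> \<epsilon>(x) q\<close> for the counit \<open>\<epsilon>\<close>, because \<open>W(x \<otimes> q) = x\<^sub>2 \<otimes> x\<^sub>1 q\<close> is sent to \<open>x q\<close>.
\<close>

definition counit_map :: "'a \<otimes> 'a \<Rightarrow> 'a"
  where "counit_map t = tensor_lift (*) (inv W t)"

lemma cbilinear_mult: "cbilinear ((*) :: 'a \<Rightarrow> 'a \<Rightarrow> 'a)"
  by (simp add: cbilinear_def clinear_iff tensor_linear_simps)

lemma counit_map_clinear: "clinear counit_map"
  unfolding counit_map_def[abs_def]
  by (rule clinear_compose[OF tensor_lift_clinear[OF cbilinear_mult] inv_W_clinear])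

lemma counit_map_W: "counit_map (W t) = tensor_lift (*) t"
  by (simp add: counit_map_def W_inv)

lemmas counit_map_linear = clinear_add[OF counit_map_clinear] clinear_scaleC[OF counit_map_clinear]

text \<open>
  The identity \<open>\<epsilon>(b \<triangleright> x) = \<langle>x, b\<rangle>\<close>. On \<open>t = W(w \<otimes> v)\<close> the action commutes with \<open>W\<close>, and both sides are
  \<open>(b \<triangleright> w) v\<close>.
\<close>

lemma counit_map_hat_act: "counit_map (tensor_map (hat_act c) (\<lambda>x. x) t) = left_slice (\<lambda>x. \<phi> (x * c)) t"
proof -
  have "counit_map (tensor_map (hat_act c) (\<lambda>x. x) (W u)) = left_slice (\<lambda>x. \<phi> (x * c)) (W u)" for u
  proof (induct u rule: tensor_induct)
    case (tensor w v)
    have "counit_map (tensor_map (hat_act c) (\<lambda>x. x) (W (w \<otimes> v))) = hat_act c w * v"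
      by (simp add: counit_map_W tensor_map_tensor[OF hat_act_clinear clinear_id(2)]
          tensor_lift_tensor[OF cbilinear_mult] flip: W_hat_act)
    also have "\<dots> = right_slice \<phi> (tensor_flip (W (w \<otimes> v)) \<lhd> (1 \<otimes>\<^sub>M mult_of c))"
      by (simp add: flip_W_rmult right_slice_rmult[OF phi_clinear] rmult_simps hat_act_def)
    also have "\<dots> = left_slice (\<lambda>x. \<phi> (x * c)) (W (w \<otimes> v))"
    proof -
      have "right_slice \<phi> (tensor_flip z \<lhd> (1 \<otimes>\<^sub>M mult_of c)) = left_slice (\<lambda>x. \<phi> (x * c)) z" for z :: "'a \<otimes> 'a"
        by (induct z rule: tensor_induct)
          (simp_all add: tensor_flip_linear tensor_flip_tensor rmult_linear right_slice_linear[OF phi_clinear]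
            rmult_mult_tensor_tensor rmult_simps right_slice_tensor[OF phi_clinear]
            left_slice_tensor[OF phi_mult_clinear(1)]
            left_slice_linear[OF phi_mult_clinear(1)])
      then show ?thesis .
    qed
    finally show ?case .
  qed (simp_all add: W_linear counit_map_linear tensor_map_linear[OF hat_act_clinear clinear_id(2)]
      left_slice_linear[OF phi_mult_clinear(1)])
  from this[of "inv W t"] show ?thesis by (simp add: W_inv)
qed

text \<open>
  Since \<open>T1\<close> is surjective, every \<open>m\<close> is a sum of elements \<open>b \<triangleright> w\<close>, where \<open>\<epsilon>\<close> has scalar values by
  the previous lemma.
\<close>

lemma counit_exists: "\<exists>k. \<forall>q. counit_map (m \<otimes> q) = k *\<^sub>C q"
proof -
  obtain y where y: "\<phi> y = 1" using phi_normalized by blast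
  obtain u where u: "m \<otimes> y = T1 u" using T1_surj by blast
  have "m = right_slice \<phi> (T1 u)"
    by (simp add: right_slice_tensor[OF phi_clinear] y scaleC_one flip: u)
  moreover have "counit_map (right_slice \<phi> (T1 u) \<otimes> q) = \<phi> (tensor_lift (*) u) *\<^sub>C q" for q
  proof (induct u rule: tensor_induct)
    case (tensor w c)
    show ?case
      using counit_map_hat_act[of c "w \<otimes> q"]
      by (simp add: tensor_map_tensor[OF hat_act_clinear clinear_id(2)] hat_act_def
          tensor_lift_tensor[OF cbilinear_mult] left_slice_tensor[OF phi_mult_clinear(1)])
  qed (simp_all add: T1_linear right_slice_linear[OF phi_clinear] tensor_linear_simps counit_map_linear phi_linear
      tensor_lift_add[OF cbilinear_mult] tensor_lift_scaleC[OF cbilinear_mult] scaleC_complex_def)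
  ultimately show ?thesis by blast
qed

text \<open>
  Left invariance gives \<open>(\<iota> \<otimes> \<phi>)(\<Delta>(x)\<Delta>(h)(g \<otimes> 1)) = \<phi>(x h) g = 0\<close>, and the elements \<open>\<Delta>(h)(g \<otimes> 1)\<close>
  span \<open>A \<otimes> A\<close>.
\<close>

lemma hat_act_null:
  assumes x: "\<And>c. \<phi> (x * c) = 0"
  shows "hat_act c x = 0"
proof (rule nondegenerate_left)
  fix v
  have "right_slice \<phi> (\<Delta> x \<rhd> tensor_flip (W (inv W (tensor_flip (v \<otimes> c))))) = 0"
    by (simp only: fourier x left_slice_zero)
  then show "hat_act c x * v = 0"
    by (simp add: W_inv tensor_flip_flip right_slice_comult)
qed

text \<open>
  The action of each \<open>\<phi>( \<cdot> c)\<close> on the first leg kills \<open>x \<otimes> y\<close>, hence also \<open>W\<^sup>-\<^sup>1(x \<otimes> y)\<close>. Applying the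
  counit to this leg shows that \<open>\<phi>( \<cdot> c)\<close> itself kills \<open>W\<^sup>-\<^sup>1(x \<otimes> y)\<close>, so that it is a sum of tensors
  \<open>w \<otimes> v\<close> with \<open>\<phi>(w \<cdot> ) = 0\<close>. Therefore \<open>\<epsilon>(x) \<phi>(y)\<close>, the sum of the \<open>\<phi>(w v)\<close>, vanishes.
\<close>

lemma counit_null:
  assumes x: "\<And>c. \<phi> (x * c) = 0"
  shows "counit_map (x \<otimes> q) = 0"
proof -
  let ?F = "range (\<lambda>c z. \<phi> (z * c))"
  obtain k where k: "\<And>q. counit_map (x \<otimes> q) = k *\<^sub>C q" using counit_exists by blast
  obtain y where y: "\<phi> y = 1" using phi_normalized by blast
  have "\<phi> (tensor_lift (*) (inv W (x \<otimes> y))) = 0"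
  proof (rule vanish_by_slices[of "\<lambda>t. \<phi> (tensor_lift (*) t)" ?F])
    show "clinear (\<lambda>t. \<phi> (tensor_lift (*) t))"
      by (rule clinear_compose[OF phi_clinear tensor_lift_clinear[OF cbilinear_mult]])
    show "\<phi> (tensor_lift (*) (a \<otimes> b)) = 0" if "\<And>f. f \<in> ?F \<Longrightarrow> f a = 0" for a b
      using that[of "\<lambda>z. \<phi> (z * b)"] by (simp add: tensor_lift_tensor[OF cbilinear_mult])
    have "left_slice (\<lambda>z. \<phi> (z * c)) (inv W (x \<otimes> y)) = 0" for c
    proof -
      have "W (tensor_map (hat_act c) (\<lambda>x. x) (inv W (x \<otimes> y))) = 0"
        by (simp add: W_hat_act W_inv tensor_map_tensor[OF hat_act_clinear clinear_id(2)] hat_act_null[OF x]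
            tensor_zero_left)
      then have "tensor_map (hat_act c) (\<lambda>x. x) (inv W (x \<otimes> y)) = 0"
        by (metis W_inv(2) clinear_zero inv_W_clinear)
      then show ?thesis
        by (metis counit_map_hat_act clinear_zero counit_map_clinear)
    qed
    then show "clinear f \<and> left_slice f (inv W (x \<otimes> y)) = 0" if "f \<in> ?F" for f
      using that phi_mult_clinear(1) by auto
  qed
  then have "k = 0"
    by (simp add: k y phi_linear scaleC_complex_def flip: counit_map_def)
  then show ?thesis by (simp add: k)
qed

text \<open>
  The first legs of \<open>W(x \<otimes> r) = x\<^sub>2 \<otimes> x\<^sub>1 r\<close> satisfy the hypothesis on \<open>x\<close> as well, so the counit kills
  them; but the counit sends \<open>W(x \<otimes> r)\<close> to \<open>x r\<close>.
\<close>

lemma faithful: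
  assumes x: "\<And>c. \<phi> (x * c) = 0"
  shows "x = 0"
proof (rule nondegenerate_left)
  fix r
  let ?F = "range (\<lambda>c z. \<phi> (z * c))"
  have "counit_map (W (x \<otimes> r)) = 0"
  proof (rule vanish_by_slices[OF counit_map_clinear, of ?F])
    have "left_slice (\<lambda>z. \<phi> (z * c)) (W (x \<otimes> r)) = counit_map (W (hat_act c x \<otimes> r))" for c
      by (simp add: tensor_map_tensor[OF hat_act_clinear clinear_id(2)] flip: counit_map_hat_act W_hat_act)
    then have "left_slice (\<lambda>z. \<phi> (z * c)) (W (x \<otimes> r)) = 0" for c
      by (simp add: hat_act_null[OF x] tensor_zero_left clinear_zero[OF W_clinear]
          clinear_zero[OF counit_map_clinear])
    then show "clinear f \<and> left_slice f (W (x \<otimes> r)) = 0" if "f \<in> ?F" for f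
      using that phi_mult_clinear(1) by auto
    show "counit_map (a \<otimes> b) = 0" if "\<And>f. f \<in> ?F \<Longrightarrow> f a = 0" for a b
    proof (rule counit_null)
      show "\<phi> (a * c) = 0" for c
        using that[of "\<lambda>z. \<phi> (z * c)"] by simp
    qed
  qed
  then show "x * r = 0"
    by (simp add: counit_map_W tensor_lift_tensor[OF cbilinear_mult])
qed

end

section \<open>Pairings of tensor products\<close>

lemma pairing_tensor_apply:
  assumes p: "cbilinear p" and q: "cbilinear q"
  shows pairing_tensor_left: "pairing_tensor p q (a \<otimes> b) t = q b (left_slice (p a) t)"
    and pairing_tensor_right: "pairing_tensor p q s (c \<otimes> d) = q (left_slice (\<lambda>a. p a c) s) d"
proof -
  have lin: "clinear (p a)" "clinear (\<lambda>a. p a c)" "clinear (q b)" "clinear (\<lambda>b. q b d)" for a b c d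
    using p q by (simp_all add: cbilinear_def)
  note lin_simps = clinear_add[OF lin(1)] clinear_add[OF lin(2)] clinear_add[OF lin(3)] clinear_add[OF lin(4)]
    clinear_scaleC[OF lin(1)] clinear_scaleC[OF lin(2)] clinear_scaleC[OF lin(3)]
    clinear_scaleC[OF lin(4)]
  have 1: "cbilinear (\<lambda>c d. p a c * q b d)" "cbilinear (\<lambda>a b. p a c * q b d)" for a b c d
    by (simp_all add: cbilinear_def clinear_iff lin_simps algebra_simps scaleC_complex_def)
  note 2 = cbilinear_lift_lift[OF 1]
  show left: "pairing_tensor p q (a \<otimes> b) t = q b (left_slice (p a) t)" for a b t
    unfolding pairing_tensor_def tensor_lift_tensor[OF 2]
    by (induct t rule: tensor_induct)
      (simp_all add: tensor_lift_tensor[OF 1(1)] tensor_lift_add[OF 1(1)] tensor_lift_scaleC[OF 1(1)]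
        left_slice_tensor[OF lin(1)] left_slice_linear[OF lin(1)] lin_simps scaleC_complex_def)
  show "pairing_tensor p q s (c \<otimes> d) = q (left_slice (\<lambda>a. p a c) s) d"
  proof (induct s rule: tensor_induct)
    case (tensor a b)
    show ?case
      by (simp add: left left_slice_tensor[OF lin(1)] left_slice_tensor[OF lin(2)] lin_simps)
  qed (simp_all add: pairing_tensor_def tensor_lift_add[OF 2] tensor_lift_scaleC[OF 2]
      left_slice_linear[OF lin(2)]
      lin_simps)
qed

section \<open>The dual in Fourier coordinates\<close>

locale dual_pair = multiplier_hopf_integral +
  fixes \<Delta>\<^sub>B :: "'b::nondegenerate_algebra \<Rightarrow> ('b \<otimes> 'b) multiplier"
    and p :: "'a \<Rightarrow> 'b \<Rightarrow> complex"
  assumes dual: "dual_of \<Delta> \<phi> \<Delta>\<^sub>B p"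
begin

lemma p_bilinear: "cbilinear p"
  using dual by (simp add: dual_of_def)

lemma p_clinear: "clinear (p a)" "clinear (\<lambda>a. p a b)"
  using p_bilinear by (simp_all add: cbilinear_def)

lemma p_separates_B:
  assumes "\<And>a. p a b = p a b'"
  shows "b = b'"
proof -
  have "inj (\<lambda>b a. p a b)" using dual by (simp add: dual_of_def bij_betw_def)
  then show ?thesis using assms by (auto dest: injD simp: fun_eq_iff)
qed

text \<open>
  The Fourier transform \<open>c \<mapsto> \<phi>( \<cdot> c)\<close>.
\<close>

definition hat :: "'a \<Rightarrow> 'b"
  where "hat c = (SOME b. \<forall>a. p a b = \<phi> (a * c))"

lemma p_hat: "p a (hat c) = \<phi> (a * c)"
proof -
  have "range (\<lambda>b a. p a b) = {\<lambda>a. \<phi> (a * c) | c. True}"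
    using dual by (simp add: dual_of_def bij_betw_def)
  then have "(\<lambda>a. \<phi> (a * c)) \<in> range (\<lambda>b a. p a b)" by blast
  then have "\<exists>b. \<forall>a. p a b = \<phi> (a * c)" by (metis (no_types, lifting) imageE)
  from someI_ex[OF this] show ?thesis unfolding hat_def by blast
qed

lemma hat_surj: "\<exists>c. b = hat c"
proof -
  have "range (\<lambda>b a. p a b) = {\<lambda>a. \<phi> (a * c) | c. True}"
    using dual by (simp add: dual_of_def bij_betw_def)
  then have "(\<lambda>a. p a b) \<in> {\<lambda>a. \<phi> (a * c) | c. True}" by blast
  then obtain c where "(\<lambda>a. p a b) = (\<lambda>a. \<phi> (a * c))" by blast
  then have "b = hat c" by (intro p_separates_B) (simp add: p_hat fun_eq_iff)
  then show ?thesis ..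
qed

lemma hat_clinear: "clinear hat"
  unfolding clinear_iff
  by (intro conjI allI; rule p_separates_B)
    (simp_all add: p_hat clinear_add[OF p_clinear(1)] clinear_scaleC[OF p_clinear(1)]
      tensor_linear_simps phi_linear)

lemmas hat_linear = clinear_add[OF hat_clinear] clinear_scaleC[OF hat_clinear]

lemma p_separates_A:
  assumes "\<And>b. p a b = p a' b"
  shows "a = a'"
proof -
  have "\<phi> ((a - a') * c) = 0" for c
    using assms[of "hat c"] by (simp add: p_hat left_diff_distrib clinear_diff[OF phi_clinear])
  then have "a - a' = 0" by (rule faithful)
  then show ?thesis by simp
qed

lemma p_zero: "p 0 b = 0" "p a 0 = 0"
  by (rule clinear_zero[OF p_clinear(2)], rule clinear_zero[OF p_clinear(1)])

lemma hat_mult: "p a (hat c * hat d) = \<phi> (right_slice \<phi> (\<Delta> a \<rhd> (c \<otimes> d)))"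
proof -
  have bil: "cbilinear (\<lambda>x y. \<phi> x * \<phi> y)"
    by (simp add: cbilinear_def clinear_iff phi_linear algebra_simps scaleC_complex_def)
  have "tensor_lift (\<lambda>x y. \<phi> x * \<phi> y) t = \<phi> (right_slice \<phi> t)" for t
    by (induct t rule: tensor_induct)
      (simp_all add: tensor_lift_tensor[OF bil] tensor_lift_add[OF bil] tensor_lift_scaleC[OF bil]
        right_slice_tensor[OF phi_clinear] right_slice_linear[OF phi_clinear] phi_linear scaleC_complex_def)
  moreover have "\<forall>b b' c c'. (\<forall>x. p x b = \<phi> (x * c)) \<and> (\<forall>x. p x b' = \<phi> (x * c')) \<longrightarrow>
      (\<forall>a. p a (b * b') = tensor_lift (\<lambda>x y. \<phi> x * \<phi> y) (\<Delta> a \<rhd> (c \<otimes> c')))"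
    using dual unfolding dual_of_def by (elim conjE) assumption
  ultimately show ?thesis by (simp add: p_hat)
qed

text \<open>
  Up to the Fourier transform this is \<open>b \<otimes> d \<mapsto> \<Delta>(b)(1 \<otimes> d)\<close> on \<open>B\<close> (lemma \<open>dual_comult_hat\<close>).
\<close>

definition G :: "'a \<otimes> 'a \<Rightarrow> 'a \<otimes> 'a"
  where "G = tensor_flip \<circ> inv W \<circ> tensor_flip"

lemma G_clinear: "clinear G"
  unfolding G_def by (intro clinear_comp tensor_flip_clinear inv_W_clinear)

lemma fourier_G: "right_slice \<phi> (\<Delta> a \<rhd> t) = right_slice (\<lambda>x. \<phi> (a * x)) (G t)"
  using fourier[of a "inv W (tensor_flip t)"]
  by (simp add: W_inv tensor_flip_flip G_def flip: slice_flip(1)[OF phi_mult_clinear(2)])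

lemma hat_mult_hat: "hat c * hat d = hat (left_slice \<phi> (G (c \<otimes> d)))"
  by (rule p_separates_B)
    (simp add: hat_mult fourier_G p_hat slice_slice[OF phi_clinear phi_mult_clinear(2)])

text \<open>
  Paired with \<open>a \<otimes> a'\<close>, the left-hand side is \<open>(\<phi> \<otimes> \<phi>)((a \<otimes> 1)\<Delta>(a')(c \<otimes> d))\<close> by the duality between \<open>\<Delta>\<^sub>B\<close>
  and \<open>\<Delta>\<close>; lemma \<open>fourier_G\<close> evaluates \<open>\<iota> \<otimes> \<phi>\<close> on it.
\<close>

lemma dual_comult_hat:
  "\<Delta>\<^sub>B (hat c) * (1 \<otimes>\<^sub>M mult_of (hat d)) = mult_of (tensor_map hat hat (G (c \<otimes> d)))"
proof -
  define X where "X = of_mult (\<Delta>\<^sub>B (hat c) * (1 \<otimes>\<^sub>M mult_of (hat d)))"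
  have X: "mult_of X = \<Delta>\<^sub>B (hat c) * (1 \<otimes>\<^sub>M mult_of (hat d))"
    unfolding X_def using dual by (intro mult_of_of_mult) (simp add: dual_of_def)
  have "X - tensor_map hat hat (G (c \<otimes> d)) = 0"
  proof (rule zero_by_left_slices[of "range p"])
    fix f assume "f \<in> range p"
    then obtain a where f: "f = p a" by blast
    have "p a' (left_slice (p a) X) = p a' (left_slice (p a) (tensor_map hat hat (G (c \<otimes> d))))" for a'
    proof -
      define Z where "Z = of_mult ((mult_of a \<otimes>\<^sub>M 1) * \<Delta> a')"
      have Z: "Z * t = (mult_of a \<otimes>\<^sub>M 1) \<rhd> \<Delta> a' \<rhd> t" for t
        using arg_cong[OF mult_of_of_mult[OF comult_range(2), of a a'], of "\<lambda>m. m \<rhd> t"]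
        by (simp add: Z_def lmult_simps)
      have hat2: "left_slice (p a) (tensor_map hat hat t) = hat (left_slice (\<lambda>x. \<phi> (a * x)) t)" for t
        by (induct t rule: tensor_induct)
          (simp_all add: tensor_map_tensor[OF hat_clinear hat_clinear]
            tensor_map_linear[OF hat_clinear hat_clinear]
            left_slice_tensor[OF p_clinear(1)] left_slice_tensor[OF phi_mult_clinear(2)]
            left_slice_linear[OF p_clinear(1)]
            left_slice_linear[OF phi_mult_clinear(2)]
            p_hat hat_linear)
      have phi2: "p (left_slice (\<lambda>x. p x (hat c)) z) (hat d) = \<phi> (right_slice \<phi> (z * (c \<otimes> d)))" for z
        by (induct z rule: tensor_induct)
          (simp_all add: p_hat left_slice_tensor[OF phi_mult_clinear(1)] tensor_linear_simps
            left_slice_linear[OF phi_mult_clinear(1)] tensor_mult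
            right_slice_linear[OF phi_clinear] right_slice_tensor[OF phi_clinear] phi_linear scaleC_complex_def)
      have "p a' (left_slice (p a) X) = pairing_tensor p p (a \<otimes> a') X"
        by (simp add: pairing_tensor_left[OF p_bilinear p_bilinear])
      also have "\<dots> = pairing_tensor p p Z (hat c \<otimes> hat d)"
        using dual by (simp add: dual_of_def X_def Z_def)
      also have "\<dots> = \<phi> (right_slice \<phi> (Z * (c \<otimes> d)))"
        by (simp add: pairing_tensor_right[OF p_bilinear p_bilinear] phi2)
      also have "\<dots> = \<phi> (a * right_slice (\<lambda>x. \<phi> (a' * x)) (G (c \<otimes> d)))"
        by (simp add: Z right_slice_lmult[OF phi_clinear] lmult_simps fourier_G)
      also have "\<dots> = \<phi> (a' * left_slice (\<lambda>x. \<phi> (a * x)) (G (c \<otimes> d)))"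
        by (rule slice_slice[OF phi_mult_clinear(2) phi_mult_clinear(2)])
      also have "\<dots> = p a' (left_slice (p a) (tensor_map hat hat (G (c \<otimes> d))))"
        by (simp add: hat2 p_hat)
      finally show ?thesis .
    qed
    then have "left_slice (p a) X = left_slice (p a) (tensor_map hat hat (G (c \<otimes> d)))"
      by (rule p_separates_B)
    then show "clinear f \<and> left_slice f (X - tensor_map hat hat (G (c \<otimes> d))) = 0"
      by (simp add: f p_clinear clinear_diff[OF left_slice_clinear[OF p_clinear(1)]])
  next
    show "x = 0" if "\<And>f. f \<in> range p \<Longrightarrow> f x = 0" for x
      using that by (intro p_separates_B) (simp add: p_zero)
  qed
  then show ?thesis by (simp add: X[symmetric])
qed

lemma dual_act_hat: "dual_act p (hat c) a = hat_act c a"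
  unfolding dual_act_def
proof (rule the_equality)
  show *: "\<forall>b'. p (hat_act c a) b' = p a (b' * hat c)"
  proof
    fix b' obtain d where "b' = hat d" using hat_surj by blast
    then show "p (hat_act c a) b' = p a (b' * hat c)"
      by (simp add: hat_mult p_hat right_slice_comult)
  qed
  show "x = hat_act c a" if "\<forall>b'. p x b' = p a (b' * hat c)" for x
    using that * by (intro p_separates_A) simp
qed

lemma act_dual_hat: "act_dual p a (hat d) = hat (a * d)"
  unfolding act_dual_def
proof (rule the_equality)
  show *: "\<forall>a'. p a' (hat (a * d)) = p (a' * a) (hat d)"
    by (simp add: p_hat mult.assoc)
  show "y = hat (a * d)" if "\<forall>a'. p a' y = p (a' * a) (hat d)" for y
    using that * by (intro p_separates_B) simp
qed

text \<open>
  The pairing of \<open>V(\<phi>( \<cdot> c) \<otimes> a)\<close> with \<open>a' \<otimes> \<phi>( \<cdot> d)\<close> is \<open>\<langle>V, (\<phi>( \<cdot> c) \<triangleright> a') \<otimes> (a \<triangleright> \<phi>( \<cdot> d))\<rangle>\<close>, which by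
  the choice of \<open>V\<close> is \<open>\<phi>((\<phi>( \<cdot> c) \<triangleright> a') a d)\<close>. Finally
  \<open>(\<phi>( \<cdot> c) \<triangleright> a') a = (\<iota> \<otimes> \<phi>)(\<Delta>(a')(a \<otimes> c))\<close> is evaluated by lemma \<open>fourier\<close>.
\<close>

lemma multiplicative_unitary_hat:
  assumes P: "extended_pairing p P" and V: "\<And>a b. P V (a \<otimes> b) = p a b"
  shows "V \<rhd> (hat c \<otimes> a) = tensor_map hat (\<lambda>x. x) (inv W (c \<otimes> a))"
proof -
  let ?Y = "tensor_map hat (\<lambda>x. x) (inv W (c \<otimes> a))"
  have q: "cbilinear (\<lambda>b a. p a b)" using p_bilinear by (simp add: cbilinear_def)
  have "V \<rhd> (hat c \<otimes> a) - ?Y = 0"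
  proof (rule zero_by_left_slices[of "range p"])
    fix f assume "f \<in> range p"
    then obtain a' where f: "f = p a'" by blast
    have "p (left_slice (p a') (V \<rhd> (hat c \<otimes> a))) b' = p (left_slice (p a') ?Y) b'" for b'
    proof -
      obtain d where b': "b' = hat d" using hat_surj by blast
      have hat1: "left_slice (p a') (tensor_map hat (\<lambda>x. x) t) = left_slice (\<lambda>x. \<phi> (a' * x)) t"
        for t :: "'a \<otimes> 'a"
        by (induct t rule: tensor_induct)
          (simp_all add: tensor_map_tensor[OF hat_clinear clinear_id(2)]
            tensor_map_linear[OF hat_clinear clinear_id(2)]
            left_slice_tensor[OF p_clinear(1)] left_slice_tensor[OF phi_mult_clinear(2)]
            left_slice_linear[OF p_clinear(1)]
            left_slice_linear[OF phi_mult_clinear(2)] p_hat)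
      have "p (left_slice (p a') (V \<rhd> (hat c \<otimes> a))) b' =
          pairing_tensor (\<lambda>b a. p a b) p (V \<rhd> (hat c \<otimes> a)) (a' \<otimes> b')"
        by (simp add: pairing_tensor_right[OF q p_bilinear])
      also have "\<dots> = P V (dual_act p (hat c) a' \<otimes> act_dual p a b')"
        using P by (simp add: extended_pairing_def Let_def)
      also have "\<dots> = \<phi> (hat_act c a' * a * d)"
        by (simp add: V dual_act_hat b' act_dual_hat p_hat mult.assoc)
      also have "hat_act c a' * a = left_slice (\<lambda>x. \<phi> (a' * x)) (inv W (c \<otimes> a))"
        using fourier[of a' "inv W (c \<otimes> a)"]
        by (simp add: W_inv tensor_flip_tensor right_slice_comult)
      finally show ?thesis by (simp add: hat1 b' p_hat)
    qed
    then have "left_slice (p a') (V \<rhd> (hat c \<otimes> a)) = left_slice (p a') ?Y"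
      by (rule p_separates_A)
    then show "clinear f \<and> left_slice f (V \<rhd> (hat c \<otimes> a) - ?Y) = 0"
      by (simp add: f p_clinear clinear_diff[OF left_slice_clinear[OF p_clinear(1)]])
  next
    show "x = 0" if "\<And>f. f \<in> range p \<Longrightarrow> f x = 0" for x
      using that by (intro p_separates_B) (simp add: p_zero)
  qed
  then show ?thesis by simp
qed

lemma pentagon_G: "leg12_map G (leg13_map G (leg23_map G t)) = leg23_map G (leg12_map G t)"
  using arg_cong[OF pentagon_inv[of "rev3 t"], of rev3]
  by (simp add: rev3_leg12_map[OF inv_W_clinear] rev3_leg13_map[OF inv_W_clinear]
      rev3_leg23_map[OF inv_W_clinear] rev3_rev3 flip: G_def)

lemma G_surj: "\<exists>z. t = G z"
proof
  show "t = G (tensor_flip (W (tensor_flip t)))"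
    by (simp add: G_def tensor_flip_flip W_inv)
qed

abbreviation (input) hat2 where "hat2 \<equiv> tensor_map hat hat"

lemmas hat2_clinear = tensor_map_clinear[OF hat_clinear hat_clinear]
lemmas hat2_linear = clinear_add[OF hat2_clinear] clinear_scaleC[OF hat2_clinear]
lemmas G_linear = clinear_add[OF G_clinear] clinear_scaleC[OF G_clinear]

lemma dual_comult_clinear: "clinear \<Delta>\<^sub>B"
  unfolding clinear_iff
proof (intro conjI allI)
  fix b b' :: 'b and k
  obtain c c' where b: "b = hat c" "b' = hat c'" using hat_surj by metis
  show "\<Delta>\<^sub>B (b + b') = \<Delta>\<^sub>B b + \<Delta>\<^sub>B b'"
  proof (rule multiplier_cancel_right_leg2)
    fix e obtain d where "e = hat d" using hat_surj by blast
    then show "\<Delta>\<^sub>B (b + b') * (1 \<otimes>\<^sub>M mult_of e) = (\<Delta>\<^sub>B b + \<Delta>\<^sub>B b') * (1 \<otimes>\<^sub>M mult_of e)"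
      by (simp add: b dual_comult_hat distrib_right tensor_add_left G_linear hat2_linear mult_of_linear
          flip: hat_linear)
  qed
  show "\<Delta>\<^sub>B (k *\<^sub>C b) = k *\<^sub>C \<Delta>\<^sub>B b"
  proof (rule multiplier_cancel_right_leg2)
    fix e obtain d where "e = hat d" using hat_surj by blast
    then show "\<Delta>\<^sub>B (k *\<^sub>C b) * (1 \<otimes>\<^sub>M mult_of e) = (k *\<^sub>C \<Delta>\<^sub>B b) * (1 \<otimes>\<^sub>M mult_of e)"
      by (simp add: b dual_comult_hat mult_scaleC_left tensor_scaleC_left G_linear hat2_linear
          mult_of_linear flip: hat_linear)
  qed
qed

text \<open>
  Since \<open>\<Delta>\<^sub>B(b)(u \<otimes> v) = (\<Delta>\<^sub>B(b)(1 \<otimes> v))(u \<otimes> 1)\<close>, the action of \<open>\<Delta>\<^sub>B(b)\<close> is \<open>G\<close> on the outer legs of \<open>b \<otimes> u \<otimes> v\<close>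
  followed by the product \<open>(\<phi> \<otimes> \<iota>) G\<close> of the first two.
\<close>

lemma dual_comult_mult_of:
  "\<Delta>\<^sub>B (hat c) * mult_of (hat2 z) =
    mult_of (hat2 (left_slice \<phi> (leg12_map G (leg13_map G (c \<otimes> z)))))"
proof (induct z rule: tensor_induct)
  case (tensor u v)
  have *: "mult_of (hat2 y) * (mult_of (hat u) \<otimes>\<^sub>M 1) =
      mult_of (hat2 (left_slice \<phi> (leg12_map G (tensor_flip23 (tensor_assoc (y \<otimes> u))))))" for y
  proof (induct y rule: tensor_induct)
    case (tensor x x')
    show ?case
      by (simp add: tensor_assoc_tensor tensor_flip23_tensor leg12_map_tensor[OF G_clinear] left_slice_assoc[OF phi_clinear]
          tensor_map_tensor[OF hat_clinear hat_clinear] mult_tensor_mult flip: mult_tensor_mult_of)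
        (simp add: hat_mult_hat flip: mult_of_mult)
  qed (simp_all add: hat2_linear multiplier_linear_simps tensor_linear_simps tensor_assoc_linear
      tensor_flip23_linear
      leg12_map_linear[OF G_clinear]
      left_slice_linear[OF phi_clinear])
  have "mult_of (hat2 (u \<otimes> v)) = (1 \<otimes>\<^sub>M mult_of (hat v)) * (mult_of (hat u) \<otimes>\<^sub>M 1)"
    by (simp add: tensor_map_tensor[OF hat_clinear hat_clinear] mult_tensor_mult mult_tensor_mult_of)
  then have "\<Delta>\<^sub>B (hat c) * mult_of (hat2 (u \<otimes> v)) = mult_of (hat2 (G (c \<otimes> v))) * (mult_of (hat u) \<otimes>\<^sub>M 1)"
    by (simp only: dual_comult_hat flip: mult.assoc)
  then show ?case
    by (simp add: * leg13_map_tensor[OF G_clinear])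
qed (simp_all add: hat2_linear multiplier_linear_simps tensor_linear_simps
      leg12_map_linear[OF G_clinear]
      leg13_map_linear[OF G_clinear]
      left_slice_linear[OF phi_clinear])

text \<open>
  With \<open>\<phi>\<close> applied to the first leg, \<open>G\<^sub>1\<^sub>2 G\<^sub>1\<^sub>3 G\<^sub>2\<^sub>3\<close> becomes \<open>\<Delta>\<^sub>B(b) \<Delta>\<^sub>B(b') (1 \<otimes> e)\<close> and \<open>G\<^sub>2\<^sub>3 G\<^sub>1\<^sub>2\<close> becomes
  \<open>\<Delta>\<^sub>B(b b') (1 \<otimes> e)\<close>.
\<close>

lemma dual_comult_mult: "\<Delta>\<^sub>B (b * b') = \<Delta>\<^sub>B b * \<Delta>\<^sub>B b'"
proof (rule multiplier_cancel_right_leg2)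
  fix e
  obtain c c' d where b: "b = hat c" "b' = hat c'" "e = hat d" using hat_surj by metis
  have "\<Delta>\<^sub>B b * \<Delta>\<^sub>B b' * (1 \<otimes>\<^sub>M mult_of e) = \<Delta>\<^sub>B (hat c) * mult_of (hat2 (G (c' \<otimes> d)))"
    by (simp add: b mult.assoc dual_comult_hat)
  also have "\<dots> = mult_of (hat2 (left_slice \<phi> (leg12_map G (leg13_map G (leg23_map G (c \<otimes> c' \<otimes> d))))))"
    by (simp add: dual_comult_mult_of leg23_map_tensor[OF G_clinear])
  also have "\<dots> = mult_of (hat2 (G (left_slice \<phi> (G (c \<otimes> c')) \<otimes> d)))"
    by (simp add: pentagon_G left_slice_leg23_map[OF phi_clinear G_clinear]
        leg12_map_tensor[OF G_clinear] left_slice_assoc[OF phi_clinear])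
  also have "\<dots> = \<Delta>\<^sub>B (b * b') * (1 \<otimes>\<^sub>M mult_of e)"
    by (simp add: b hat_mult_hat dual_comult_hat)
  finally show "\<Delta>\<^sub>B (b * b') * (1 \<otimes>\<^sub>M mult_of e) = \<Delta>\<^sub>B b * \<Delta>\<^sub>B b' * (1 \<otimes>\<^sub>M mult_of e)" ..
qed

section \<open>The comultiplications of the multiplicative unitary\<close>

text \<open>
  The products \<open>(\<Delta>\<^sub>B(b) \<otimes> a)(1 \<otimes> d \<otimes> 1)\<close> span \<open>B \<otimes> B \<otimes> C\<close> because \<open>G\<close> and the Fourier transform are
  surjective.
\<close>

lemma comult_id_dense:
  fixes m n :: "('b \<otimes> 'b \<otimes> 'c::nondegenerate_algebra) multiplier"
  assumes eq: "\<And>x. m * comult_id \<Delta>\<^sub>B x = n * comult_id \<Delta>\<^sub>B x"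
  shows "m = n"
proof (rule multiplier_eqI)
  have *: "m \<rhd> tensor_assoc (hat2 (G z) \<otimes> a) = n \<rhd> tensor_assoc (hat2 (G z) \<otimes> a)" for z a
  proof (induct z rule: tensor_induct)
    case (tensor c d)
    have one: "1 \<otimes>\<^sub>M mult_of (hat d) \<otimes>\<^sub>M 1 =
        multiplier_iso tensor_assoc (((1 :: 'b multiplier) \<otimes>\<^sub>M mult_of (hat d)) \<otimes>\<^sub>M (1 :: 'c multiplier))"
      by (simp add: assoc_iso_mult_tensor)
    have "mult_of (tensor_assoc (hat2 (G (c \<otimes> d)) \<otimes> a)) =
        comult_id \<Delta>\<^sub>B (hat c \<otimes> a) * (1 \<otimes>\<^sub>M mult_of (hat d) \<otimes>\<^sub>M 1)"
      unfolding one
      by (simp add: comult_id_apply[OF dual_comult_clinear] mult_tensor_mult dual_comult_hat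
          flip: mult_tensor_mult_of assoc_iso_hom(1,2))
    then have "m * mult_of (tensor_assoc (hat2 (G (c \<otimes> d)) \<otimes> a)) =
        n * mult_of (tensor_assoc (hat2 (G (c \<otimes> d)) \<otimes> a))"
      by (simp only: eq flip: mult.assoc)
    then show ?case by (simp add: mult_mult_of mult_of_inject)
  qed (simp_all add: G_linear hat2_linear tensor_linear_simps tensor_assoc_linear lmult_linear)
  have "m \<rhd> (b \<otimes> b' \<otimes> a) = n \<rhd> (b \<otimes> b' \<otimes> a)" for b b' a
  proof -
    obtain c d where b: "b = hat c" "b' = hat d" using hat_surj by metis
    obtain z where "c \<otimes> d = G z" using G_surj by blast
    then have "hat2 (G z) = b \<otimes> b'"
      by (simp add: b tensor_map_tensor[OF hat_clinear hat_clinear] flip: \<open>c \<otimes> d = G z\<close>)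
    with *[of z a] show ?thesis by (simp add: tensor_assoc_tensor)
  qed
  then show "m \<rhd> x = n \<rhd> x" for x
    by (rule clinear_tensor_eqI3[OF lmult_clinear lmult_clinear])
qed

context
  fixes V :: "('b \<otimes> 'a) multiplier"
  assumes V: "V \<rhd> (hat c \<otimes> a) = tensor_map hat (\<lambda>x. x) (inv W (c \<otimes> a))"
begin

abbreviation (input) "hat1 \<equiv> tensor_map hat (\<lambda>x. x)"

lemmas hat1_clinear = tensor_map_clinear[OF hat_clinear clinear_id(2)]
lemmas hat1_linear = clinear_add[OF hat1_clinear] clinear_scaleC[OF hat1_clinear]

text \<open>
  Covered by \<open>y\<close> in the second leg, \<open>(\<iota> \<otimes> \<Delta>)(b \<otimes> a)\<close> becomes \<open>\<sigma>\<^sub>2\<^sub>3 W\<^sub>2\<^sub>3 (b \<otimes> a \<otimes> y)\<close>, and the claim becomes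
  \<open>W\<^sub>1\<^sub>2\<^sup>-\<^sup>1 W\<^sub>1\<^sub>3\<^sup>-\<^sup>1 \<sigma>\<^sub>2\<^sub>3 W\<^sub>2\<^sub>3 = \<sigma>\<^sub>2\<^sub>3 W\<^sub>2\<^sub>3 W\<^sub>1\<^sub>2\<^sup>-\<^sup>1\<close>. Moving the flip to the left gives \<open>pentagon_mixed\<close>.
\<close>

lemma id_comult_unitary: "multiplier_extension (id_comult \<Delta>) V = leg12 V * leg13 V"
proof (rule multiplier_extension_eqI)
  show "id_comult \<Delta> (x * y) = id_comult \<Delta> x * id_comult \<Delta> y" for x y :: "'b \<otimes> 'a"
    by (rule id_comult_mult[OF comult_clinear comult_mult])
  show "m = n" if "\<And>x. m * id_comult \<Delta> x = n * id_comult \<Delta> x" for m n :: "('b \<otimes> 'a \<otimes> 'a) multiplier"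
    using that by (rule id_comult_dense)
  let ?j = "tensor_map hat (tensor_map (\<lambda>x. x) (\<lambda>x. x)) :: 'a \<otimes> 'a \<otimes> 'a \<Rightarrow> _"
  have TW: "clinear (\<lambda>x. tensor_flip (W x))" by (rule clinear_compose[OF tensor_flip_clinear W_clinear])
  have j: "clinear ?j" by (intro tensor_map_clinear hat_clinear clinear_id)
  note lins = j tensor_assoc_clinear leg23_map_clinear[OF TW]
  have id_comult_hat: "id_comult \<Delta> (hat1 s) * (1 \<otimes>\<^sub>M mult_of y \<otimes>\<^sub>M 1) =
      mult_of (?j (leg23_map (\<lambda>x. tensor_flip (W x)) (tensor_assoc (s \<otimes> y))))" for s y
  proof (induct s rule: tensor_induct)
    case (tensor c a)
    have "?j (c \<otimes> t) = hat c \<otimes> t" for c t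
      using tensor_map_tensor[OF hat_clinear tensor_map_clinear[OF clinear_id(2) clinear_id(2)], of c t]
      by (simp add: tensor_map_ident)
    then show ?case
      by (simp add: tensor_map_tensor[OF hat_clinear clinear_id(2)] id_comult_apply[OF comult_clinear]
          mult_tensor_mult mult_tensor_mult_of tensor_assoc_tensor leg23_map_tensor[OF TW]
          flip: mult_of_flip_W)
  qed (simp_all add: hat1_linear id_comult_linear[OF comult_clinear] multiplier_linear_simps
      tensor_linear_simps lins[THEN clinear_add] lins[THEN clinear_scaleC])
  have legs: "leg12 V \<rhd> leg13 V \<rhd> ?j t = ?j (leg12_map (inv W) (leg13_map (inv W) t))" for t
    by (simp add: lmult_leg12 lmult_leg13 V
        leg13_map_natural[OF lmult_clinear inv_W_clinear hat_clinear clinear_id(2) clinear_id(2)]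
        leg12_map_natural[OF lmult_clinear inv_W_clinear hat_clinear clinear_id(2) clinear_id(2)])
  have split: "leg23_map (\<lambda>x. tensor_flip (W x)) t = tensor_flip23 (leg23_map W t)" for t
    using leg23_map_comp[OF tensor_flip_clinear W_clinear, of t]
    by (simp add: tensor_flip23_def leg23_map_def[of tensor_flip] o_def)
  have pent: "leg12_map (inv W) (leg13_map (inv W) (tensor_flip23 (leg23_map W t))) =
      tensor_flip23 (leg23_map W (leg12_map (inv W) t))" for t
    by (simp add: leg13_map_def tensor_flip23_flip23 flip: pentagon_mixed)
  show "leg12 V * leg13 V * id_comult \<Delta> x = id_comult \<Delta> (V \<rhd> x)" for x
  proof (induct x rule: tensor_induct)
    case (tensor b a)
    obtain c where b: "b = hat c" using hat_surj by blast
    show ?case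
    proof (rule multiplier_cancel_right_leg2_of_3)
      fix y
      have "id_comult \<Delta> (V \<rhd> (b \<otimes> a)) * (1 \<otimes>\<^sub>M mult_of y \<otimes>\<^sub>M 1) =
          mult_of (?j (tensor_flip23 (leg23_map W (leg12_map (inv W) (c \<otimes> a \<otimes> y)))))"
        by (simp add: b V id_comult_hat split leg12_map_tensor[OF inv_W_clinear])
      moreover have "id_comult \<Delta> (b \<otimes> a) * (1 \<otimes>\<^sub>M mult_of y \<otimes>\<^sub>M 1) =
          mult_of (?j (tensor_flip23 (leg23_map W (c \<otimes> a \<otimes> y))))"
        using id_comult_hat[of "c \<otimes> a" y]
        by (simp add: b split tensor_map_tensor[OF hat_clinear clinear_id(2)] tensor_assoc_tensor)
      ultimately show "leg12 V * leg13 V * id_comult \<Delta> (b \<otimes> a) * (1 \<otimes>\<^sub>M mult_of y \<otimes>\<^sub>M 1) =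
          id_comult \<Delta> (V \<rhd> (b \<otimes> a)) * (1 \<otimes>\<^sub>M mult_of y \<otimes>\<^sub>M 1)"
        by (simp only: mult.assoc) (simp only: mult_mult_of legs pent)
    qed
  qed (simp_all add: lmult_linear id_comult_linear[OF comult_clinear] multiplier_linear_simps)
qed

text \<open>
  Covered by \<open>d\<close> in the second leg, \<open>(\<Delta>\<^sub>B \<otimes> \<iota>)(b \<otimes> a)\<close> becomes \<open>G\<^sub>1\<^sub>2 (b \<otimes> d \<otimes> a)\<close>, and the claim becomes
  \<open>W\<^sub>1\<^sub>3\<^sup>-\<^sup>1 W\<^sub>2\<^sub>3\<^sup>-\<^sup>1 G\<^sub>1\<^sub>2 = G\<^sub>1\<^sub>2 W\<^sub>1\<^sub>3\<^sup>-\<^sup>1\<close>. As \<open>G = \<sigma> W\<^sup>-\<^sup>1 \<sigma>\<close>, moving both flips \<open>\<sigma>\<^sub>1\<^sub>2\<close> to the left gives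
  \<open>pentagon_inv\<close>.
\<close>

lemma comult_id_unitary: "multiplier_extension (comult_id \<Delta>\<^sub>B) V = leg13 V * leg23 V"
proof (rule multiplier_extension_eqI)
  show "comult_id \<Delta>\<^sub>B (x * y) = comult_id \<Delta>\<^sub>B x * comult_id \<Delta>\<^sub>B y" for x y :: "'b \<otimes> 'a"
    by (rule comult_id_mult[OF dual_comult_clinear dual_comult_mult])
  show "m = n" if "\<And>x. m * comult_id \<Delta>\<^sub>B x = n * comult_id \<Delta>\<^sub>B x" for m n :: "('b \<otimes> 'b \<otimes> 'a) multiplier"
    using that by (rule comult_id_dense)
  let ?k = "tensor_map hat (tensor_map hat (\<lambda>x. x)) :: 'a \<otimes> 'a \<otimes> 'a \<Rightarrow> _"
  have k: "clinear ?k" by (intro tensor_map_clinear hat_clinear clinear_id)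
  note lins = k tensor_assoc_clinear tensor_flip23_clinear leg12_map_clinear[OF G_clinear]
  have comult_id_hat: "comult_id \<Delta>\<^sub>B (hat1 s) * (1 \<otimes>\<^sub>M mult_of (hat d) \<otimes>\<^sub>M 1) =
      mult_of (?k (leg12_map G (tensor_flip23 (tensor_assoc (s \<otimes> d)))))" for s d
  proof (induct s rule: tensor_induct)
    case (tensor c a)
    have one: "1 \<otimes>\<^sub>M mult_of (hat d) \<otimes>\<^sub>M 1 =
        multiplier_iso tensor_assoc (((1 :: 'b multiplier) \<otimes>\<^sub>M mult_of (hat d)) \<otimes>\<^sub>M (1 :: 'a multiplier))"
      by (simp add: assoc_iso_mult_tensor)
    have "comult_id \<Delta>\<^sub>B (hat c \<otimes> a) * (1 \<otimes>\<^sub>M mult_of (hat d) \<otimes>\<^sub>M 1) =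
        mult_of (tensor_assoc (hat2 (G (c \<otimes> d)) \<otimes> a))"
      unfolding one
      by (simp add: comult_id_apply[OF dual_comult_clinear] mult_tensor_mult dual_comult_hat
          flip: mult_tensor_mult_of assoc_iso_hom(1,2))
    then show ?case
      using tensor_assoc_map[OF hat_clinear hat_clinear clinear_id(2), of "G (c \<otimes> d)" a]
      by (simp add: tensor_map_tensor[OF hat_clinear clinear_id(2)] tensor_assoc_tensor
          tensor_flip23_tensor leg12_map_tensor[OF G_clinear])
  qed (simp_all add: hat1_linear comult_id_linear[OF dual_comult_clinear] multiplier_linear_simps
      tensor_linear_simps lins[THEN clinear_add] lins[THEN clinear_scaleC])
  have legs: "leg13 V \<rhd> leg23 V \<rhd> ?k t = ?k (leg13_map (inv W) (leg23_map (inv W) t))" for t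
    by (simp add: lmult_leg13 lmult_leg23 V
        leg23_map_natural[OF lmult_clinear inv_W_clinear hat_clinear clinear_id(2) hat_clinear]
        leg13_map_natural[OF lmult_clinear inv_W_clinear hat_clinear clinear_id(2) hat_clinear])
  have split: "leg12_map G t =
      leg12_map tensor_flip (leg12_map (inv W) (leg12_map tensor_flip t))" for t
    by (simp add: G_def leg12_map_comp tensor_flip_clinear inv_W_clinear clinear_comp comp_assoc)
  have pent: "leg13_map (inv W) (leg23_map (inv W) (leg12_map G t)) =
      leg12_map G (leg13_map (inv W) t)" for t
    unfolding split
    by (simp add: leg23_map_flip12[OF inv_W_clinear] leg13_map_flip12[OF inv_W_clinear] pentagon_inv)
  show "leg13 V * leg23 V * comult_id \<Delta>\<^sub>B x = comult_id \<Delta>\<^sub>B (V \<rhd> x)" for x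
  proof (induct x rule: tensor_induct)
    case (tensor b a)
    obtain c where b: "b = hat c" using hat_surj by blast
    show ?case
    proof (rule multiplier_cancel_right_leg2_of_3)
      fix y obtain d where y: "y = hat d" using hat_surj by blast
      have "comult_id \<Delta>\<^sub>B (V \<rhd> (b \<otimes> a)) * (1 \<otimes>\<^sub>M mult_of y \<otimes>\<^sub>M 1) =
          mult_of (?k (leg12_map G (leg13_map (inv W) (c \<otimes> d \<otimes> a))))"
        by (simp add: b y V comult_id_hat leg13_map_tensor[OF inv_W_clinear])
      moreover have "comult_id \<Delta>\<^sub>B (b \<otimes> a) * (1 \<otimes>\<^sub>M mult_of y \<otimes>\<^sub>M 1) =
          mult_of (?k (leg12_map G (c \<otimes> d \<otimes> a)))"
        using comult_id_hat[of "c \<otimes> a" d]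
        by (simp add: b y tensor_map_tensor[OF hat_clinear clinear_id(2)] tensor_assoc_tensor
            tensor_flip23_tensor)
      ultimately show "leg13 V * leg23 V * comult_id \<Delta>\<^sub>B (b \<otimes> a) * (1 \<otimes>\<^sub>M mult_of y \<otimes>\<^sub>M 1) =
          comult_id \<Delta>\<^sub>B (V \<rhd> (b \<otimes> a)) * (1 \<otimes>\<^sub>M mult_of y \<otimes>\<^sub>M 1)"
        by (simp only: mult.assoc) (simp only: mult_mult_of legs pent)
    qed
  qed (simp_all add: lmult_linear comult_id_linear[OF dual_comult_clinear] multiplier_linear_simps)
qed

end

end

theorem proposition3p11:
  fixes \<Delta> :: "'a::nondegenerate_algebra \<Rightarrow> ('a \<otimes> 'a) multiplier"
    and \<phi> :: "'a \<Rightarrow> complex"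
    and \<Delta>\<^sub>B :: "'b::nondegenerate_algebra \<Rightarrow> ('b \<otimes> 'b) multiplier"
    and p :: "'a \<Rightarrow> 'b \<Rightarrow> complex"
    and P :: "('b \<otimes> 'a) multiplier \<Rightarrow> 'a \<otimes> 'b \<Rightarrow> complex"
    and V :: "('b \<otimes> 'a) multiplier"
  assumes "algebraic_quantum_group \<Delta>"
    and "left_integral \<Delta> \<phi>"
    and "dual_of \<Delta> \<phi> \<Delta>\<^sub>B p"
    and "extended_pairing p P"
    and "\<And>a b. P V (a \<otimes> b) = p a b"
  shows "multiplier_extension (id_comult \<Delta>) V = leg12 V * leg13 V \<and>
    multiplier_extension (comult_id \<Delta>\<^sub>B) V = leg13 V * leg23 V"
proof -
  interpret dual_pair \<Delta> \<phi> \<Delta>\<^sub>B p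
    using assms(1-3) by unfold_locales (simp_all add: algebraic_quantum_group_def)
  note V = multiplicative_unitary_hat[OF assms(4,5)]
  show ?thesis using id_comult_unitary[OF V] comult_id_unitary[OF V] by blast
qed

end
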